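(* Let $Q$ be an $n\times n$-matrix-valued function that is meromorphic on $\mathbb{C}$ and such that all poles of $Q$ are real. Suppose that $Q$ is $\#$-real, that $Q|_{\mathbb{C}_+}$ is of bounded type, and that $\limsup_{\eta\to+\infty}\frac{\|Q(i\eta)\|}{\eta}<+\infty$. Then the following statements are equivalent: (i) $Q$ is Herglotz. (ii) For every $m\in\{1,\dots,n\}$ and every $\mathbf{i}\in I_{n,m}$, the function $f_{\mathbf{i}}:=\det Q_{\mathbf{i}}$ satisfies at least one of the following properties: (a) $f_{\mathbf{i}}$ satisfies the $m$-interlacing condition; if $f_{\mathbf{i}}$ has a pole of multiplicity $m$, there is $z^*\in\mathbb{R}$ such that $\lim_{z\to z^*}\big[(z^*-z)^m f_{\mathbf{i}}(z)\big]>0$; and the limit $\lim_{\eta\to+\infty}\frac{f_{\mathbf{i}}(i\eta)}{(i\eta)^m}$ (which exists in this situation) is nonnegative. (b) $f_{\mathbf{i}}$ can be represented as the product of $m$ scalar-valued meromorphic Herglotz functions. (c) $f_{\mathbf{i}}|_{\mathbb{C}_+}$ has a holomorphic logarithm $u$ (i.e. $u$ is holomorphic on $\mathbb{C}_+$ with $e^{u}=f_{\mathbf{i}}$ there) satisfying $\operatorname{Im}u(z)\in(0,m\pi)$ for all $z\in\mathbb{C}_+$. (iii) For every $\mathbf{i}\in I_{n,1}\cup I_{n,2}$, the function $\det Q_{\mathbf{i}}$ satisfies the $|\mathbf{i}|$-interlacing condition. For every $\mathbf{i}\in I_{n,2}$, if $\det Q_{\mathbf{i}}$ has a pole of multiplicity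 $2$, there is $z^*\in\mathbb{R}$ such that $\lim_{z\to z^*}\big[(z^*-z)^2\det Q_{\mathbf{i}}(z)\big]>0$. All residues of $Q$ are negative semi-definite, and $D:=\lim_{\eta\to+\infty}\frac{\operatorname{Im}Q(i\eta)}{\eta}$ (which exists in this situation) is positive semi-definite. Moreover, if (i)-(iii) hold, then in (ii) all of (a), (b), (c) hold whenever $f_{\mathbf{i}}$ is not constant.
   Context: $\mathbb{C}_{\pm}=\{z\in\mathbb{C}:\pm\operatorname{Im}z>0\}$. For a square complex matrix $M$: $\operatorname{Re}M=\frac12(M+M^* )$, $\operatorname{Im}M=\frac1{2i}(M-M^* )$, and $M\ge 0$ means $M$ is positive semi-definite. For a $\mathbb{C}^{n\times n}$-valued function $f$ on $\Omega\subseteq\mathbb{C}$, $f^{\#}(z):=f(\overline z)^*$ whenever $\overline z\in\Omega$; $f$ is $\#$-real if $\Omega$ is symmetric with respect to $\mathbb{R}$ and $f=f^{\#}$ on $\Omega$ (for meromorphic $f$, away from poles). A Herglotz function is a function $Q:\mathbb{C}\setminus\mathbb{R}\to\mathbb{C}^{n\times n}$ that is holomorphic, $\#$-real, and satisfies $\operatorname{Im}Q(z)\ge 0$ for all $z\in\mathbb{C}_+$. If it admits a meromorphic continuation to all of $\mathbb{C}$ it is called a meromorphic Herglotz function, and the continuation is denoted by the same letter. A function meromorphic on $\mathbb{C}$ with only real poles is said to be Herglotz if its restriction to $\mathbb{C}\setminus\mathbb{R}$ is. A scalar meromorphic function on $\mathbb{C}_+$ is of bounded type if it can be written as $g/h$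 with $g,h$ bounded and analytic on $\mathbb{C}_+$. A matrix-valued function is of bounded type if all its entries are. Divisor: for a scalar meromorphic $f\not\equiv0$, $\theta_f(z)=k$ if $z$ is a zero of multiplicity $k$, $\theta_f(z)=-k$ if $z$ is a pole of multiplicity $k$, and $\theta_f(z)=0$ otherwise. For $k\in\mathbb{N}$, a function $f$ meromorphic on an open set $\Omega\supseteq\mathbb{R}$ satisfies the $k$-interlacing condition if $f\not\equiv 0$, all zeros and poles of $f$ are real, and $\big|\sum_{x\in(a,b)}\theta_f(x)\big|\le k$ for all $-\infty<a<b<+\infty$. $I_{n,m}=\{(i_1,\dots,i_m)\in\mathbb{N}^m: 1\le i_1<\dots<i_m\le n\}$ (so $I_{n,2}=\emptyset$ if $n=1$), and $|\mathbf{i}|=m$ for $\mathbf{i}\in I_{n,m}$. For $M=(m_{ij})\in\mathbb{C}^{n\times n}$ and $\mathbf{i}\in I_{n,m}$, $M_{\mathbf{i}}=(m_{i_k i_l})_{k,l=1}^m$ is the corresponding principal submatrix; $Q_{\mathbf{i}}$ is defined pointwise.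
   Formalization: In (iii), det Q_i for |i| ≤ 2 is allowed to vanish identically instead of satisfying the |i|-interlacing condition (which demands f ≢ 0); as literally stated (i)⇒(iii) fails, e.g. for n = 1 and Q = 0. *)

theory Defs
  imports
    "HOL-Complex_Analysis.Complex_Analysis"
    "Jordan_Normal_Form.Determinant"
    "Jordan_Normal_Form.Schur_Decomposition"
begin

definition upper_half_plane :: "complex set" where
  "upper_half_plane = {z. 0 < Im z}"

definition mat_Im :: "complex mat \<Rightarrow> complex mat" where
  "mat_Im M = (1 / (2 * \<i>)) \<cdot>\<^sub>m (M - mat_adjoint M)"

text \<open>The order on complex numbers is the one with \<open>0 \<le> w\<close> iff \<open>w\<close> is real and nonnegative, so
  the condition below forces \<open>M\<close> to be Hermitian.\<close>

definition psd :: "nat \<Rightarrow> complex mat \<Rightarrow> bool" where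
  "psd n M \<longleftrightarrow> M \<in> carrier_mat n n \<and> (\<forall>v \<in> carrier_vec n. 0 \<le> (M *\<^sub>v v) \<bullet>c v)"

definition frobenius_norm :: "complex mat \<Rightarrow> real" where
  "frobenius_norm M = sqrt (\<Sum>i<dim_row M. \<Sum>j<dim_col M. (cmod (M $$ (i, j)))\<^sup>2)"


definition sharp :: "(complex \<Rightarrow> complex mat) \<Rightarrow> complex \<Rightarrow> complex mat" where
  "sharp F z = mat_adjoint (F (cnj z))"

definition sharp_real_on :: "complex set \<Rightarrow> (complex \<Rightarrow> complex mat) \<Rightarrow> bool" where
  "sharp_real_on \<Omega> F \<longleftrightarrow> (\<forall>z\<in>\<Omega>. cnj z \<in> \<Omega>) \<and> (\<forall>z\<in>\<Omega>. F z = sharp F z)"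

text \<open>A meromorphic function is a total function on the complex plane that is analytic off its poles
  (no removable singularities are left over); at a pole the entry concerned has the dummy
  value 0, which is the convention of \<open>nicely_meromorphic_on\<close>.\<close>

definition mat_meromorphic :: "nat \<Rightarrow> (complex \<Rightarrow> complex mat) \<Rightarrow> bool" where
  "mat_meromorphic n Q \<longleftrightarrow> (\<forall>z. Q z \<in> carrier_mat n n) \<and>
     (\<forall>i<n. \<forall>j<n. (\<lambda>z. Q z $$ (i, j)) nicely_meromorphic_on UNIV)"

definition mat_poles :: "nat \<Rightarrow> (complex \<Rightarrow> complex mat) \<Rightarrow> complex set" where
  "mat_poles n Q = {z. \<exists>i<n. \<exists>j<n. is_pole (\<lambda>w. Q w $$ (i, j)) z}"

definition mat_residue :: "nat \<Rightarrow> (complex \<Rightarrow> complex mat) \<Rightarrow> complex \<Rightarrow> complex mat" where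
  "mat_residue n Q z = mat n n (\<lambda>(i, j). residue (\<lambda>w. Q w $$ (i, j)) z)"

text \<open>Only the values off the real line matter, so for a function that is meromorphic on the whole
  plane this speaks about its restriction to the complement of the real line.\<close>

definition herglotz :: "nat \<Rightarrow> (complex \<Rightarrow> complex mat) \<Rightarrow> bool" where
  "herglotz n Q \<longleftrightarrow>
     (\<forall>z \<in> - \<real>. Q z \<in> carrier_mat n n) \<and>
     (\<forall>i<n. \<forall>j<n. (\<lambda>z. Q z $$ (i, j)) holomorphic_on - \<real>) \<and>
     sharp_real_on (- \<real>) Q \<and>
     (\<forall>z \<in> upper_half_plane. psd n (mat_Im (Q z)))"

definition scalar_meromorphic_herglotz :: "(complex \<Rightarrow> complex) \<Rightarrow> bool" where
  "scalar_meromorphic_herglotz g \<longleftrightarrow>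
     g nicely_meromorphic_on UNIV \<and> herglotz 1 (\<lambda>z. mat 1 1 (\<lambda>_. g z))"

definition bounded_type :: "(complex \<Rightarrow> complex) \<Rightarrow> bool" where
  "bounded_type f \<longleftrightarrow> f nicely_meromorphic_on upper_half_plane \<and>
     (\<exists>g h. g holomorphic_on upper_half_plane \<and> bounded (g ` upper_half_plane) \<and>
            h holomorphic_on upper_half_plane \<and> bounded (h ` upper_half_plane) \<and>
            (\<exists>z\<in>upper_half_plane. h z \<noteq> 0) \<and>
            (\<forall>z\<in>upper_half_plane. h z \<noteq> 0 \<longrightarrow> f z = g z / h z))"

definition mat_bounded_type :: "nat \<Rightarrow> (complex \<Rightarrow> complex mat) \<Rightarrow> bool" where
  "mat_bounded_type n Q \<longleftrightarrow> (\<forall>i<n. \<forall>j<n. bounded_type (\<lambda>z. Q z $$ (i, j)))"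


text \<open>The divisor of a meromorphic \<open>f\<close> that does not vanish identically is \<open>zorder f\<close>: the multiplicity
  at a zero, minus the multiplicity at a pole, and 0 elsewhere.  The sum over the points of
  \<open>(a, b)\<close> is restricted to the finitely many nonzero terms because \<open>sum\<close> is 0 on infinite sets.\<close>

definition interlacing :: "complex set \<Rightarrow> nat \<Rightarrow> (complex \<Rightarrow> complex) \<Rightarrow> bool" where
  "interlacing \<Omega> k f \<longleftrightarrow>
     open \<Omega> \<and> \<real> \<subseteq> \<Omega> \<and> f nicely_meromorphic_on \<Omega> \<and>
     (\<exists>z\<in>\<Omega>. f z \<noteq> 0) \<and>
     (\<forall>z\<in>\<Omega>. f z = 0 \<or> is_pole f z \<longrightarrow> z \<in> \<real>) \<and>
     (\<forall>a b :: real. a < b \<longrightarrow>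
        \<bar>\<Sum>x | a < x \<and> x < b \<and> zorder f (of_real x) \<noteq> 0. zorder f (of_real x)\<bar> \<le> int k)"

text \<open>\<open>interlacing\<close> excludes the zero function, but a Herglotz function may have principal minors that
  vanish identically (for example \<open>Q = 0\<close>); the variant below tolerates this case.\<close>

definition interlacing_or_zero :: "complex set \<Rightarrow> nat \<Rightarrow> (complex \<Rightarrow> complex) \<Rightarrow> bool" where
  "interlacing_or_zero \<Omega> k f \<longleftrightarrow> (\<forall>z\<in>\<Omega>. f z = 0) \<or> interlacing \<Omega> k f"

definition has_pole_of_mult :: "nat \<Rightarrow> (complex \<Rightarrow> complex) \<Rightarrow> bool" where
  "has_pole_of_mult m f \<longleftrightarrow> (\<exists>z. is_pole f z \<and> zorder f z = - int m)"

definition pole_sign_condition :: "nat \<Rightarrow> (complex \<Rightarrow> complex) \<Rightarrow> bool" where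
  "pole_sign_condition m f \<longleftrightarrow> (has_pole_of_mult m f \<longrightarrow>
     (\<exists>x L :: real. 0 < L \<and>
        ((\<lambda>z. (of_real x - z) ^ m * f z) \<longlongrightarrow> of_real L) (at (of_real x))))"

definition leading_limit :: "nat \<Rightarrow> (complex \<Rightarrow> complex) \<Rightarrow> complex \<Rightarrow> bool" where
  "leading_limit m f L \<longleftrightarrow>
     ((\<lambda>\<eta>::real. f (\<i> * of_real \<eta>) / (\<i> * of_real \<eta>) ^ m) \<longlongrightarrow> L) at_top"


text \<open>Indices run over \<open>{0..<n}\<close>, following the indexing of \<open>mat\<close>.\<close>

definition index_tuples :: "nat \<Rightarrow> nat \<Rightarrow> nat list set" where
  "index_tuples n m = {idx. length idx = m \<and> sorted_wrt (<) idx \<and> set idx \<subseteq> {0..<n}}"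

definition principal_submatrix :: "complex mat \<Rightarrow> nat list \<Rightarrow> complex mat" where
  "principal_submatrix M idx = mat (length idx) (length idx) (\<lambda>(k, l). M $$ (idx ! k, idx ! l))"

text \<open>The pointwise determinant is meaningless at the poles of \<open>Q\<close>, where it is evaluated on dummy
  values; \<open>remove_sings\<close> turns it into the meromorphic function it represents.\<close>

definition minor_fun :: "(complex \<Rightarrow> complex mat) \<Rightarrow> nat list \<Rightarrow> complex \<Rightarrow> complex" where
  "minor_fun Q idx = remove_sings (\<lambda>z. Determinant.det (principal_submatrix (Q z) idx))"


definition prop_a :: "nat \<Rightarrow> (complex \<Rightarrow> complex) \<Rightarrow> bool" where
  "prop_a m f \<longleftrightarrow> interlacing UNIV m f \<and> pole_sign_condition m f \<and>
     (\<exists>L::real. 0 \<le> L \<and> leading_limit m f (of_real L))"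

text \<open>The identity of meromorphic functions is stated off the real line, where no factor has a pole.\<close>

definition prop_b :: "nat \<Rightarrow> (complex \<Rightarrow> complex) \<Rightarrow> bool" where
  "prop_b m f \<longleftrightarrow> (\<exists>g :: nat \<Rightarrow> complex \<Rightarrow> complex.
     (\<forall>j<m. scalar_meromorphic_herglotz (g j)) \<and> (\<forall>z \<in> - \<real>. f z = (\<Prod>j<m. g j z)))"

definition prop_c :: "nat \<Rightarrow> (complex \<Rightarrow> complex) \<Rightarrow> bool" where
  "prop_c m f \<longleftrightarrow> (\<exists>u. u holomorphic_on upper_half_plane \<and>
     (\<forall>z \<in> upper_half_plane. exp (u z) = f z) \<and>
     (\<forall>z \<in> upper_half_plane. 0 < Im (u z) \<and> Im (u z) < real m * pi))"

definition minors_condition :: "nat \<Rightarrow> (complex \<Rightarrow> complex mat) \<Rightarrow> bool" where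
  "minors_condition n Q \<longleftrightarrow> (\<forall>m \<in> {1..n}. \<forall>idx \<in> index_tuples n m.
     prop_a m (minor_fun Q idx) \<or> prop_b m (minor_fun Q idx) \<or> prop_c m (minor_fun Q idx))"

definition small_minors_condition :: "nat \<Rightarrow> (complex \<Rightarrow> complex mat) \<Rightarrow> bool" where
  "small_minors_condition n Q \<longleftrightarrow>
     (\<forall>idx \<in> index_tuples n 1 \<union> index_tuples n 2.
        interlacing_or_zero UNIV (length idx) (minor_fun Q idx)) \<and>
     (\<forall>idx \<in> index_tuples n 2. pole_sign_condition 2 (minor_fun Q idx))"

definition residues_nsd :: "nat \<Rightarrow> (complex \<Rightarrow> complex mat) \<Rightarrow> bool" where
  "residues_nsd n Q \<longleftrightarrow> (\<forall>z \<in> mat_poles n Q. psd n (- mat_residue n Q z))"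

definition Im_growth_limit :: "nat \<Rightarrow> (complex \<Rightarrow> complex mat) \<Rightarrow> complex mat \<Rightarrow> bool" where
  "Im_growth_limit n Q D \<longleftrightarrow> D \<in> carrier_mat n n \<and>
     (\<forall>i<n. \<forall>j<n. ((\<lambda>\<eta>::real. mat_Im (Q (\<i> * of_real \<eta>)) $$ (i, j) / of_real \<eta>)
        \<longlongrightarrow> D $$ (i, j)) at_top)"

end

(*
  Let f be real meromorphic without nonreal zeros and poles. Seen from the upper half plane, the boundary values
  of Im (log f) on the real line form a step function that jumps by - pi times the divisor of f. Hence f is
  m-interlacing iff this step function oscillates by at most m pi. If f is of bounded type, a Phragmen--Lindelof
  argument extends the bounds to the half plane: N pi <= Im (log f) <= (N + m) pi, so that f = +-phi^m
  with Im phi >= 0. The orders and signs of the poles of f and its behaviour at infinity are read off from this.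

  If Q is Herglotz, elimination with Schur complements, which are again Herglotz, writes every minor as a product
  of scalar Herglotz functions. Conversely, the conditions on the minors of size 1 and 2 make all poles of Q simple
  and bound its entries by C |z + i|^2 / Im z. If moreover the residues are negative semi-definite, then for every
  vector v the function F = v* Q v satisfies liminf Im F >= 0 at all real points, and Phragmen--Lindelof shows that
  F - b z has nonnegative imaginary part, where b is the limit of F(i eta) / (i eta). Under condition (ii),
  positivity of the residues and of the linear term follows from the principal minors.
*)
theory Submission
  imports Defs "HOL-Real_Asymp.Real_Asymp"
begin

section \<open>Holomorphic functions on the upper half plane\<close>

text \<open>No integral representation of Herglotz functions is used. The quantitative input is
  Schwarz's lemma: a function with nonnegative imaginary part is bounded by a multiple of
  \<open>(cmod (z + \<i>))\<^sup>2 / Im z\<close>, and so is the logarithm of a zero-free bounded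
  denominator. This majorant blows up at the real axis as well as at infinity, so Phragmen-Lindelof
  in half discs only gives bounds up to a term linear in \<open>Im z\<close>. That term is dealt
  with separately: for the argument of a minor by comparison along rays, for an off-diagonal entry
  by the growth hypothesis on the imaginary axis; for the form of Q at a vector it is genuine, and
  the condition at infinity decides its sign. An off-diagonal entry is not a minor. Only the product
  of the entries (i, j) and (j, i) is controlled, and the two factors are comparable only near real
  points, where reflection exchanges them. Interlacing leaves open the sign in front of the m-th
  power, written \<open>cos (of_int N * pi)\<close>; the sign conditions at poles and at infinity
  settle it wherever it matters.\<close>

abbreviation UHP :: "complex set" where "UHP \<equiv> upper_half_plane"

lemma UHP_iff [simp]: "z \<in> UHP \<longleftrightarrow> 0 < Im z"
  by (simp add: upper_half_plane_def)

lemma open_UHP [simp]: "open UHP"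
  by (simp add: upper_half_plane_def open_halfspace_Im_gt)

lemma convex_UHP [simp]: "convex UHP"
  by (simp add: upper_half_plane_def convex_halfspace_Im_gt)

lemma connected_UHP [simp]: "connected UHP"
  by (simp add: convex_connected)

lemma UHP_nonreal: "z \<in> UHP \<Longrightarrow> z \<notin> \<real>"
  by (auto simp: complex_is_Real_iff)

lemma eventually_in_UHP: "\<forall>\<^sub>F z in at w within UHP. z \<in> UHP"
  by (simp add: eventually_at_filter)

text \<open>Makes the majorant \<open>(cmod (z + \<i>))\<^sup>2 / Im z\<close> at least 1 on the
  half plane, so that additive constants can be absorbed into it.\<close>

lemma Im_le_cmod_add_i:
  assumes "z \<in> UHP"
  shows "Im z \<le> (cmod (z + \<i>))\<^sup>2"
proof -
  have "Im z \<le> (Im z + 1)\<^sup>2"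
    using assms by (simp add: power2_eq_square algebra_simps)
  also have "\<dots> \<le> (cmod (z + \<i>))\<^sup>2"
    by (simp add: cmod_power2)
  finally show ?thesis .
qed

lemma analytic_at_nonreal:
  assumes "g holomorphic_on - \<real>" "z \<notin> \<real>"
  shows "g analytic_on {z}"
  using assms by (intro analytic_at[THEN iffD2] exI[of _ "-\<real>"]) (auto simp: closed_complex_Reals open_Compl)

text \<open>Since f need not extend to the frontier, the maximum principle is applied to a
  superlevel set of \<open>cmod (f z)\<close>. The frontier bound keeps the closure of that set
  inside U, where f is continuous.\<close>

lemma maximum_modulus_limsup:
  assumes "open U" "bounded U" "f holomorphic_on U"
    and bd: "\<And>\<zeta> e. \<zeta> \<in> frontier U \<Longrightarrow> e > 0 \<Longrightarrow> \<forall>\<^sub>F z in at \<zeta> within U. cmod (f z) < B + e"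
    and "w \<in> U"
  shows "cmod (f w) \<le> B"
proof (rule ccontr)
  assume "\<not> cmod (f w) \<le> B"
  define e where "e = (cmod (f w) - B) / 2"
  have "e > 0" "B + e < cmod (f w)"
    using \<open>\<not> cmod (f w) \<le> B\<close> by (auto simp: e_def field_simps)
  define V where "V = {z\<in>U. cmod (f z) > B + e}"
  have contf: "continuous_on U f"
    using assms(3) by (rule holomorphic_on_imp_continuous_on)
  have V: "V = U \<inter> (\<lambda>z. cmod (f z)) -` {B + e<..}"
    by (auto simp: V_def)
  have "open V"
    unfolding V using contf \<open>open U\<close>
    by (intro continuous_open_preimage continuous_intros) auto
  have clV: "closure V \<subseteq> U"
  proof
    fix \<zeta> assume z: "\<zeta> \<in> closure V"
    show "\<zeta> \<in> U"
    proof (rule ccontr)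
      assume nU: "\<zeta> \<notin> U"
      have "\<zeta> \<in> closure U"
        using z closure_mono[of V U] by (auto simp: V_def)
      then have "\<zeta> \<in> frontier U"
        using nU \<open>open U\<close> by (simp add: frontier_def interior_open)
      then have "\<forall>\<^sub>F z in at \<zeta> within U. cmod (f z) < B + e"
        using bd \<open>e > 0\<close> by blast
      then obtain d where d: "d > 0" "\<And>z. z \<in> U \<Longrightarrow> z \<noteq> \<zeta> \<Longrightarrow> dist z \<zeta> < d \<Longrightarrow> cmod (f z) < B + e"
        unfolding eventually_at by blast
      obtain y where "y \<in> V" "dist y \<zeta> < d"
        using z \<open>d > 0\<close> closure_approachable by blast
      then show False
        using d(2)[of y] nU by (auto simp: V_def)
    qed
  qed
  have "cmod (f w) \<le> B + e"
  proof (rule maximum_modulus_frontier[where S = V and f = f and \<xi> = w])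
    show "f holomorphic_on interior V"
      using \<open>open V\<close> assms(3) by (intro holomorphic_on_subset[OF assms(3)]) (auto simp: interior_open V_def)
    show "continuous_on (closure V) f"
      using clV contf continuous_on_subset by blast
    show "bounded V"
      using \<open>bounded U\<close> by (rule bounded_subset) (auto simp: V_def)
    show "w \<in> V"
      using \<open>w \<in> U\<close> \<open>B + e < cmod (f w)\<close> by (simp add: V_def)
    fix z assume "z \<in> frontier V"
    then have "z \<in> U" "z \<notin> V"
      using clV \<open>open V\<close> by (auto simp: frontier_def interior_open)
    then show "cmod (f z) \<le> B + e"
      by (simp add: V_def)
  qed
  then show False
    using \<open>B + e < cmod (f w)\<close> by simp
qed

subsection \<open>Functions with nonnegative imaginary part\<close>

definition pick :: "(complex \<Rightarrow> complex) \<Rightarrow> bool" where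
  "pick g \<longleftrightarrow> g holomorphic_on UHP \<and> (\<forall>z\<in>UHP. 0 \<le> Im (g z))"

text \<open>The quotient \<open>cmod (a - b) / cmod (a - cnj b)\<close> is the pseudo-hyperbolic
  distance of the half plane; this identity computes one minus its square.\<close>

lemma cmod_diff_cnj:
  "(cmod (a - cnj b))\<^sup>2 = (cmod (a - b))\<^sup>2 + 4 * Im a * Im b"
  unfolding cmod_power2 by (simp add: power2_eq_square algebra_simps)

lemma cmod_diff_cnj_less:
  assumes "Im a > 0" "Im b > 0"
  shows "cmod (a - b) < cmod (a - cnj b)" "a - cnj b \<noteq> 0"
proof -
  have "(cmod (a - b))\<^sup>2 < (cmod (a - cnj b))\<^sup>2"
    using assms by (simp add: cmod_diff_cnj)
  then show "cmod (a - b) < cmod (a - cnj b)"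
    by (rule power2_less_imp_less) simp
  then show "a - cnj b \<noteq> 0"
    by auto
qed

text \<open>The map is the inverse of the Cayley transform sending z to
  \<open>(z - a) / (z - cnj a)\<close>; it carries the unit disc to the half plane and 0 to
  a.\<close>

lemma cayley_UHP:
  assumes "Im a > 0" "cmod \<zeta> < 1"
  shows "1 - \<zeta> \<noteq> 0" "Im ((a - cnj a * \<zeta>) / (1 - \<zeta>)) > 0"
proof -
  show nz: "1 - \<zeta> \<noteq> 0"
    using assms by auto
  have "Im ((a - cnj a * \<zeta>) / (1 - \<zeta>)) = Im a * (1 - (cmod \<zeta>)\<^sup>2) / (cmod (1 - \<zeta>))\<^sup>2"
    unfolding cmod_power2 Im_divide by (simp add: power2_eq_square algebra_simps)
  moreover have "(cmod \<zeta>)\<^sup>2 < 1"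
    using assms by (simp add: power_less_one_iff abs_square_less_1)
  ultimately show "Im ((a - cnj a * \<zeta>) / (1 - \<zeta>)) > 0"
    using assms nz by simp
qed

text \<open>Schwarz's lemma for the disc, transported by the Cayley transform that moves a to
  0.\<close>

lemma schwarz_UHP:
  assumes "h holomorphic_on UHP" "\<And>z. z \<in> UHP \<Longrightarrow> cmod (h z) \<le> 1" "a \<in> UHP" "h a = 0" "z \<in> UHP"
  shows "cmod (h z) * cmod (z - cnj a) \<le> cmod (z - a)"
proof -
  define \<phi> where "\<phi> = (\<lambda>\<zeta>. (a - cnj a * \<zeta>) / (1 - \<zeta>))"
  define w where "w = (z - a) / (z - cnj a)"
  have ne: "z - cnj a \<noteq> 0" and lt: "cmod (z - a) < cmod (z - cnj a)"
    using cmod_diff_cnj_less[of z a] assms by auto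
  have w1: "cmod w < 1"
    using lt by (simp add: w_def norm_divide divide_simps)
  have "1 - w = (a - cnj a) / (z - cnj a)"
    using ne by (simp add: w_def field_simps)
  moreover have "a - cnj a * w = z * (a - cnj a) / (z - cnj a)"
    using ne by (simp add: w_def field_simps)
  moreover have "a - cnj a \<noteq> 0"
    using assms(3) by (auto simp: complex_eq_iff)
  ultimately have \<phi>w: "\<phi> w = z"
    unfolding \<phi>_def using ne by simp
  have \<phi>: "\<phi> holomorphic_on ball 0 1" "\<phi> \<in> ball 0 1 \<rightarrow> UHP"
    using cayley_UHP[of a] assms(3) unfolding \<phi>_def
    by (force intro!: holomorphic_intros)+
  \<comment> \<open>Scaling by s < 1 turns the weak bound on h into the strict one that Schwarz's
    lemma requires; s tends to 1 afterwards.\<close>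
  have *: "s * cmod (h z) \<le> cmod w" if "0 < s" "s < 1" for s :: real
  proof -
    have "cmod ((\<lambda>\<zeta>. of_real s * h (\<phi> \<zeta>)) w) \<le> cmod w"
    proof (rule Schwarz_Lemma(1)[where f = "\<lambda>\<zeta>. of_real s * h (\<phi> \<zeta>)" and \<xi> = w])
      show "(\<lambda>\<zeta>. of_real s * h (\<phi> \<zeta>)) holomorphic_on ball 0 1"
        by (intro holomorphic_intros holomorphic_on_compose_gen[OF \<phi>(1) assms(1), unfolded o_def])
          (use \<phi>(2) in auto)
      show "of_real s * h (\<phi> 0) = 0"
        using assms by (simp add: \<phi>_def)
      fix \<zeta> :: complex assume "cmod \<zeta> < 1"
      then have "cmod (h (\<phi> \<zeta>)) \<le> 1"
        using \<phi>(2) assms(2) by (auto simp: Pi_iff)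
      then have "s * cmod (h (\<phi> \<zeta>)) \<le> s * 1"
        using that by (intro mult_left_mono) auto
      then show "cmod (of_real s * h (\<phi> \<zeta>)) < 1"
        using that unfolding norm_mult norm_of_real by linarith
    qed (use w1 in auto)
    then show ?thesis
      using that by (simp add: \<phi>w norm_mult)
  qed
  have "1 * cmod (h z) \<le> cmod w"
  proof (rule tendsto_upperbound)
    show "((\<lambda>s. s * cmod (h z)) \<longlongrightarrow> 1 * cmod (h z)) (at_left (1::real))"
      by (intro tendsto_intros)
    show "\<forall>\<^sub>F s in at_left (1::real). s * cmod (h z) \<le> cmod w"
      using * by (auto simp: eventually_at_left_field intro!: exI[of _ 0])
  qed auto
  then show ?thesis
    using ne by (simp add: w_def norm_divide divide_simps)
qed

text \<open>A nonconstant g has an open image, and an open subset of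
  \<open>{w. c \<le> Im w}\<close> has no point on the line \<open>Im w = c\<close>.\<close>

lemma open_map_Im_strict:
  assumes "g holomorphic_on UHP" "\<And>z. z \<in> UHP \<Longrightarrow> c \<le> Im (g z)" "z \<in> UHP" "Im (g z) = c"
  shows "g constant_on UHP"
proof (rule ccontr)
  assume "\<not> g constant_on UHP"
  then have "open (g ` UHP)"
    using open_mapping_thm[OF assms(1), of UHP] by simp
  then obtain e where e: "e > 0" "ball (g z) e \<subseteq> g ` UHP"
    using assms(3) open_contains_ball by (metis imageI)
  have "g z - \<i> * of_real (e/2) \<in> ball (g z) e"
    using e by (simp add: dist_norm norm_mult)
  then obtain w where "w \<in> UHP" "g w = g z - \<i> * of_real (e/2)"
    using e by (metis imageE subsetD)
  then have "Im (g w) = c - e/2"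
    using assms(4) by simp
  then show False
    using assms(2)[OF \<open>w \<in> UHP\<close>] e by simp
qed

text \<open>Schwarz's lemma applied to \<open>(g z - g z0) / (g z - cnj (g z0))\<close>. The base
  point is left free: choosing it so that \<open>Im (g z0) / Im z0\<close> is small is what later
  identifies the linear part of g.\<close>

lemma pick_bound_at:
  assumes "pick g" "z \<in> UHP" "z0 \<in> UHP"
  shows "cmod (g z - of_real (Re (g z0))) \<le> Im (g z0) * (cmod (z - cnj z0))\<^sup>2 / (Im z * Im z0)"
proof (cases "Im (g z0) = 0")
  case True
  then have "g constant_on UHP"
    using open_map_Im_strict[of g 0 z0] assms by (auto simp: pick_def)
  then have "g z = g z0"
    using assms by (auto simp: constant_on_def)
  then show ?thesis
    using True by (simp add: complex_eq_iff)
next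
  case False
  have hol: "g holomorphic_on UHP" and nn: "\<And>z. z \<in> UHP \<Longrightarrow> Im (g z) \<ge> 0"
    using assms(1) by (auto simp: pick_def)
  define t where "t = Im (g z0)"
  have t: "t > 0"
    using False nn[OF assms(3)] by (simp add: t_def)
  have ne: "g w - cnj (g z0) \<noteq> 0" and le: "cmod (g w - g z0) \<le> cmod (g w - cnj (g z0))" if "w \<in> UHP" for w
  proof -
    have "Im (g w - cnj (g z0)) > 0"
      using t nn[OF that] by (simp add: t_def)
    then show "g w - cnj (g z0) \<noteq> 0"
      by auto
    have "(cmod (g w - g z0))\<^sup>2 \<le> (cmod (g w - cnj (g z0)))\<^sup>2"
      using t nn[OF that] by (simp add: cmod_diff_cnj t_def)
    then show "cmod (g w - g z0) \<le> cmod (g w - cnj (g z0))"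
      using power2_le_imp_le norm_ge_zero by blast
  qed
  define d where "d = cmod (z - z0) / cmod (z - cnj z0)"
  have zz: "cmod (z - z0) < cmod (z - cnj z0)" "z - cnj z0 \<noteq> 0"
    using cmod_diff_cnj_less[of z z0] assms by auto
  then have d: "0 \<le> d" "d < 1"
    by (auto simp: d_def divide_simps)
  have "cmod ((g z - g z0) / (g z - cnj (g z0))) * cmod (z - cnj z0) \<le> cmod (z - z0)"
  proof (rule schwarz_UHP[where h = "\<lambda>z. (g z - g z0) / (g z - cnj (g z0))"])
    show "(\<lambda>z. (g z - g z0) / (g z - cnj (g z0))) holomorphic_on UHP"
      using ne by (intro holomorphic_intros hol) auto
    show "cmod ((g w - g z0) / (g w - cnj (g z0))) \<le> 1" if "w \<in> UHP" for w
      using ne[OF that] le[OF that] by (simp add: norm_divide)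
  qed (use assms in auto)
  then have main: "cmod (g z - g z0) \<le> d * cmod (g z - cnj (g z0))"
    using ne[OF assms(2)] zz(2) by (simp add: norm_divide d_def field_simps)
  define a where "a = cmod (g z - of_real (Re (g z0)))"
  have eq: "g z0 = of_real (Re (g z0)) + \<i> * of_real t" "cnj (g z0) = of_real (Re (g z0)) - \<i> * of_real t"
    by (auto simp: complex_eq_iff t_def)
  have "a \<le> cmod (g z - g z0) + t"
  proof -
    have "g z - of_real (Re (g z0)) = (g z - g z0) + \<i> * of_real t"
      by (subst (2) eq(1)) simp
    then show ?thesis
      using norm_triangle_ineq[of "g z - g z0" "\<i> * of_real t"] t unfolding a_def by (simp only: norm_mult) simp
  qed
  moreover have "cmod (g z - cnj (g z0)) \<le> a + t"
  proof -
    have "g z - cnj (g z0) = (g z - of_real (Re (g z0))) + \<i> * of_real t"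
      by (subst eq(2)) simp
    then show ?thesis
      using norm_triangle_ineq[of "g z - of_real (Re (g z0))" "\<i> * of_real t"] t unfolding a_def by (simp only: norm_mult) simp
  qed
  \<comment> \<open>With d the pseudo-hyperbolic distance of z and z0, this says
    \<open>a \<le> t * (1 + d) / (1 - d)\<close>, which is at most
    \<open>4 * t / (1 - d\<^sup>2)\<close>; the identity for \<open>1 - d\<^sup>2\<close> then makes
    the bound explicit.\<close>
  ultimately have "a - t \<le> d * (a + t)"
    using main d by (smt (verit) mult_left_mono)
  then have "a * (1 - d) \<le> t * (1 + d)"
    by (simp add: algebra_simps)
  then have "a * (1 - d) * (1 + d) \<le> t * (1 + d) * (1 + d)"
    using d by (intro mult_right_mono) auto
  also have "\<dots> \<le> t * (2 * 2)"
    unfolding mult.assoc using d t by (intro mult_left_mono mult_mono) auto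
  finally have "a * (1 - d\<^sup>2) \<le> 4 * t"
    by (simp add: algebra_simps power2_eq_square)
  moreover have "1 - d\<^sup>2 = 4 * Im z * Im z0 / (cmod (z - cnj z0))\<^sup>2"
  proof -
    have "(cmod (z - cnj z0))\<^sup>2 > 0"
      using zz(2) by simp
    then show ?thesis
      using cmod_diff_cnj[of z z0] by (simp add: d_def power_divide field_simps)
  qed
  ultimately show ?thesis
    using zz assms unfolding a_def[symmetric] t_def[symmetric] by (simp add: field_simps)
qed

text \<open>The instance with base point \<open>\<i>\<close>, brought into the form of the majorant
  shared by all later growth estimates.\<close>

lemma pick_bound:
  assumes "pick g"
  obtains C where "C \<ge> 0" "\<And>z. z \<in> UHP \<Longrightarrow> cmod (g z) \<le> C * (cmod (z + \<i>))\<^sup>2 / Im z"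
proof
  show "\<bar>Re (g \<i>)\<bar> + Im (g \<i>) \<ge> 0"
    using assms by (simp add: pick_def)
  fix z assume z: "z \<in> UHP"
  have "\<bar>Re (g \<i>)\<bar> * 1 \<le> \<bar>Re (g \<i>)\<bar> * ((cmod (z + \<i>))\<^sup>2 / Im z)"
    using z Im_le_cmod_add_i[OF z] by (intro mult_left_mono) auto
  moreover have "cmod (g z) \<le> \<bar>Re (g \<i>)\<bar> + Im (g \<i>) * (cmod (z + \<i>))\<^sup>2 / Im z"
    using pick_bound_at[OF assms z, of \<i>] norm_triangle_ineq[of "of_real (Re (g \<i>))" "g z - of_real (Re (g \<i>))"]
    by simp
  ultimately show "cmod (g z) \<le> (\<bar>Re (g \<i>)\<bar> + Im (g \<i>)) * (cmod (z + \<i>))\<^sup>2 / Im z"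
    by (simp add: algebra_simps add_divide_distrib)
qed

text \<open>The slope b is the infimum of \<open>Im (g z) / Im z\<close>. After subtraction of the
  linear term the infimum is 0, so a base point can be chosen at which the Schwarz-Pick bound makes
  the quotient along any ray arbitrarily small.\<close>

lemma pick_linear_part:
  assumes "pick g"
  obtains b :: real where "b \<ge> 0" "\<And>z. z \<in> UHP \<Longrightarrow> b * Im z \<le> Im (g z)"
    "\<And>\<omega>. \<omega> \<in> UHP \<Longrightarrow> ((\<lambda>r::real. g (of_real r * \<omega>) / (of_real r * \<omega>)) \<longlongrightarrow> of_real b) at_top"
proof -
  define S where "S = (\<lambda>z. Im (g z) / Im z) ` UHP"
  define b where "b = Inf S"
  have hol: "g holomorphic_on UHP" and nn: "\<And>z. z \<in> UHP \<Longrightarrow> Im (g z) \<ge> 0"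
    using assms(1) by (auto simp: pick_def)
  have S: "S \<noteq> {}" "\<And>s. s \<in> S \<Longrightarrow> s \<ge> 0"
    using nn by (auto simp: S_def upper_half_plane_def intro!: exI[of _ \<i>])
  then have bdd: "bdd_below S"
    by (auto simp: bdd_below_def)
  have b0: "b \<ge> 0"
    using S by (auto simp: b_def intro: cInf_greatest)
  have b1: "b * Im z \<le> Im (g z)" if "z \<in> UHP" for z
  proof -
    have "b \<le> Im (g z) / Im z"
      unfolding b_def using that bdd by (intro cInf_lower) (auto simp: S_def)
    then show ?thesis
      using that by (simp add: field_simps)
  qed
  define g1 where "g1 = (\<lambda>z. g z - of_real b * z)"
  have g1: "pick g1"
    using b1 by (auto simp: pick_def g1_def intro!: holomorphic_intros hol)
  have "((\<lambda>r::real. g (of_real r * \<omega>) / (of_real r * \<omega>)) \<longlongrightarrow> of_real b) at_top"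
    if \<omega>: "\<omega> \<in> UHP" for \<omega>
  proof (rule tendstoI)
    fix e :: real assume "e > 0"
    \<comment> \<open>Chosen such that the limit
      \<open>\<epsilon> * cmod \<omega> / Im \<omega>\<close> of the bound h below equals e /
      2.\<close>
    define \<epsilon> where "\<epsilon> = e / (2 * (cmod \<omega> / Im \<omega>))"
    have \<omega>0: "cmod \<omega> > 0" "Im \<omega> > 0"
      using \<omega> by auto
    have \<epsilon>: "\<epsilon> > 0" 
      using \<omega>0 \<open>e > 0\<close> by (simp add: \<epsilon>_def)
    have "\<exists>s\<in>S. s < b + \<epsilon>"
      using cInf_lessD[of S "b + \<epsilon>"] S \<epsilon> by (auto simp: b_def)
    then obtain z0 where z0: "z0 \<in> UHP" "Im (g z0) / Im z0 < b + \<epsilon>"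
      by (auto simp: S_def)
    then have z0': "Im (g1 z0) \<le> \<epsilon> * Im z0"
      by (simp add: g1_def field_simps)
    define h where "h = (\<lambda>r. \<bar>Re (g1 z0)\<bar> / (r * cmod \<omega>) + \<epsilon> * (r * cmod \<omega> + cmod z0)\<^sup>2 / (r * Im \<omega> * (r * cmod \<omega>)))"
    have "(h \<longlongrightarrow> \<epsilon> * (cmod \<omega>)\<^sup>2 * (inverse (Im \<omega>) * inverse (cmod \<omega>))) at_top"
      unfolding h_def using \<omega>0 \<epsilon> by real_asymp
    then have "(h \<longlongrightarrow> \<epsilon> * cmod \<omega> / Im \<omega>) at_top"
      using \<omega>0 by (simp add: field_simps power2_eq_square)
    moreover have "\<epsilon> * cmod \<omega> / Im \<omega> < e"
      using \<omega>0 \<open>e > 0\<close> by (simp add: \<epsilon>_def)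
    ultimately have ev: "\<forall>\<^sub>F r in at_top. h r < e"
      by (rule order_tendstoD)
    show "\<forall>\<^sub>F r in at_top. dist (g (of_real r * \<omega>) / (of_real r * \<omega>)) (of_real b) < e"
      using ev eventually_gt_at_top[of 0]
    proof eventually_elim
      case (elim r)
      define z where "z = of_real r * \<omega>"
      have z: "z \<in> UHP" "Im z = r * Im \<omega>" "cmod z = r * cmod \<omega>" "z \<noteq> 0"
        using elim \<omega>0 by (auto simp: z_def norm_mult)
      have "cmod (g1 z) \<le> \<bar>Re (g1 z0)\<bar> + cmod (g1 z - of_real (Re (g1 z0)))"
        using norm_triangle_ineq[of "of_real (Re (g1 z0))" "g1 z - of_real (Re (g1 z0))"] by simp
      also have "cmod (g1 z - of_real (Re (g1 z0))) \<le> Im (g1 z0) * (cmod (z - cnj z0))\<^sup>2 / (Im z * Im z0)"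
        by (rule pick_bound_at[OF g1 z(1) z0(1)])
      also have "\<dots> \<le> (\<epsilon> * Im z0) * (cmod z + cmod z0)\<^sup>2 / (Im z * Im z0)"
        using z z0 z0' norm_triangle_ineq4[of z "cnj z0"] \<epsilon>
        by (intro divide_right_mono mult_mono power_mono) auto
      also have "\<dots> = \<epsilon> * (cmod z + cmod z0)\<^sup>2 / Im z"
        using z0 by simp
      finally have "cmod (g1 z) \<le> \<bar>Re (g1 z0)\<bar> + \<epsilon> * (cmod z + cmod z0)\<^sup>2 / Im z"
        by simp
      then have "cmod (g1 z) / cmod z \<le> (\<bar>Re (g1 z0)\<bar> + \<epsilon> * (cmod z + cmod z0)\<^sup>2 / Im z) / cmod z"
        by (intro divide_right_mono) auto
      also have "\<dots> = h r"
        using elim \<omega>0 by (simp add: h_def z add_divide_distrib)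
      also have "\<dots> < e"
        by (rule elim)
      finally have "cmod (g1 z / z) < e"
        by (simp add: norm_divide)
      moreover have "g1 z / z = g z / z - of_real b"
        using z by (simp add: g1_def field_simps)
      ultimately show ?case
        by (simp add: dist_norm z_def)
    qed
  qed
  with b0 b1 show thesis
    by (rule that)
qed


lemma pick_scaled_limit:
  assumes "pick g"
  obtains b :: real where "b \<ge> 0" "\<And>z. z \<in> UHP \<Longrightarrow> b * Im z \<le> Im (g z)"
    "((\<lambda>r::real. g (\<i> * of_real r) / (\<i> * of_real r)) \<longlongrightarrow> of_real b) at_top"
proof -
  obtain b :: real where b: "b \<ge> 0" "\<And>z. z \<in> UHP \<Longrightarrow> b * Im z \<le> Im (g z)"
    "\<And>\<omega>. \<omega> \<in> UHP \<Longrightarrow> ((\<lambda>r::real. g (of_real r * \<omega>) / (of_real r * \<omega>)) \<longlongrightarrow> of_real b) at_top"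
    using pick_linear_part[OF assms] by blast
  then show thesis
    using that[of b] b(3)[of \<i>] by (simp add: mult.commute)
qed

subsection \<open>Phragmen--Lindelof principles\<close>

lemma frontier_UHP_ball:
  assumes "\<zeta> \<in> frontier (ball 0 R \<inter> UHP)"
  shows "Im \<zeta> \<ge> 0" "cmod \<zeta> \<le> R" "cmod \<zeta> = R \<or> Im \<zeta> = 0"
proof -
  have op: "open (ball 0 R \<inter> UHP)"
    by (intro open_Int) auto
  have "closure (ball 0 R \<inter> UHP) \<subseteq> cball 0 R \<inter> {z. Im z \<ge> 0}"
    by (rule closure_minimal) (auto simp: closed_halfspace_Im_ge intro!: closed_Int)
  moreover have "\<zeta> \<in> closure (ball 0 R \<inter> UHP)" and n: "\<zeta> \<notin> ball 0 R \<inter> UHP"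
    using assms op by (auto simp: frontier_def interior_open)
  ultimately show *: "Im \<zeta> \<ge> 0" "cmod \<zeta> \<le> R"
    by auto
  show "cmod \<zeta> = R \<or> Im \<zeta> = 0"
    using * n by auto
qed

lemma eventually_less_of_isCont:
  assumes "open S" "f holomorphic_on S" "\<zeta> \<in> S" "cmod (f \<zeta>) < c"
  shows "\<forall>\<^sub>F z in at \<zeta> within T. cmod (f z) < c"
proof -
  have "isCont f \<zeta>"
    using assms(1-3) holomorphic_on_imp_continuous_on continuous_on_eq_continuous_at by blast
  then have "((\<lambda>z. cmod (f z)) \<longlongrightarrow> cmod (f \<zeta>)) (at \<zeta> within T)"
    by (intro tendsto_norm) (simp add: continuous_within isCont_def tendsto_within_subset[of _ _ _ UNIV])
  then show ?thesis
    using assms(4) by (rule order_tendstoD)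
qed

lemma half_disc_kernel:
  fixes R :: real
  assumes "R > 0" "cmod z \<le> R" "z \<noteq> of_real R" "z \<noteq> - of_real R"
  defines "k \<equiv> 1 / (of_real R - z) - 1 / (of_real R + z)"
  shows "Im k = Im z / ((R - Re z)\<^sup>2 + (Im z)\<^sup>2) + Im z / ((R + Re z)\<^sup>2 + (Im z)\<^sup>2)"
    and "cmod z = R \<Longrightarrow> Im z > 0 \<Longrightarrow> Im k = 1 / Im z"
proof -
  show k: "Im k = Im z / ((R - Re z)\<^sup>2 + (Im z)\<^sup>2) + Im z / ((R + Re z)\<^sup>2 + (Im z)\<^sup>2)"
    by (simp add: k_def Im_divide)
  assume R: "cmod z = R" and y: "Im z > 0"
  define x y where "x = Re z" and "y = Im z"
  have xy: "x\<^sup>2 + y\<^sup>2 = R\<^sup>2" "y > 0"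
    using R y cmod_power2[of z] by (auto simp: x_def y_def)
  have 1: "(R - x)\<^sup>2 + y\<^sup>2 = 2 * R * (R - x)" "(R + x)\<^sup>2 + y\<^sup>2 = 2 * R * (R + x)"
    using xy(1) by (auto simp: power2_eq_square algebra_simps)
  have p: "(R - x) * (R + x) = y\<^sup>2"
    using xy(1) by (simp add: power2_eq_square algebra_simps)
  then have nz: "R - x \<noteq> 0" "R + x \<noteq> 0"
    using xy(2) by auto
  have "Im k = y / (2 * R * (R - x)) + y / (2 * R * (R + x))"
    using k by (simp add: x_def[symmetric] y_def[symmetric] 1)
  also have "\<dots> = y * ((R + x) + (R - x)) / (2 * R * ((R - x) * (R + x)))"
    using nz assms(1) by (simp add: divide_simps) (simp add: algebra_simps)
  also have "\<dots> = y * (2 * R) / (2 * R * ((R - x) * (R + x)))"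
    by simp
  also have "\<dots> = 1 / y"
    unfolding p using xy(2) assms(1) by (simp add: power2_eq_square)
  finally show "Im k = 1 / Im z"
    by (simp add: y_def)
qed

text \<open>Multiplying \<open>\<Phi>\<close> by \<open>exp (4 \<i> C R\<^sup>2 k)\<close>, with the kernel \<open>k\<close> of the preceding lemma, compensates the
  growth of \<open>\<Phi>\<close> on the arc of the half disc of radius \<open>R\<close> and does not change the modulus on the diameter; at a fixed
  point the cost remains bounded as \<open>R\<close> tends to infinity.\<close>

lemma phragmen_lindelof_half_disc:
  assumes hol: "\<Phi> holomorphic_on UHP"
    and bd: "\<And>x e. e > 0 \<Longrightarrow> \<forall>\<^sub>F z in at (of_real x) within UHP. cmod (\<Phi> z) < 1 + e"
    and C: "C \<ge> 0" "\<And>z. z \<in> UHP \<Longrightarrow> cmod (\<Phi> z) \<le> exp (C * (cmod (z + \<i>))\<^sup>2 / Im z)"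
    and w: "w \<in> UHP"
  shows "cmod (\<Phi> w) \<le> exp (8 * C * Im w)"
proof -
  define B where "B = (\<lambda>R. 4 * C * R\<^sup>2 * (Im w / ((R - Re w)\<^sup>2 + (Im w)\<^sup>2) + Im w / ((R + Re w)\<^sup>2 + (Im w)\<^sup>2)))"
  have step: "cmod (\<Phi> w) \<le> exp (B R)" if R: "R > 1" "R > cmod w" for R
  proof -
    define k :: "complex \<Rightarrow> complex" where "k = (\<lambda>z. 1 / (of_real R - z) - 1 / (of_real R + z))"
    define E where "E = (\<lambda>z. exp (\<i> * of_real (4 * C * R\<^sup>2) * k z))"
    define U where "U = ball 0 R \<inter> UHP"
    have nR: "of_real R - z \<noteq> 0" "of_real R + z \<noteq> 0" "z \<noteq> of_real R" "z \<noteq> - of_real R" if "z \<in> UHP" for z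
      using that by (auto simp: complex_eq_iff)
    have holE: "(\<lambda>z. \<Phi> z * E z) holomorphic_on UHP"
      unfolding E_def k_def using nR by (intro holomorphic_intros hol) auto
    have nE: "cmod (E z) = exp (- (4 * C * R\<^sup>2 * Im (k z)))" for z
      by (simp add: E_def)
    have E1: "cmod (E z) \<le> 1" if "z \<in> UHP" "cmod z \<le> R" for z
    proof -
      have "Im (k z) \<ge> 0"
        using half_disc_kernel(1)[of R z] that nR[of z] R unfolding k_def by simp
      then show ?thesis
        using C(1) by (simp add: nE)
    qed
    have "cmod (\<Phi> w * E w) \<le> 1"
    proof (rule maximum_modulus_limsup[where U = U and f = "\<lambda>z. \<Phi> z * E z" and w = w])
      show "open U" "bounded U" "w \<in> U"
        using w R by (auto simp: U_def intro!: open_Int)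
      show "(\<lambda>z. \<Phi> z * E z) holomorphic_on U"
        using holE by (rule holomorphic_on_subset) (auto simp: U_def)
      fix \<zeta> and e :: real assume \<zeta>: "\<zeta> \<in> frontier U" and e: "e > 0"
      note f = frontier_UHP_ball[OF \<zeta>[unfolded U_def]]
      show "\<forall>\<^sub>F z in at \<zeta> within U. cmod (\<Phi> z * E z) < 1 + e"
      \<comment> \<open>The corners, where k has its poles, belong to the real case: there only
        \<open>cmod (E z) \<le> 1\<close> is used.\<close>
      proof (cases "Im \<zeta> = 0")
        case True
        then have "\<zeta> = of_real (Re \<zeta>)"
          by (simp add: complex_eq_iff)
        then have "\<forall>\<^sub>F z in at \<zeta> within UHP. cmod (\<Phi> z) < 1 + e"
          using bd[OF e, of "Re \<zeta>"] by simp
        then have "\<forall>\<^sub>F z in at \<zeta> within U. cmod (\<Phi> z) < 1 + e"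
          by (rule filter_leD[rotated]) (auto simp: U_def intro: at_le)
        moreover have "\<forall>\<^sub>F z in at \<zeta> within U. z \<in> U"
          by (simp add: eventually_at_topological) blast
        ultimately show ?thesis
        proof eventually_elim
          case (elim z)
          then have "cmod (\<Phi> z) * cmod (E z) \<le> cmod (\<Phi> z) * 1"
            by (intro mult_left_mono E1) (auto simp: U_def)
          then show ?case
            using elim by (simp add: norm_mult)
        qed
      next
        case False
        then have z: "\<zeta> \<in> UHP" "cmod \<zeta> = R"
          using f by auto
        have k1: "Im (k \<zeta>) = 1 / Im \<zeta>"
          using half_disc_kernel(2)[of R \<zeta>] z nR[OF z(1)] R unfolding k_def by simp
        \<comment> \<open>Origin of the factor 4 in E: on the arc
          \<open>cmod (\<zeta> + \<i>)\<close> is at most R + 1, and R > 1.\<close>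
        have "cmod (\<zeta> + \<i>) \<le> 2 * R"
          using norm_triangle_ineq[of \<zeta> \<i>] z R by simp
        then have "(cmod (\<zeta> + \<i>))\<^sup>2 \<le> (2 * R)\<^sup>2"
          by (intro power_mono) auto
        then have "C * (cmod (\<zeta> + \<i>))\<^sup>2 / Im \<zeta> \<le> 4 * C * R\<^sup>2 * (1 / Im \<zeta>)"
          using C(1) z mult_left_mono[of "(cmod (\<zeta> + \<i>))\<^sup>2" "(2 * R)\<^sup>2" C]
          by (simp add: divide_simps power_mult_distrib)
        then have "cmod (\<Phi> \<zeta>) \<le> exp (4 * C * R\<^sup>2 * Im (k \<zeta>))"
          using C(2)[OF z(1)] unfolding k1 by (meson exp_le_cancel_iff order_trans)
        then have "cmod (\<Phi> \<zeta> * E \<zeta>) \<le> 1"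
          by (simp add: norm_mult nE exp_minus field_simps)
        then show ?thesis
          using e z by (intro eventually_less_of_isCont[OF open_UHP holE]) auto
      qed
    qed
    moreover have "Im (k w) = Im w / ((R - Re w)\<^sup>2 + (Im w)\<^sup>2) + Im w / ((R + Re w)\<^sup>2 + (Im w)\<^sup>2)"
      unfolding k_def using R w nR[of w] by (intro half_disc_kernel(1)) auto
    ultimately have "cmod (\<Phi> w) * exp (- B R) \<le> 1"
      by (simp add: norm_mult nE B_def)
    then show ?thesis
      by (simp add: exp_minus field_simps)
  qed
  \<comment> \<open>Each of the two fractions times \<open>R\<^sup>2\<close> tends to
    \<open>Im w\<close>, so 8 is 4 times 2.\<close>
  have "(B \<longlongrightarrow> 8 * C * Im w) at_top"
    unfolding B_def using w by real_asymp
  then have "((\<lambda>R. exp (B R)) \<longlongrightarrow> exp (8 * C * Im w)) at_top"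
    by (rule tendsto_exp)
  moreover have "\<forall>\<^sub>F R in at_top. cmod (\<Phi> w) \<le> exp (B R)"
    using eventually_gt_at_top[of 1] eventually_gt_at_top[of "cmod w"]
    by eventually_elim (rule step)
  ultimately show ?thesis
    using tendsto_lowerbound by force
qed

text \<open>The modulus of \<open>exp (\<i> * F z)\<close> is \<open>exp (- Im (F z))\<close>, so
  lower bounds for \<open>Im (F z)\<close> are upper bounds for a modulus.\<close>

corollary Im_lower_bound_half_disc:
  assumes hol: "F holomorphic_on UHP"
    and bd: "\<And>x e. e > 0 \<Longrightarrow> \<forall>\<^sub>F z in at (of_real x) within UHP. Im (F z) > -e"
    and C: "C \<ge> 0" "\<And>z. z \<in> UHP \<Longrightarrow> cmod (F z) \<le> C * (cmod (z + \<i>))\<^sup>2 / Im z"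
    and w: "w \<in> UHP"
  shows "Im (F w) \<ge> - (8 * C * Im w)"
proof -
  have "cmod (exp (\<i> * F w)) \<le> exp (8 * C * Im w)"
  proof (rule phragmen_lindelof_half_disc[where \<Phi> = "\<lambda>z. exp (\<i> * F z)"])
    fix x e :: real assume "e > 0"
    then have "ln (1 + e) > 0"
      by simp
    from bd[OF this, of x] show "\<forall>\<^sub>F z in at (of_real x) within UHP. cmod (exp (\<i> * F z)) < 1 + e"
    proof eventually_elim
      case (elim z)
      then have "exp (- Im (F z)) < exp (ln (1 + e))"
        by simp
      then show ?case
        using \<open>e > 0\<close> by simp
    qed
  next
    fix z assume "z \<in> UHP"
    then show "cmod (exp (\<i> * F z)) \<le> exp (C * (cmod (z + \<i>))\<^sup>2 / Im z)"
      using C(2)[of z] abs_Im_le_cmod[of "F z"] by simp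
  qed (use assms in \<open>auto intro!: holomorphic_intros\<close>)
  then show ?thesis
    by simp
qed

text \<open>The quadrant has opening \<open>pi / 2\<close>, so a power of z with exponent strictly
  between 1 and 2 has, suitably rotated, positive real part there and dominates exponential growth.
  Damping by \<open>exp (- \<epsilon> * P z)\<close> reduces the claim to the maximum principle on
  large quarter discs.\<close>

lemma phragmen_lindelof_quadrant:
  assumes hol: "\<Phi> holomorphic_on UHP"
    and bd: "\<And>x e. e > 0 \<Longrightarrow> \<forall>\<^sub>F z in at (of_real x) within UHP. cmod (\<Phi> z) < 1 + e"
    and gr: "\<And>z. z \<in> UHP \<Longrightarrow> cmod (\<Phi> z) \<le> exp (\<tau> * Im z)"
    and im: "\<And>\<eta>. \<eta> > 0 \<Longrightarrow> cmod (\<Phi> (\<i> * of_real \<eta>)) \<le> B" "B \<ge> 1"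
    and w: "w \<in> UHP" "Re w > 0"
  shows "cmod (\<Phi> w) \<le> B"
proof -
  \<comment> \<open>This is z, rotated by \<open>- pi / 4\<close> so that the quadrant becomes
    symmetric about the positive axis, to the power 3/2. Its argument stays within
    \<open>3/8 * pi\<close>, whence the constant c.\<close>
  define P where "P = (\<lambda>z. exp (3/2 * (Ln z - \<i> * of_real (pi/4))))"
  define c where "c = cos (3/8 * pi)"
  have c: "c > 0"
    unfolding c_def by (rule cos_gt_zero_pi) (use pi_gt_zero in linarith)+
  have ReP: "Re (P z) \<ge> cmod z powr (3/2) * c" if "Im z > 0" "Re z \<ge> 0" for z
  proof -
    have z: "z \<noteq> 0"
      using that by auto
    have L: "0 \<le> Im (Ln z)" "Im (Ln z) \<le> pi/2"
      using that z Re_Ln_pos_le[of z] Im_Ln_pos_le[of z] by (auto simp: abs_le_iff)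
    have "\<bar>3/2 * (Im (Ln z) - pi/4)\<bar> \<le> 3/8 * pi"
      using L by (simp add: abs_le_iff field_simps)
    then have "cos (3/8 * pi) \<le> cos \<bar>3/2 * (Im (Ln z) - pi/4)\<bar>"
      by (intro cos_monotone_0_pi_le) auto
    then have "c \<le> cos (3/2 * (Im (Ln z) - pi/4))"
      unfolding c_def cos_abs_real .
    moreover have "exp (3/2 * ln (cmod z)) = cmod z powr (3/2)"
      using z by (simp add: powr_def)
    ultimately show ?thesis
      unfolding P_def using z by (simp add: Re_exp)
  qed
  have holP: "P holomorphic_on UHP"
    unfolding P_def by (intro holomorphic_intros) (auto simp: complex_nonpos_Reals_iff)
  have step: "cmod (\<Phi> w) \<le> B * exp (\<epsilon> * Re (P w))" if \<epsilon>: "\<epsilon> > 0" for \<epsilon>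
  proof -
    define E where "E = (\<lambda>z. exp (- (of_real \<epsilon> * P z)))"
    have nE: "cmod (E z) = exp (- (\<epsilon> * Re (P z)))" for z
      by (simp add: E_def)
    have E1: "cmod (E z) \<le> 1" if "Im z > 0" "Re z \<ge> 0" for z
    proof -
      have "0 \<le> cmod z powr (3/2) * c"
        using c by simp
      then have "0 \<le> Re (P z)"
        using ReP[OF that] by linarith
      then show ?thesis
        using \<epsilon> by (simp add: nE)
    qed
    have holE: "(\<lambda>z. \<Phi> z * E z) holomorphic_on UHP"
      unfolding E_def by (intro holomorphic_intros hol holP)
    have "filterlim (\<lambda>R. \<epsilon> * c * R powr (3/2) - \<tau> * R) at_top at_top"
      using \<epsilon> c by real_asymp
    then have "\<forall>\<^sub>F R in at_top. \<epsilon> * c * R powr (3/2) - \<tau> * R \<ge> 0 \<and> R > cmod w"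
      using filterlim_at_top eventually_gt_at_top eventually_conj by metis
    moreover have "\<forall>\<^sub>F R in at_top. \<epsilon> * c * R powr (3/2) \<ge> 0"
      using \<epsilon> c by (intro always_eventually) auto
    ultimately obtain R where R: "\<epsilon> * c * R powr (3/2) - \<tau> * R \<ge> 0" "R > cmod w"
      by (metis (mono_tags, lifting) eventually_at_top_linorder order_refl)
    define Q :: "complex set" where "Q = {z. Re z > 0}"
    define U where "U = ball 0 R \<inter> UHP \<inter> Q"
    have opQ: "open Q"
      by (simp add: Q_def open_halfspace_Re_gt)
    have opU: "open U"
      unfolding U_def using opQ by (intro open_Int) auto
    have "cmod (\<Phi> w * E w) \<le> B"
    proof (rule maximum_modulus_limsup[where U = U and f = "\<lambda>z. \<Phi> z * E z" and w = w])
      show "open U" by fact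
      show "bounded U" "w \<in> U"
        using w R by (auto simp: U_def Q_def)
      show "(\<lambda>z. \<Phi> z * E z) holomorphic_on U"
        using holE by (rule holomorphic_on_subset) (auto simp: U_def)
      fix \<zeta> and e :: real assume \<zeta>: "\<zeta> \<in> frontier U" and e: "e > 0"
      have "closure U \<subseteq> cball 0 R \<inter> {z. Im z \<ge> 0} \<inter> {z. Re z \<ge> 0}"
        by (rule closure_minimal)
          (auto simp: U_def Q_def closed_halfspace_Im_ge closed_halfspace_Re_ge intro!: closed_Int)
      moreover have "\<zeta> \<in> closure U" and n: "\<zeta> \<notin> U"
        using \<zeta> opU by (auto simp: frontier_def interior_open)
      ultimately have f: "cmod \<zeta> \<le> R" "Im \<zeta> \<ge> 0" "Re \<zeta> \<ge> 0"
        by auto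
      show "\<forall>\<^sub>F z in at \<zeta> within U. cmod (\<Phi> z * E z) < B + e"
      proof (cases "Im \<zeta> = 0")
        case True
        then have "\<zeta> = of_real (Re \<zeta>)"
          by (simp add: complex_eq_iff)
        then have "\<forall>\<^sub>F z in at \<zeta> within UHP. cmod (\<Phi> z) < 1 + e"
          using bd[OF e, of "Re \<zeta>"] by simp
        then have "\<forall>\<^sub>F z in at \<zeta> within U. cmod (\<Phi> z) < 1 + e"
          by (rule filter_leD[rotated]) (auto simp: U_def intro: at_le)
        moreover have "\<forall>\<^sub>F z in at \<zeta> within U. z \<in> U"
          by (simp add: eventually_at_topological) blast
        ultimately show ?thesis
        proof eventually_elim
          case (elim z)
          then have "cmod (\<Phi> z) * cmod (E z) \<le> cmod (\<Phi> z) * 1"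
            by (intro mult_left_mono E1) (auto simp: U_def Q_def)
          then show ?case
            using elim im(2) by (simp add: norm_mult)
        qed
      next
        case False
        then have z: "\<zeta> \<in> UHP"
          using f by auto
        have "cmod (\<Phi> \<zeta> * E \<zeta>) \<le> B"
        proof (cases "Re \<zeta> = 0")
          case True
          then have "\<zeta> = \<i> * of_real (Im \<zeta>)"
            by (simp add: complex_eq_iff)
          then have "cmod (\<Phi> \<zeta>) \<le> B"
            using im(1)[of "Im \<zeta>"] z by simp
          then have "cmod (\<Phi> \<zeta>) * cmod (E \<zeta>) \<le> B * 1"
            using E1[of \<zeta>] z f im(2) by (intro mult_mono) auto
          then show ?thesis
            by (simp add: norm_mult)
        next
          case False
          then have zR: "cmod \<zeta> = R"
            using n f z by (auto simp: U_def Q_def)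
          have "R * \<tau> \<ge> Im \<zeta> * \<tau> \<or> \<tau> < 0"
            using abs_Im_le_cmod[of \<zeta>] zR by (intro disjCI mult_right_mono) auto
          then have t: "\<tau> * Im \<zeta> \<le> \<epsilon> * (R powr (3/2) * c)"
          proof
            assume "\<tau> < 0"
            then have "\<tau> * Im \<zeta> \<le> 0"
              using z by (simp add: mult_nonpos_nonneg)
            moreover have "0 \<le> \<epsilon> * (R powr (3/2) * c)"
              using \<epsilon> c by simp
            ultimately show ?thesis
              by linarith
          qed (use R(1) in \<open>simp add: mult.commute mult.left_commute\<close>)
          also have "\<dots> \<le> \<epsilon> * Re (P \<zeta>)"
            using ReP[of \<zeta>] z f zR \<epsilon> by (intro mult_left_mono) auto
          finally have "exp (\<tau> * Im \<zeta>) \<le> exp (\<epsilon> * Re (P \<zeta>))"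
            by simp
          then have "cmod (\<Phi> \<zeta>) \<le> exp (\<epsilon> * Re (P \<zeta>))"
            using gr[OF z] by linarith
          then have "cmod (\<Phi> \<zeta> * E \<zeta>) \<le> 1"
            by (simp add: norm_mult nE exp_minus field_simps)
          then show ?thesis
            using im(2) by linarith
        qed
        then show ?thesis
          using e z by (intro eventually_less_of_isCont[OF open_UHP holE]) auto
      qed
    qed
    then show ?thesis
      by (simp add: norm_mult nE exp_minus field_simps)
  qed
  have "((\<lambda>\<epsilon>. B * exp (\<epsilon> * Re (P w))) \<longlongrightarrow> B * exp (0 * Re (P w))) (at_right 0)"
    by (intro tendsto_intros)
  moreover have "\<forall>\<^sub>F \<epsilon> in at_right 0. cmod (\<Phi> w) \<le> B * exp (\<epsilon> * Re (P w))"
    using step by (auto simp: eventually_at_right_field intro!: exI[of _ 1])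
  ultimately have "cmod (\<Phi> w) \<le> B * exp (0 * Re (P w))"
    by (intro tendsto_lowerbound) auto
  then show ?thesis
    by simp
qed

text \<open>The imaginary axis cuts the half plane into two quadrants, exchanged by the reflection
  \<open>- cnj z\<close>. The bound on that axis excludes functions such as
  \<open>exp (- \<i> * of_real \<tau> * z)\<close> with \<tau> > 0, which have modulus 1 on the real
  line and exponential growth inside.\<close>

lemma phragmen_lindelof_UHP:
  assumes hol: "\<Phi> holomorphic_on UHP"
    and bd: "\<And>x e. e > 0 \<Longrightarrow> \<forall>\<^sub>F z in at (of_real x) within UHP. cmod (\<Phi> z) < 1 + e"
    and gr: "\<And>z. z \<in> UHP \<Longrightarrow> cmod (\<Phi> z) \<le> exp (\<tau> * Im z)"
    and im: "\<And>\<eta>. \<eta> > 0 \<Longrightarrow> cmod (\<Phi> (\<i> * of_real \<eta>)) \<le> B" "B \<ge> 1"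
    and w: "w \<in> UHP"
  shows "cmod (\<Phi> w) \<le> B"
proof -
  consider "Re w > 0" | "Re w = 0" | "Re w < 0"
    by linarith
  then show ?thesis
  proof cases
    case 1
    then show ?thesis
      using phragmen_lindelof_quadrant[OF hol bd gr im w] by simp
  next
    case 2
    then have "w = \<i> * of_real (Im w)"
      by (simp add: complex_eq_iff)
    then show ?thesis
      using im(1)[of "Im w"] w by simp
  next
    case 3
    define \<Psi> where "\<Psi> = (\<lambda>z. cnj (\<Phi> (- cnj z)))"
    have "cmod (\<Psi> (- cnj w)) \<le> B"
    proof (rule phragmen_lindelof_quadrant[where \<Phi> = \<Psi> and w = "- cnj w"])
      have "(cnj \<circ> (\<lambda>z. \<Phi> (- z)) \<circ> cnj) holomorphic_on UHP"
        by (rule holomorphic_on_compose_cnj_cnj)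
           (auto intro!: holomorphic_on_compose_gen[of _ _ \<Phi> UHP, unfolded o_def] holomorphic_intros hol
              simp: image_iff)
      then show "\<Psi> holomorphic_on UHP"
        by (simp add: \<Psi>_def o_def)
      fix x e :: real assume e: "e > 0"
      have "filterlim (\<lambda>z. - cnj z) (at (of_real (-x)) within UHP) (at (of_real x) within UHP)"
        unfolding filterlim_at
        by (auto intro!: tendsto_eq_intros simp: eventually_at_filter complex_eq_iff)
      from eventually_compose_filterlim[OF bd[OF e, of "-x"] this]
      show "\<forall>\<^sub>F z in at (of_real x) within UHP. cmod (\<Psi> z) < 1 + e"
        by (simp add: \<Psi>_def)
    next
      fix \<eta> :: real assume "\<eta> > 0"
      then show "cmod (\<Psi> (\<i> * of_real \<eta>)) \<le> B"
        using im(1)[of \<eta>] by (simp add: \<Psi>_def)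
    next
      fix z assume "z \<in> UHP"
      then show "cmod (\<Psi> z) \<le> exp (\<tau> * Im z)"
        using gr[of "- cnj z"] by (simp add: \<Psi>_def)
    qed (use 3 w im in auto)
    then show ?thesis
      by (simp add: \<Psi>_def)
  qed
qed

subsection \<open>Quotients of bounded functions\<close>

text \<open>Bounded type in multiplicative form: h is the denominator and f h the numerator. Both
  bounds are normalised to 1, so that the admissible denominators form a normal family.\<close>

definition bounded_quotient :: "(complex \<Rightarrow> complex) \<Rightarrow> bool" where
  "bounded_quotient f \<longleftrightarrow> (\<exists>h. h holomorphic_on UHP \<and> (\<forall>z\<in>UHP. cmod (h z) \<le> 1 \<and> cmod (f z * h z) \<le> 1) \<and>
     (\<exists>z\<in>UHP. h z \<noteq> 0))"

lemma bounded_quotientI: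
  assumes "h holomorphic_on UHP" "\<And>z. z \<in> UHP \<Longrightarrow> cmod (h z) \<le> M" "\<And>z. z \<in> UHP \<Longrightarrow> cmod (f z * h z) \<le> M"
    "z0 \<in> UHP" "h z0 \<noteq> 0"
  shows "bounded_quotient f"
proof -
  have "cmod (h z0) \<le> M"
    using assms by blast
  then have M: "M > 0"
    using assms(5) by (meson less_le_trans zero_less_norm_iff)
  show ?thesis
    unfolding bounded_quotient_def
    using assms M by (intro exI[of _ "\<lambda>z. h z / of_real M"]) (auto intro!: holomorphic_intros simp: norm_divide)
qed

text \<open>Schwarz's lemma keeps the quotient by the Blaschke factor bounded by 1. The identity is
  stated without division, so that it also makes sense at the zero a.\<close>

lemma divide_blaschke_factor:
  assumes "h holomorphic_on UHP" "\<And>z. z \<in> UHP \<Longrightarrow> cmod (h z) \<le> 1" "a \<in> UHP" "h a = 0"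
  obtains h1 where "h1 holomorphic_on UHP" "\<And>z. z \<in> UHP \<Longrightarrow> cmod (h1 z) \<le> 1"
    "\<And>z. h1 z * (z - a) = h z * (z - cnj a)"
proof
  define q where "q = (\<lambda>z. if z = a then deriv h a else h z / (z - a))"
  define h1 where "h1 = (\<lambda>z. q z * (z - cnj a))"
  have "q holomorphic_on UHP"
    by (rule pole_theorem_open_0[OF assms(1)]) (use assms in \<open>auto simp: q_def\<close>)
  then show hol: "h1 holomorphic_on UHP"
    unfolding h1_def by (intro holomorphic_intros)
  show "h1 z * (z - a) = h z * (z - cnj a)" for z
    using assms by (simp add: h1_def q_def)
  have *: "cmod (h1 z) \<le> 1" if "z \<in> UHP" "z \<noteq> a" for z
    using schwarz_UHP[OF assms that(1)] that(2) by (simp add: h1_def q_def norm_mult norm_divide divide_simps)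
  have "isCont h1 a"
    using holomorphic_on_imp_continuous_on[OF hol] continuous_on_interior assms(3) by (metis interior_open open_UHP)
  then have "((\<lambda>z. cmod (h1 z)) \<longlongrightarrow> cmod (h1 a)) (at a)"
    by (intro tendsto_norm) (simp add: isCont_def)
  moreover have "\<forall>\<^sub>F z in at a. cmod (h1 z) \<le> 1"
    using eventually_at_in_open[OF open_UHP assms(3)] by eventually_elim (use * in auto)
  ultimately have "cmod (h1 a) \<le> 1"
    by (rule tendsto_upperbound) simp
  then show "cmod (h1 z) \<le> 1" if "z \<in> UHP" for z
    using * that by auto
qed

text \<open>Among the admissible denominators, one that maximises the modulus at a fixed point cannot vanish:
  dividing it by a Blaschke factor would increase that modulus.\<close>

lemma bounded_quotient_zero_free:
  assumes "bounded_quotient f" and holf: "f holomorphic_on UHP"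
  obtains h where "h holomorphic_on UHP" "\<And>z. z \<in> UHP \<Longrightarrow> cmod (h z) \<le> 1"
    "\<And>z. z \<in> UHP \<Longrightarrow> cmod (f z * h z) \<le> 1" "\<And>z. z \<in> UHP \<Longrightarrow> h z \<noteq> 0"
proof -
  define H where "H = {h. h holomorphic_on UHP \<and> (\<forall>z\<in>UHP. cmod (h z) \<le> 1 \<and> cmod (f z * h z) \<le> 1)}"
  obtain h0 z0 where h0: "h0 \<in> H" "z0 \<in> UHP" "h0 z0 \<noteq> 0"
    using assms(1) by (auto simp: bounded_quotient_def H_def)
  define S where "S = (\<lambda>h. cmod (h z0)) ` H"
  have bdd: "bdd_above S"
    unfolding S_def bdd_above_def using h0(2) by (intro exI[of _ 1]) (auto simp: H_def)
  have Sne: "S \<noteq> {}"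
    using h0 by (auto simp: S_def)
  define s where "s = Sup S"
  have le: "cmod (h z0) \<le> s" if "h \<in> H" for h
    unfolding s_def using that bdd by (intro cSup_upper) (auto simp: S_def)
  \<comment> \<open>A maximising sequence; by Montel's theorem a subsequence converges, and the
    conditions defining H are closed under pointwise limits.\<close>
  have "\<exists>h\<in>H. s - 1 / Suc n < cmod (h z0)" for n
    using less_cSupD[OF Sne, of "s - 1 / Suc n"] by (auto simp: s_def S_def)
  then obtain F where F: "\<And>n. F n \<in> H" "\<And>n. s - 1 / Suc n < cmod (F n z0)"
    by metis
  obtain h r where h: "h holomorphic_on UHP" "strict_mono (r :: nat \<Rightarrow> nat)"
    "\<And>x. x \<in> UHP \<Longrightarrow> ((\<lambda>n. F (r n) x) \<longlongrightarrow> h x) sequentially"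
  proof (rule Montel[of UHP H F])
    show "\<exists>B. \<forall>h\<in>H. \<forall>z\<in>K. cmod (h z) \<le> B" if "K \<subseteq> UHP" for K
      using that by (intro exI[of _ 1]) (auto simp: H_def)
  qed (use F in \<open>auto simp: H_def\<close>)
  have hH: "h \<in> H"
    unfolding H_def
  proof (intro CollectI conjI ballI h(1))
    fix z assume z: "z \<in> UHP"
    note l = h(3)[OF z]
    show "cmod (h z) \<le> 1"
      using F(1) z by (intro tendsto_upperbound[OF tendsto_norm[OF l]]) (auto simp: H_def)
    show "cmod (f z * h z) \<le> 1"
      using F(1) z by (intro tendsto_upperbound[OF tendsto_norm[OF tendsto_mult[OF tendsto_const l]]]) (auto simp: H_def)
  qed
  have F': "s - 1 / Suc n \<le> cmod (F n z0)" for n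
    by (rule less_imp_le[OF F(2)])
  have "(\<lambda>n. s - 1 / Suc (r n)) \<longlonglongrightarrow> s - 0"
    by (intro tendsto_diff tendsto_const LIMSEQ_subseq_LIMSEQ[OF LIMSEQ_Suc[OF lim_inverse_n'] h(2), unfolded o_def])
  then have "s - 0 \<le> cmod (h z0)"
    by (rule tendsto_le[OF _ tendsto_norm[OF h(3)[OF h0(2)]], rotated])
      (use F' in \<open>auto intro!: always_eventually simp del: of_nat_Suc\<close>)
  then have s: "s \<le> cmod (h z0)"
    by simp
  moreover have "0 < cmod (h0 z0)"
    using h0(3) by simp
  ultimately have s': "cmod (h z0) > 0"
    using le[OF h0(1)] by linarith
  note s = s s'
  have "h a \<noteq> 0" if a: "a \<in> UHP" for a
  proof
    assume ha: "h a = 0"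
    obtain h1 where h1: "h1 holomorphic_on UHP" "\<And>z. z \<in> UHP \<Longrightarrow> cmod (h1 z) \<le> 1"
      "\<And>z. h1 z * (z - a) = h z * (z - cnj a)"
      using divide_blaschke_factor[of h a] hH a ha by (auto simp: H_def)
    \<comment> \<open>The numerator f h vanishes at a as well, so the same Blaschke factor divides
      it, and the new denominator h1 is again admissible.\<close>
    obtain g1 where g1: "g1 holomorphic_on UHP" "\<And>z. z \<in> UHP \<Longrightarrow> cmod (g1 z) \<le> 1"
      "\<And>z. g1 z * (z - a) = (f z * h z) * (z - cnj a)"
      using divide_blaschke_factor[of "\<lambda>z. f z * h z" a] hH a ha holf by (auto simp: H_def intro!: holomorphic_intros)
    have eq: "g1 z = f z * h1 z" if "z \<in> UHP" "z \<noteq> a" for z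
    proof -
      have "g1 z * (z - a) = f z * h1 z * (z - a)"
        using g1(3)[of z] h1(3)[of z] by simp
      then show ?thesis
        using that by simp
    qed
    have "g1 z = f z * h1 z" if "z \<in> UHP" for z
    proof (rule analytic_continuation_open[of "UHP - {a}" UHP g1 "\<lambda>z. f z * h1 z"])
      have "\<i> + a \<in> UHP - {a}"
        using a by simp
      then show "UHP - {a} \<noteq> {}"
        by blast
    qed (use that eq g1 h1 holf in \<open>auto intro!: holomorphic_intros\<close>)
    then have "h1 \<in> H"
      using h1 g1 by (auto simp: H_def simp del: UHP_iff)
    then have "cmod (h1 z0) \<le> cmod (h z0)"
      using le s by force
    moreover have "z0 \<noteq> a"
      using ha s by auto
    moreover have "cmod (h1 z0) * cmod (z0 - a) = cmod (h z0) * cmod (z0 - cnj a)"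
      using h1(3)[of z0] by (metis norm_mult)
    ultimately have "cmod (h z0) * cmod (z0 - cnj a) \<le> cmod (h z0) * cmod (z0 - a)"
      by (metis mult_right_mono norm_ge_zero)
    then show False
      using s cmod_diff_cnj_less(1)[of z0 a] a h0 by simp
  qed
  then show thesis
    using that[of h] hH by (auto simp: H_def)
qed

text \<open>A zero-free denominator on the half plane has a holomorphic logarithm; p is its
  negative. Then \<open>\<i> * p\<close> has nonnegative imaginary part, which makes the bound on f
  accessible to estimates for Pick functions.\<close>

lemma bounded_quotient_exp:
  assumes "bounded_quotient f" "f holomorphic_on UHP"
  obtains p where "p holomorphic_on UHP" "\<And>z. z \<in> UHP \<Longrightarrow> Re (p z) \<ge> 0"
    "\<And>z. z \<in> UHP \<Longrightarrow> cmod (f z) \<le> exp (Re (p z))"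
proof -
  obtain h where h: "h holomorphic_on UHP" "\<And>z. z \<in> UHP \<Longrightarrow> cmod (h z) \<le> 1"
    "\<And>z. z \<in> UHP \<Longrightarrow> cmod (f z * h z) \<le> 1" "\<And>z. z \<in> UHP \<Longrightarrow> h z \<noteq> 0"
    using bounded_quotient_zero_free[OF assms] by blast
  obtain g where g: "g holomorphic_on UHP" "\<And>z. z \<in> UHP \<Longrightarrow> exp (g z) = h z"
    using holomorphic_logarithm_exists[OF convex_UHP open_UHP h(1,4), of \<i>] by auto
  show thesis
  proof (rule that[of "\<lambda>z. - g z"])
    fix z assume z: "z \<in> UHP"
    show "Re (- g z) \<ge> 0"
      using h(2)[OF z] unfolding g(2)[OF z, symmetric] by simp
    have "cmod (f z) * exp (Re (g z)) \<le> 1"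
      using h(3)[OF z] unfolding g(2)[OF z, symmetric] by (simp add: norm_mult)
    then show "cmod (f z) \<le> exp (Re (- g z))"
      by (simp add: exp_minus field_simps)
  qed (intro holomorphic_intros g)
qed

lemma bounded_quotient_growth:
  assumes "bounded_quotient f" "f holomorphic_on UHP"
  obtains C where "C \<ge> 0" "\<And>z. z \<in> UHP \<Longrightarrow> cmod (f z) \<le> exp (C * (cmod (z + \<i>))\<^sup>2 / Im z)"
proof -
  obtain p where p: "p holomorphic_on UHP" "\<And>z. z \<in> UHP \<Longrightarrow> Re (p z) \<ge> 0"
    "\<And>z. z \<in> UHP \<Longrightarrow> cmod (f z) \<le> exp (Re (p z))"
    using bounded_quotient_exp[OF assms] by blast
  have "pick (\<lambda>z. \<i> * p z)"
    using p by (auto simp: pick_def intro!: holomorphic_intros)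
  then obtain C where C: "C \<ge> 0" "\<And>z. z \<in> UHP \<Longrightarrow> cmod (\<i> * p z) \<le> C * (cmod (z + \<i>))\<^sup>2 / Im z"
    using pick_bound by blast
  show thesis
  proof (rule that[OF C(1)])
    fix z assume z: "z \<in> UHP"
    have "Re (p z) \<le> C * (cmod (z + \<i>))\<^sup>2 / Im z"
      using C(2)[OF z] complex_Re_le_cmod[of "p z"] by (simp add: norm_mult)
    then show "cmod (f z) \<le> exp (C * (cmod (z + \<i>))\<^sup>2 / Im z)"
      using p(3)[OF z] by (meson exp_le_cancel_iff order_trans)
  qed
qed

lemma bounded_quotient_const [simp]: "bounded_quotient (\<lambda>_. c)"
  by (rule bounded_quotientI[of "\<lambda>_. 1" "max 1 (cmod c)" _ \<i>]) auto

lemma bounded_quotient_mult: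
  assumes "bounded_quotient f" "f holomorphic_on UHP" "bounded_quotient g" "g holomorphic_on UHP"
  shows "bounded_quotient (\<lambda>z. f z * g z)"
proof -
  obtain h where h: "h holomorphic_on UHP" "\<And>z. z \<in> UHP \<Longrightarrow> cmod (h z) \<le> 1"
    "\<And>z. z \<in> UHP \<Longrightarrow> cmod (f z * h z) \<le> 1" "\<And>z. z \<in> UHP \<Longrightarrow> h z \<noteq> 0"
    using bounded_quotient_zero_free[OF assms(1,2)] by blast
  obtain k where k: "k holomorphic_on UHP" "\<And>z. z \<in> UHP \<Longrightarrow> cmod (k z) \<le> 1"
    "\<And>z. z \<in> UHP \<Longrightarrow> cmod (g z * k z) \<le> 1" "\<And>z. z \<in> UHP \<Longrightarrow> k z \<noteq> 0"
    using bounded_quotient_zero_free[OF assms(3,4)] by blast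
  show ?thesis
  proof (rule bounded_quotientI[of "\<lambda>z. h z * k z" 1 _ \<i>])
    fix z assume z: "z \<in> UHP"
    show "cmod (h z * k z) \<le> 1"
      using h(2)[OF z] k(2)[OF z] by (simp add: norm_mult mult_le_one)
    have "cmod ((f z * h z) * (g z * k z)) \<le> 1"
      unfolding norm_mult[of "f z * h z"] using h(3)[OF z] k(3)[OF z] by (intro mult_le_one) auto
    then show "cmod (f z * g z * (h z * k z)) \<le> 1"
      by (simp add: ac_simps)
  qed (use h(1,4) k(1,4) in \<open>auto intro!: holomorphic_intros\<close>)
qed

lemma bounded_quotient_add:
  assumes "bounded_quotient f" "f holomorphic_on UHP" "bounded_quotient g" "g holomorphic_on UHP"
  shows "bounded_quotient (\<lambda>z. f z + g z)"
proof -
  obtain h where h: "h holomorphic_on UHP" "\<And>z. z \<in> UHP \<Longrightarrow> cmod (h z) \<le> 1"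
    "\<And>z. z \<in> UHP \<Longrightarrow> cmod (f z * h z) \<le> 1" "\<And>z. z \<in> UHP \<Longrightarrow> h z \<noteq> 0"
    using bounded_quotient_zero_free[OF assms(1,2)] by blast
  obtain k where k: "k holomorphic_on UHP" "\<And>z. z \<in> UHP \<Longrightarrow> cmod (k z) \<le> 1"
    "\<And>z. z \<in> UHP \<Longrightarrow> cmod (g z * k z) \<le> 1" "\<And>z. z \<in> UHP \<Longrightarrow> k z \<noteq> 0"
    using bounded_quotient_zero_free[OF assms(3,4)] by blast
  show ?thesis
  proof (rule bounded_quotientI[of "\<lambda>z. h z * k z" 2 _ \<i>])
    fix z assume z: "z \<in> UHP"
    have "cmod (h z * k z) \<le> 1"
      using h(2)[OF z] k(2)[OF z] by (simp add: norm_mult mult_le_one)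
    then show "cmod (h z * k z) \<le> 2"
      by linarith
    have "cmod ((f z * h z) * k z) \<le> 1" "cmod (h z * (g z * k z)) \<le> 1"
      unfolding norm_mult[of "f z * h z"] norm_mult[of "h z" "g z * k z"]
      using h(2,3)[OF z] k(2,3)[OF z] by (intro mult_le_one; simp)+
    moreover have "(f z + g z) * (h z * k z) = (f z * h z) * k z + h z * (g z * k z)"
      by (simp add: algebra_simps)
    ultimately show "cmod ((f z + g z) * (h z * k z)) \<le> 2"
      using norm_triangle_ineq[of "(f z * h z) * k z" "h z * (g z * k z)"] by simp
  qed (use h(1,4) k(1,4) in \<open>auto intro!: holomorphic_intros\<close>)
qed

lemma bounded_quotient_sum:
  assumes "finite A" "\<And>a. a \<in> A \<Longrightarrow> bounded_quotient (f a)" "\<And>a. a \<in> A \<Longrightarrow> f a holomorphic_on UHP"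
  shows "bounded_quotient (\<lambda>z. \<Sum>a\<in>A. f a z)"
  using assms by (induction A rule: finite_induct) (auto intro!: bounded_quotient_add holomorphic_intros)

lemma bounded_quotient_prod:
  assumes "finite A" "\<And>a. a \<in> A \<Longrightarrow> bounded_quotient (f a)" "\<And>a. a \<in> A \<Longrightarrow> f a holomorphic_on UHP"
  shows "bounded_quotient (\<lambda>z. \<Prod>a\<in>A. f a z)"
  using assms by (induction A rule: finite_induct) (auto intro!: bounded_quotient_mult holomorphic_intros)

lemma bounded_type_imp_bounded_quotient:
  assumes "bounded_type f" and holf: "f holomorphic_on UHP"
  shows "bounded_quotient f"
proof -
  obtain g h where g: "g holomorphic_on UHP" "bounded (g ` UHP)" and h: "h holomorphic_on UHP" "bounded (h ` UHP)"
    and h0: "\<exists>z\<in>UHP. h z \<noteq> 0" and eq: "\<And>z. z \<in> UHP \<Longrightarrow> h z \<noteq> 0 \<Longrightarrow> f z = g z / h z"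
    using assms(1) unfolding bounded_type_def by blast
  obtain z0 where z0: "z0 \<in> UHP" "h z0 \<noteq> 0"
    using h0 by blast
  obtain M1 M2 where M: "\<And>z. z \<in> UHP \<Longrightarrow> cmod (g z) \<le> M1" "\<And>z. z \<in> UHP \<Longrightarrow> cmod (h z) \<le> M2"
    using g(2) h(2) unfolding bounded_iff by blast
  have op: "open (UHP \<inter> h -` (- {0}))"
    using h(1) by (intro continuous_open_preimage holomorphic_on_imp_continuous_on) auto
  \<comment> \<open>Bounded type says nothing about f where h vanishes; the product identity extends
    to these points by the identity theorem.\<close>
  have "f z * h z = g z" if "z \<in> UHP" for z
    by (rule analytic_continuation_open[OF op open_UHP, where f = "\<lambda>z. f z * h z" and g = g])
       (use that z0 eq g h holf in \<open>auto intro!: holomorphic_intros\<close>)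
  then show ?thesis
    using M z0 h by (intro bounded_quotientI[of h "max M1 M2" _ z0]) (auto simp: le_max_iff_disj simp del: UHP_iff)
qed

subsection \<open>Boundary values of the argument\<close>

text \<open>A linear term in \<open>u\<close> cannot occur: \<open>Re u\<close> is bounded above by a function which, along the rays
  approaching the real axis, is of small linear growth.\<close>

lemma log_bounds_from_boundary:
  assumes bq: "bounded_quotient f" and holf: "f holomorphic_on UHP"
    and u: "u holomorphic_on UHP" "\<And>z. z \<in> UHP \<Longrightarrow> exp (u z) = f z"
    and bd: "\<And>x e. e > 0 \<Longrightarrow> \<forall>\<^sub>F z in at (of_real x) within UHP. A - e < Im (u z) \<and> Im (u z) < B + e"
    and w: "w \<in> UHP"
  shows "A \<le> Im (u w) \<and> Im (u w) \<le> B"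
proof -
  obtain p where p: "p holomorphic_on UHP" "\<And>z. z \<in> UHP \<Longrightarrow> Re (p z) \<ge> 0"
    "\<And>z. z \<in> UHP \<Longrightarrow> cmod (f z) \<le> exp (Re (p z))"
    using bounded_quotient_exp[OF bq holf] by blast
  have up: "Re (u z) \<le> Re (p z)" if "z \<in> UHP" for z
    using p(3)[OF that] unfolding u(2)[OF that, symmetric] by simp
  \<comment> \<open>Writing u as p minus (p - u) presents it as a difference of two functions with
    nonnegative real part; this bounds the modulus of u, although only \<open>Re (u z)\<close> is
    controlled directly and only from above.\<close>
  have pick1: "pick (\<lambda>z. \<i> * p z)" "pick (\<lambda>z. \<i> * (p z - u z))"
    using p(1,2) up u(1) by (auto simp: pick_def intro!: holomorphic_intros)
  obtain C1 where C1: "C1 \<ge> 0" "\<And>z. z \<in> UHP \<Longrightarrow> cmod (\<i> * p z) \<le> C1 * (cmod (z + \<i>))\<^sup>2 / Im z"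
    using pick_bound[OF pick1(1)] by blast
  obtain C2 where C2: "C2 \<ge> 0" "\<And>z. z \<in> UHP \<Longrightarrow> cmod (\<i> * (p z - u z)) \<le> C2 * (cmod (z + \<i>))\<^sup>2 / Im z"
    using pick_bound[OF pick1(2)] by blast
  define C where "C = C1 + C2 + \<bar>A\<bar> + \<bar>B\<bar>"
  have C0: "C \<ge> 0"
    using C1 C2 by (simp add: C_def)
  have growth: "cmod (u z - \<i> * of_real A) \<le> C * (cmod (z + \<i>))\<^sup>2 / Im z"
      "cmod (- u z + \<i> * of_real B) \<le> C * (cmod (z + \<i>))\<^sup>2 / Im z" if z: "z \<in> UHP" for z
  proof -
    define D where "D = (cmod (z + \<i>))\<^sup>2 / Im z"
    have D: "D \<ge> 1"
      using Im_le_cmod_add_i[OF z] z by (simp add: D_def)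
    have "cmod (p z) \<le> C1 * D" "cmod (p z - u z) \<le> C2 * D"
      using C1(2)[OF z] C2(2)[OF z] by (simp_all add: norm_mult D_def)
    moreover have "cmod (u z) \<le> cmod (p z) + cmod (p z - u z)"
      using norm_triangle_ineq4[of "p z" "p z - u z"] by simp
    ultimately have "cmod (u z) \<le> C1 * D + C2 * D"
      by linarith
    moreover have "\<bar>A\<bar> * 1 \<le> \<bar>A\<bar> * D" "\<bar>B\<bar> * 1 \<le> \<bar>B\<bar> * D"
      using D by (intro mult_left_mono; simp)+
    moreover have "0 \<le> \<bar>A\<bar> * D" "0 \<le> \<bar>B\<bar> * D"
      using D by auto
    moreover have "cmod (u z - \<i> * of_real A) \<le> cmod (u z) + \<bar>A\<bar>" "cmod (- u z + \<i> * of_real B) \<le> cmod (u z) + \<bar>B\<bar>"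
      using norm_triangle_ineq4[of "u z" "\<i> * of_real A"] norm_triangle_ineq[of "- u z" "\<i> * of_real B"]
      by (simp_all add: norm_mult)
    ultimately have "cmod (u z - \<i> * of_real A) \<le> C * D" "cmod (- u z + \<i> * of_real B) \<le> C * D"
      by (simp_all add: C_def algebra_simps)
    then show "cmod (u z - \<i> * of_real A) \<le> C * (cmod (z + \<i>))\<^sup>2 / Im z"
      "cmod (- u z + \<i> * of_real B) \<le> C * (cmod (z + \<i>))\<^sup>2 / Im z"
      by (simp_all add: D_def)
  qed
  define \<tau> where "\<tau> = 8 * C"
  have lo: "Im (u z - \<i> * of_real A) \<ge> - (8 * C * Im z)" if "z \<in> UHP" for z
  proof (rule Im_lower_bound_half_disc[where F = "\<lambda>z. u z - \<i> * of_real A" and w = z])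
    show "\<forall>\<^sub>F z in at (of_real x) within UHP. - e < Im (u z - \<i> * of_real A)" if "e > 0" for x e
      using bd[OF that, of x] by eventually_elim simp
  qed (use that C0 growth u in \<open>auto intro!: holomorphic_intros\<close>)
  have hi: "Im (- u z + \<i> * of_real B) \<ge> - (8 * C * Im z)" if "z \<in> UHP" for z
  proof (rule Im_lower_bound_half_disc[where F = "\<lambda>z. - u z + \<i> * of_real B" and w = z])
    show "\<forall>\<^sub>F z in at (of_real x) within UHP. - e < Im (- u z + \<i> * of_real B)" if "e > 0" for x e
      using bd[OF that, of x] by eventually_elim simp
  qed (use that C0 growth u in \<open>auto intro!: holomorphic_intros\<close>)
  \<comment> \<open>The half disc estimate loses a linear term, compensated here by
    \<open>of_real \<tau> * z\<close>. What remains is to show that both functions have slope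
    exactly \<tau>, so that the term can be subtracted again.\<close>
  have pick2: "pick (\<lambda>z. u z - \<i> * of_real A + of_real \<tau> * z)" "pick (\<lambda>z. - u z + \<i> * of_real B + of_real \<tau> * z)"
  proof -
    have "0 \<le> Im (u z - \<i> * of_real A + of_real \<tau> * z)" "0 \<le> Im (- u z + \<i> * of_real B + of_real \<tau> * z)"
      if "z \<in> UHP" for z
      using lo[OF that] hi[OF that] by (simp_all add: \<tau>_def)
    then show "pick (\<lambda>z. u z - \<i> * of_real A + of_real \<tau> * z)" "pick (\<lambda>z. - u z + \<i> * of_real B + of_real \<tau> * z)"
      unfolding pick_def using u(1) by (intro conjI holomorphic_intros ballI; simp del: UHP_iff)+
  qed
  have ray: "((\<lambda>r::real. c / (of_real r * \<omega>)) \<longlongrightarrow> 0) at_top" if "\<omega> \<in> UHP" for c \<omega> :: complex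
  proof -
    have "((\<lambda>r::real. (c / \<omega>) * of_real (1 / r)) \<longlongrightarrow> (c / \<omega>) * of_real 0) at_top"
      by (intro tendsto_intros) real_asymp
    then show ?thesis
      by (simp add: mult.commute)
  qed
  obtain b1 :: real where "b1 \<ge> 0" and b1: "\<And>z. z \<in> UHP \<Longrightarrow> b1 * Im z \<le> Im (u z - \<i> * of_real A + of_real \<tau> * z)"
    "\<And>\<omega>. \<omega> \<in> UHP \<Longrightarrow> ((\<lambda>r::real. (u (of_real r * \<omega>) - \<i> * of_real A + of_real \<tau> * (of_real r * \<omega>)) / (of_real r * \<omega>)) \<longlongrightarrow> of_real b1) at_top"
    by (rule pick_linear_part[OF pick2(1)]) (rule that)
  obtain b2 :: real where "b2 \<ge> 0" and b2: "\<And>z. z \<in> UHP \<Longrightarrow> b2 * Im z \<le> Im (- u z + \<i> * of_real B + of_real \<tau> * z)"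
    "\<And>\<omega>. \<omega> \<in> UHP \<Longrightarrow> ((\<lambda>r::real. (- u (of_real r * \<omega>) + \<i> * of_real B + of_real \<tau> * (of_real r * \<omega>)) / (of_real r * \<omega>)) \<longlongrightarrow> of_real b2) at_top"
    by (rule pick_linear_part[OF pick2(2)]) (rule that)
  obtain \<beta> :: real where "\<beta> \<ge> 0" and "\<And>z. z \<in> UHP \<Longrightarrow> \<beta> * Im z \<le> Im (\<i> * p z)"
    and \<beta>: "\<And>\<omega>. \<omega> \<in> UHP \<Longrightarrow> ((\<lambda>r::real. \<i> * p (of_real r * \<omega>) / (of_real r * \<omega>)) \<longlongrightarrow> of_real \<beta>) at_top"
    by (rule pick_linear_part[OF pick1(1)]) (rule that)
  have lim1: "((\<lambda>r::real. u (of_real r * \<omega>) / (of_real r * \<omega>)) \<longlongrightarrow> of_real (b1 - \<tau>)) at_top" if \<omega>: "\<omega> \<in> UHP" for \<omega>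
  proof (rule Lim_transform_eventually)
    show "((\<lambda>r::real. (u (of_real r * \<omega>) - \<i> * of_real A + of_real \<tau> * (of_real r * \<omega>)) / (of_real r * \<omega>)
       + \<i> * of_real A / (of_real r * \<omega>) - of_real \<tau>) \<longlongrightarrow> of_real (b1 - \<tau>)) at_top"
      using tendsto_diff[OF tendsto_add[OF b1(2)[OF \<omega>] ray[OF \<omega>, of "\<i> * of_real A"]] tendsto_const, of "of_real \<tau>"]
      by simp
    show "\<forall>\<^sub>F r::real in at_top. (u (of_real r * \<omega>) - \<i> * of_real A + of_real \<tau> * (of_real r * \<omega>)) / (of_real r * \<omega>)
       + \<i> * of_real A / (of_real r * \<omega>) - of_real \<tau> = u (of_real r * \<omega>) / (of_real r * \<omega>)"
      using eventually_gt_at_top[of 0]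
    proof eventually_elim
      case (elim r)
      then have "of_real r * \<omega> \<noteq> 0"
        using \<omega> by auto
      then show ?case
        by (simp add: add_divide_distrib diff_divide_distrib)
    qed
  qed
  have lim2: "((\<lambda>r::real. u (of_real r * \<omega>) / (of_real r * \<omega>)) \<longlongrightarrow> of_real (\<tau> - b2)) at_top" if \<omega>: "\<omega> \<in> UHP" for \<omega>
  proof (rule Lim_transform_eventually)
    show "((\<lambda>r::real. of_real \<tau> + \<i> * of_real B / (of_real r * \<omega>) - (- u (of_real r * \<omega>) + \<i> * of_real B + of_real \<tau> * (of_real r * \<omega>)) / (of_real r * \<omega>)) \<longlongrightarrow> of_real (\<tau> - b2)) at_top"
      using tendsto_diff[OF tendsto_add[OF tendsto_const[of "of_real \<tau>"] ray[OF \<omega>, of "\<i> * of_real B"]] b2(2)[OF \<omega>]]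
      by simp
    show "\<forall>\<^sub>F r::real in at_top. of_real \<tau> + \<i> * of_real B / (of_real r * \<omega>) - (- u (of_real r * \<omega>) + \<i> * of_real B + of_real \<tau> * (of_real r * \<omega>)) / (of_real r * \<omega>) = u (of_real r * \<omega>) / (of_real r * \<omega>)"
      using eventually_gt_at_top[of 0]
    proof eventually_elim
      case (elim r)
      then have "of_real r * \<omega> \<noteq> 0"
        using \<omega> by auto
      then show ?case
        by (simp add: add_divide_distrib diff_divide_distrib)
    qed
  qed
  define t where "t = b1 - \<tau>"
  have "complex_of_real (b1 - \<tau>) = of_real (\<tau> - b2)"
    using tendsto_unique[OF _ lim1[of \<i>] lim2[of \<i>]] by simp
  then have t2: "t = \<tau> - b2"
    unfolding t_def of_real_eq_iff .
  \<comment> \<open>Here t is the slope of u and \<beta> that of \<open>\<i> * p\<close>, and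
    \<open>Re (u z) \<le> Re (p z)\<close> is compared along the ray through \<omega>. Letting
    \<omega> tend to 1 and to -1 from within the half plane forces t = 0.\<close>
  have ineq: "t * Re \<omega> \<le> \<beta> * Im \<omega>" if \<omega>: "\<omega> \<in> UHP" for \<omega>
  proof -
    have "((\<lambda>r::real. Re (u (of_real r * \<omega>) / (of_real r * \<omega>) * \<omega>)) \<longlongrightarrow> Re (of_real t * \<omega>)) at_top"
      unfolding t_def by (intro tendsto_intros lim1 \<omega>)
    moreover have "((\<lambda>r::real. Re (\<i> * p (of_real r * \<omega>) / (of_real r * \<omega>) * (- \<i> * \<omega>))) \<longlongrightarrow> Re (of_real \<beta> * (- \<i> * \<omega>))) at_top"
      by (intro tendsto_intros \<beta> \<omega>)
    moreover have "\<forall>\<^sub>F r::real in at_top. Re (u (of_real r * \<omega>) / (of_real r * \<omega>) * \<omega>) \<le> Re (\<i> * p (of_real r * \<omega>) / (of_real r * \<omega>) * (- \<i> * \<omega>))"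
      using eventually_gt_at_top[of 0]
    proof eventually_elim
      case (elim r)
      have nz: "\<omega> \<noteq> 0" "of_real r * \<omega> \<in> UHP"
        using \<omega> elim by auto
      have 1: "u (of_real r * \<omega>) / (of_real r * \<omega>) * \<omega> = u (of_real r * \<omega>) / of_real r"
        using nz by simp
      have 2: "\<i> * p (of_real r * \<omega>) / (of_real r * \<omega>) * (- \<i> * \<omega>) = p (of_real r * \<omega>) / of_real r"
        using nz elim by (simp add: field_simps)
      show ?case
        unfolding 1 2 using up[OF nz(2)] elim by (simp add: Re_divide_of_real divide_right_mono)
    qed
    ultimately have "Re (of_real t * \<omega>) \<le> Re (of_real \<beta> * (- \<i> * \<omega>))"
      by (intro tendsto_le[of at_top]) auto
    then show ?thesis
      by simp
  qed
  have "((\<lambda>d. \<beta> * d) \<longlongrightarrow> \<beta> * 0) (at_right (0::real))"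
    by (intro tendsto_intros)
  then have l0: "((\<lambda>d. \<beta> * d) \<longlongrightarrow> 0) (at_right (0::real))"
    by simp
  have "t \<le> 0"
    using ineq[of "Complex 1 d" for d] by (intro tendsto_lowerbound[OF l0]) (auto simp: eventually_at_right_field intro!: exI[of _ 1])
  moreover have "-t \<le> 0"
    using ineq[of "Complex (-1) d" for d] by (intro tendsto_lowerbound[OF l0]) (auto simp: eventually_at_right_field intro!: exI[of _ 1])
  ultimately have "t = 0"
    by simp
  then have "b1 = \<tau>" "b2 = \<tau>"
    using t2 by (simp_all add: t_def)
  then show ?thesis
    using b1(1)[OF w] b2(1)[OF w] by simp
qed

text \<open>The values lie in the multiples of \<open>2 * pi * \<i>\<close>, which are more than 1
  apart, and a continuous function with discrete range on a connected set is constant.\<close>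

lemma constant_of_exp_eq_1:
  assumes "connected S" "v holomorphic_on S" "\<And>z. z \<in> S \<Longrightarrow> exp (v z) = 1"
  obtains n :: int where "\<And>z. z \<in> S \<Longrightarrow> v z = of_int (2 * n) * of_real pi * \<i>"
proof (cases "S = {}")
  case False
  then obtain z0 where z0: "z0 \<in> S" by blast
  have n: "\<exists>n::int. v z = of_int (2 * n) * of_real pi * \<i>" if z: "z \<in> S" for z
  proof -
    obtain n :: int where "Re (v z) = 0" "Im (v z) = of_int (2 * n) * pi"
      using assms(3)[OF z] unfolding exp_eq_1 by blast
    then show ?thesis
      by (intro exI[of _ n]) (simp add: complex_eq_iff)
  qed
  have "v constant_on S"
  proof (rule continuous_discrete_range_constant[OF assms(1) holomorphic_on_imp_continuous_on[OF assms(2)]])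
    fix x assume x: "x \<in> S"
    show "\<exists>e>0. \<forall>y. y \<in> S \<and> v y \<noteq> v x \<longrightarrow> e \<le> cmod (v y - v x)"
    proof (intro exI[of _ "1::real"] conjI allI impI)
      fix y assume y: "y \<in> S \<and> v y \<noteq> v x"
      obtain k m :: int where km: "v y = of_int (2 * k) * of_real pi * \<i>" "v x = of_int (2 * m) * of_real pi * \<i>"
        using n x y by blast
      then have "k \<noteq> m"
        using y by auto
      then have "\<bar>real_of_int (k - m)\<bar> \<ge> 1"
        by linarith
      then have "2 * pi * 1 \<le> 2 * pi * \<bar>real_of_int (k - m)\<bar>"
        by (intro mult_left_mono) auto
      also have "v y - v x = of_real (2 * pi * real_of_int (k - m)) * \<i>"
        by (simp add: km algebra_simps)
      then have "2 * pi * \<bar>real_of_int (k - m)\<bar> = cmod (v y - v x)"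
        by (simp only: norm_mult norm_of_real norm_ii) (simp add: abs_mult)
      finally show "1 \<le> cmod (v y - v x)"
        using pi_ge_two by linarith
    qed auto
  qed
  then show thesis
    using n[OF z0] z0 that unfolding constant_on_def by metis
qed (use that in auto)

lemma tendsto_at_real_UHP_nontrivial [simp]: "at (of_real x) within UHP \<noteq> bot"
proof -
  have "of_real x islimpt UHP"
    unfolding islimpt_approachable
  proof (intro allI impI)
    fix e :: real assume "e > 0"
    then show "\<exists>y\<in>UHP. y \<noteq> of_real x \<and> dist y (of_real x) < e"
      by (intro bexI[of _ "of_real x + \<i> * of_real (e/2)"]) (auto simp: complex_eq_iff dist_norm norm_mult)
  qed
  then show ?thesis
    by (simp add: trivial_limit_within)
qed

lemma of_real_in_ball_iff: "of_real y \<in> ball (of_real x :: complex) d \<longleftrightarrow> \<bar>y - x\<bar> < d"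
  by (simp add: dist_of_real dist_real_def abs_minus_commute)

lemma eventually_UHP_ball:
  assumes "\<bar>y - x\<bar> < d"
  shows "\<forall>\<^sub>F z in at (of_real y) within UHP. z \<in> UHP \<inter> ball (of_real x) d"
proof -
  have "of_real y \<in> ball (of_real x :: complex) d" "open (ball (of_real x :: complex) d)"
    using assms by (simp_all only: of_real_in_ball_iff open_ball)
  then show ?thesis
    unfolding eventually_at_topological by blast
qed

section \<open>The divisor of a real meromorphic function as the jumps of its boundary
  argument\<close>

locale log_real_meromorphic =
  fixes f u :: "complex \<Rightarrow> complex"
  assumes mero: "f nicely_meromorphic_on UNIV"
    and hol: "f holomorphic_on - \<real>"
    and sym: "\<And>z. z \<notin> \<real> \<Longrightarrow> f (cnj z) = cnj (f z)"
    and holu: "u holomorphic_on UHP"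
    and exp_u: "\<And>z. z \<in> UHP \<Longrightarrow> exp (u z) = f z"
begin

lemma nz_UHP: "z \<in> UHP \<Longrightarrow> f z \<noteq> 0"
  using exp_u[of z] by (metis exp_not_eq_zero)

lemma nz_nonreal:
  assumes "z \<notin> \<real>" shows "f z \<noteq> 0"
proof (cases "z \<in> UHP")
  case False
  then have "cnj z \<in> UHP"
    using assms by (simp add: complex_is_Real_iff)
  then have "f (cnj z) \<noteq> 0"
    by (rule nz_UHP)
  then show ?thesis
    using sym[OF assms] by simp
qed (use nz_UHP in auto)

text \<open>Here l is a logarithm of the zero-free factor of f at x, with the branch chosen to match
  u on the half disc without an extra constant. That factor is real on the axis, so the imaginary
  part a of l is constant there and a multiple of pi.\<close>

definition local_form :: "real \<Rightarrow> real \<Rightarrow> (complex \<Rightarrow> complex) \<Rightarrow> real \<Rightarrow> bool" where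
  "local_form x a l d \<longleftrightarrow> d > 0 \<and> l holomorphic_on ball (of_real x) d \<and>
     (\<forall>t. \<bar>t - x\<bar> < d \<longrightarrow> Im (l (of_real t)) = a) \<and>
     (\<forall>z\<in>UHP \<inter> ball (of_real x) d. u z = of_int (zorder f (of_real x)) * Ln (z - of_real x) + l z) \<and>
     (\<forall>z\<in>ball (of_real x) d - {of_real x}. f z = (z - of_real x) powi zorder f (of_real x) * exp (l z)) \<and>
     (\<exists>N::int. a = of_int N * pi)"

text \<open>Split off the power of \<open>z - x\<close> given by the order. The remaining factor h
  is real on the axis and nonzero at x, so it has a logarithm nearby; any discrepancy with u is a
  constant multiple of \<open>2 * pi * \<i>\<close> and is moved into l.\<close>

lemma local_form_exists: "\<exists>a l d. local_form x a l d"
proof -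
  define X :: complex where "X = of_real x"
  define k where "k = zorder f X"
  define h where "h = zor_poly f X"
  have m: "isolated_singularity_at f X" "not_essential f X"
    using mero meromorphic_on_subset[of f UNIV "{X}"] by (auto simp: nicely_meromorphic_on_def meromorphic_at_iff)
  have "\<exists>\<^sub>F w in at X. f w \<noteq> 0"
    unfolding frequently_def
  proof
    assume "\<forall>\<^sub>F w in at X. \<not> f w \<noteq> 0"
    then have "\<forall>\<^sub>F w in at X within UHP. \<not> f w \<noteq> 0"
      by (rule filter_leD[rotated]) (simp add: at_le)
    moreover have "\<forall>\<^sub>F z in at X within UHP. z \<in> UHP"
      by (rule eventually_in_UHP)
    ultimately have "\<forall>\<^sub>F z in at X within UHP. False"
      by eventually_elim (use nz_UHP in auto)
    then show False
      by (simp add: X_def)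
  qed
  from zorder_exist[OF m this] obtain r where r: "r > 0" "h X \<noteq> 0" "h holomorphic_on cball X r"
    "\<And>w. w \<in> cball X r - {X} \<Longrightarrow> f w = h w * (w - X) powi k \<and> h w \<noteq> 0"
    unfolding h_def k_def by blast
  have holh: "h holomorphic_on ball X r"
    using r(3) by (rule holomorphic_on_subset) auto
  have ch: "isCont h w" if "w \<in> ball X r" for w
    using holomorphic_on_imp_continuous_on[OF holh] continuous_on_interior that by (metis interior_open open_ball)
  \<comment> \<open>The symmetry of f is available off the real line only; it is transferred to h on
    the half disc and then to real points by continuity of h.\<close>
  have hreal: "h (of_real t) \<in> \<real>" if t: "\<bar>t - x\<bar> < r" for t
  proof -
    have tb: "of_real t \<in> ball X r"
      using t by (simp only: X_def of_real_in_ball_iff)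
    have l: "((\<lambda>z. h z) \<longlongrightarrow> h (of_real t)) (at (of_real t) within UHP)"
      using ch[OF tb] by (simp add: isCont_def tendsto_within_subset[of _ _ _ UNIV])
    have "filterlim cnj (at (of_real t)) (at (of_real t) within UHP)"
      unfolding filterlim_at by (auto intro!: tendsto_eq_intros simp: eventually_at_filter complex_eq_iff)
    moreover have "(h \<longlongrightarrow> h (of_real t)) (at (of_real t))"
      using ch[OF tb] by (simp add: isCont_def)
    ultimately have l2: "((\<lambda>z. h (cnj z)) \<longlongrightarrow> h (of_real t)) (at (of_real t) within UHP)"
      using filterlim_compose by blast
    have "\<forall>\<^sub>F z in at (of_real t) within UHP. z \<in> UHP \<inter> ball X r"
      unfolding X_def using t by (rule eventually_UHP_ball)
    then have "\<forall>\<^sub>F z in at (of_real t) within UHP. cnj (h z) = h (cnj z)"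
    proof eventually_elim
      case (elim z)
      have z: "z \<in> cball X r - {X}" "z \<noteq> X"
        using elim by (auto simp: X_def)
      have "cmod (cnj z - X) = cmod (z - X)"
        by (metis X_def complex_cnj_complex_of_real complex_cnj_diff complex_mod_cnj)
      then have cz: "cnj z \<in> cball X r - {X}" "cnj z \<noteq> X"
        using z by (auto simp: dist_norm norm_minus_commute X_def complex_eq_iff)
      have "h (cnj z) * (cnj z - X) powi k = cnj (h z * (z - X) powi k)"
        using r(4)[OF z(1)] r(4)[OF cz(1)] sym[of z] elim UHP_nonreal by simp
      also have "\<dots> = cnj (h z) * (cnj z - X) powi k"
        by (simp add: X_def)
      finally have "h (cnj z) = cnj (h z)"
        using cz(2) by simp
      then show ?case
        by (rule HOL.sym)
    qed
    then have "((\<lambda>z. h (cnj z)) \<longlongrightarrow> cnj (h (of_real t))) (at (of_real t) within UHP)"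
      by (rule Lim_transform_eventually[OF tendsto_cnj[OF l]])
    then have "cnj (h (of_real t)) = h (of_real t)"
      by (rule tendsto_unique[OF tendsto_at_real_UHP_nontrivial _ l2])
    then show ?thesis
      by (simp only: Reals_cnj_iff)
  qed
  have "((\<lambda>w. h w / h X) \<longlongrightarrow> h X / h X) (at X)"
    using ch[of X] r by (intro tendsto_intros) (auto simp: isCont_def)
  then have "\<forall>\<^sub>F w in at X. dist (h w / h X) 1 < 1"
    using r(2) by (auto simp: tendsto_iff)
  then obtain d0 where d0: "d0 > 0" "\<And>w. w \<noteq> X \<Longrightarrow> dist w X < d0 \<Longrightarrow> dist (h w / h X) 1 < 1"
    unfolding eventually_at by auto
  define d where "d = min d0 r"
  have d: "d > 0" "d \<le> r" "d \<le> d0"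
    using d0 r by (auto simp: d_def)
  \<comment> \<open>Normalising by \<open>h X\<close> keeps the argument of the principal logarithm
    in the right half plane, away from its cut; at real points the quotient is then a positive
    number and the logarithm is real.\<close>
  have pos: "Re (h w / h X) > 0" if "w \<in> ball X d" for w
  proof (cases "w = X")
    case False
    then have "cmod (1 - h w / h X) < 1"
      using d0(2)[of w] that d by (auto simp: dist_norm norm_minus_commute)
    then have "Re (1 - h w / h X) < 1"
      using complex_Re_le_cmod order_le_less_trans by blast
    then show ?thesis
      by simp
  qed (use r in auto)
  define l0 where "l0 = (\<lambda>w. Ln (h w / h X) + Ln (h X))"
  have holl0: "l0 holomorphic_on ball X d"
    unfolding l0_def
  proof (intro holomorphic_intros holomorphic_on_subset[OF holh])
    fix w assume "w \<in> ball X d"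
    then show "h w / h X \<notin> \<real>\<^sub>\<le>\<^sub>0"
      using pos[of w] by (auto simp: complex_nonpos_Reals_iff)
  qed (use d r in auto)
  have exp_l0: "exp (l0 w) = h w" if "w \<in> ball X d" for w
  proof -
    have "h w / h X \<noteq> 0"
      using pos[OF that] by fastforce
    then show ?thesis
      using r(2) by (simp add: l0_def exp_add exp_Ln del: divide_eq_0_iff)
  qed
  have fw: "f w = (w - X) powi k * h w" if "w \<in> ball X d - {X}" for w
  proof -
    have "w \<in> cball X r - {X}"
      using that d by auto
    then show ?thesis
      unfolding mult.commute[of "(w - X) powi k"] using r(4) by blast
  qed
  \<comment> \<open>The difference of two logarithms of f on the half disc.\<close>
  define v where "v = (\<lambda>z. u z - (of_int k * Ln (z - X) + l0 z))"
  define S where "S = UHP \<inter> ball X d"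
  obtain n :: int where n: "\<And>z. z \<in> S \<Longrightarrow> v z = of_int (2 * n) * of_real pi * \<i>"
  proof (rule constant_of_exp_eq_1)
    show "connected S"
      unfolding S_def by (intro convex_connected convex_Int) auto
    have hL: "(\<lambda>z. Ln (z - X)) holomorphic_on S"
      by (intro holomorphic_intros) (auto simp: S_def X_def complex_nonpos_Reals_iff)
    show "v holomorphic_on S"
      unfolding v_def
      by (intro holomorphic_on_diff holomorphic_on_add holomorphic_on_mult holomorphic_on_const hL
          holomorphic_on_subset[OF holu] holomorphic_on_subset[OF holl0]) (auto simp: S_def)
    fix z assume z: "z \<in> S"
    then have nX: "z - X \<noteq> 0"
      by (auto simp: S_def X_def)
    have "exp (of_int k * Ln (z - X)) = (z - X) powi k"
      using exp_power_int[of "Ln (z - X)" k] nX by simp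
    moreover have "exp (u z) = (z - X) powi k * exp (l0 z)"
      using exp_u[of z] fw[of z] exp_l0[of z] z nX by (simp add: S_def)
    ultimately have "exp (u z) = exp (of_int k * Ln (z - X) + l0 z)"
      by (simp only: exp_add)
    then show "exp (v z) = 1"
      unfolding v_def exp_diff by simp
  qed (rule that)
  define l where "l = (\<lambda>z. l0 z + of_int (2 * n) * of_real pi * \<i>)"
  define a where "a = Im (Ln (h X)) + 2 * n * pi"
  have "local_form x a l d"
    unfolding local_form_def X_def[symmetric] k_def[symmetric]
  proof (intro conjI ballI allI impI)
    show "d > 0" by fact
    show "l holomorphic_on ball X d"
      unfolding l_def by (intro holomorphic_intros holl0)
    show "u z = of_int k * Ln (z - X) + l z" if "z \<in> UHP \<inter> ball X d" for z
    proof -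
      have "u z - (of_int k * Ln (z - X) + l0 z) = of_int (2 * n) * of_real pi * \<i>"
        using n[of z] that unfolding v_def S_def .
      then show ?thesis
        by (simp only: l_def diff_eq_eq ac_simps)
    qed
    have "exp (of_int (2 * n) * of_real pi * \<i>) = 1"
      unfolding exp_eq_1 by (intro conjI exI[of _ n]) simp_all
    then have "exp (l z) = exp (l0 z)" for z
      unfolding l_def exp_add by (simp only: mult_1_right)
    then show "f z = (z - X) powi k * exp (l z)" if "z \<in> ball X d - {X}" for z
      using fw[OF that] exp_l0[of z] that by simp
    have hX: "h X \<in> \<real>"
      using hreal[of x] r by (simp add: X_def)
    then have "Im (Ln (h X)) = 0 \<or> Im (Ln (h X)) = pi"
      using Im_Ln_eq_0[OF r(2)] Im_Ln_eq_pi[OF r(2)] r(2) by (auto simp: complex_is_Real_iff complex_eq_iff)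
    then show "\<exists>N::int. a = of_int N * pi"
    proof
      assume "Im (Ln (h X)) = 0"
      then show ?thesis
        by (intro exI[of _ "2 * n"]) (simp add: a_def)
    next
      assume "Im (Ln (h X)) = pi"
      then show ?thesis
        by (intro exI[of _ "2 * n + 1"]) (simp add: a_def algebra_simps)
    qed
    fix t assume t: "\<bar>t - x\<bar> < d"
    then have tb: "of_real t \<in> ball X d"
      by (simp only: X_def of_real_in_ball_iff)
    have "h (of_real t) / h X \<in> \<real>"
      using hreal[of t] hX t d by (intro Reals_divide) auto
    then have "Im (Ln (h (of_real t) / h X)) = 0"
      using pos[OF tb] by (subst Im_Ln_eq_0) (auto simp: complex_is_Real_iff)
    then show "Im (l (of_real t)) = a"
      by (simp add: l_def l0_def a_def)
  qed
  then show ?thesis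
    by blast
qed

text \<open>At a zero or pole \<open>x\<close> the value below is the boundary value of \<open>Im u\<close> immediately to the right of \<open>x\<close>.\<close>

definition bval :: "real \<Rightarrow> real" where
  "bval x = (SOME a. \<exists>l d. local_form x a l d)"

lemma bval_form: obtains l d where "local_form x (bval x) l d"
  unfolding bval_def using someI_ex[OF local_form_exists[of x]] by blast

text \<open>The negative axis is the cut of \<open>Ln\<close>, so the limit is taken through
  \<open>Ln (of_real x - z) + \<i> * of_real pi\<close>, which agrees on the half plane and is
  continuous at y.\<close>

lemma Im_Ln_tendsto_left:
  assumes "y < x"
  shows "((\<lambda>z. Im (Ln (z - of_real x))) \<longlongrightarrow> pi) (at (of_real y) within UHP)"
proof (rule Lim_transform_eventually)
  have "((\<lambda>z. Im (Ln (of_real x - z) + \<i> * of_real pi)) \<longlongrightarrow> Im (Ln (of_real x - of_real y) + \<i> * of_real pi)) (at (of_real y) within UHP)"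
    using assms by (intro tendsto_intros) (auto simp: complex_nonpos_Reals_iff)
  moreover have "Ln (of_real x - of_real y) = of_real (ln (x - y))"
    using assms by (simp add: Ln_of_real flip: of_real_diff)
  ultimately show "((\<lambda>z. Im (Ln (of_real x - z) + \<i> * of_real pi)) \<longlongrightarrow> pi) (at (of_real y) within UHP)"
    by simp
  have "Ln (z - of_real x) = Ln (of_real x - z) + \<i> * of_real pi" if "z \<in> UHP" for z
  proof -
    have "of_real x - z \<noteq> 0"
      using that by auto
    then show ?thesis
      using Ln_minus[of "of_real x - z"] that by simp
  qed
  then show "\<forall>\<^sub>F z in at (of_real y) within UHP. Im (Ln (of_real x - z) + \<i> * of_real pi) = Im (Ln (z - of_real x))"
    by (auto simp: eventually_at_filter)
qed

lemma Im_Ln_tendsto_right: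
  assumes "y > x"
  shows "((\<lambda>z. Im (Ln (z - of_real x))) \<longlongrightarrow> 0) (at (of_real y) within UHP)"
proof -
  have "((\<lambda>z. Im (Ln (z - of_real x))) \<longlongrightarrow> Im (Ln (of_real y - of_real x))) (at (of_real y) within UHP)"
    using assms by (intro tendsto_intros) (auto simp: complex_nonpos_Reals_iff)
  moreover have "Ln (of_real y - of_real x) = of_real (ln (y - x))"
    using assms by (simp add: Ln_of_real flip: of_real_diff)
  ultimately show ?thesis
    by simp
qed

lemma Im_l_tendsto:
  assumes "local_form x a l d" "\<bar>y - x\<bar> < d"
  shows "((\<lambda>z. Im (l z)) \<longlongrightarrow> a) (at (of_real y) within UHP)"
proof -
  have "of_real y \<in> ball (of_real x :: complex) d"
    using assms(2) by (simp only: of_real_in_ball_iff)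
  then have "isCont l (of_real y)"
    using assms(1) holomorphic_on_imp_continuous_on continuous_on_interior
    unfolding local_form_def by (metis interior_open open_ball)
  then have "((\<lambda>z. Im (l z)) \<longlongrightarrow> Im (l (of_real y))) (at (of_real y) within UHP)"
    by (intro tendsto_Im) (simp add: isCont_def tendsto_within_subset[of _ _ _ UNIV])
  then show ?thesis
    using assms by (simp add: local_form_def)
qed

lemma Im_u_eq:
  assumes "local_form x a l d" "z \<in> UHP \<inter> ball (of_real x) d"
  shows "Im (u z) = of_int (zorder f (of_real x)) * Im (Ln (z - of_real x)) + Im (l z)"
  using assms by (auto simp: local_form_def)

lemma Im_u_tendsto_right:
  assumes "local_form x a l d" "x < y" "y < x + d"
  shows "((\<lambda>z. Im (u z)) \<longlongrightarrow> a) (at (of_real y) within UHP)"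
proof (rule Lim_transform_eventually)
  show "((\<lambda>z. of_int (zorder f (of_real x)) * Im (Ln (z - of_real x)) + Im (l z)) \<longlongrightarrow> a) (at (of_real y) within UHP)"
    using tendsto_add[OF tendsto_mult[OF tendsto_const Im_Ln_tendsto_right[OF assms(2)]] Im_l_tendsto[OF assms(1)]] assms
    by simp
  have "\<forall>\<^sub>F z in at (of_real y) within UHP. z \<in> UHP \<inter> ball (of_real x) d"
    using assms by (intro eventually_UHP_ball) auto
  then show "\<forall>\<^sub>F z in at (of_real y) within UHP. of_int (zorder f (of_real x)) * Im (Ln (z - of_real x)) + Im (l z) = Im (u z)"
    by eventually_elim (use Im_u_eq[OF assms(1)] in auto)
qed

lemma Im_u_tendsto_left:
  assumes "local_form x a l d" "x - d < y" "y < x"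
  shows "((\<lambda>z. Im (u z)) \<longlongrightarrow> a + of_int (zorder f (of_real x)) * pi) (at (of_real y) within UHP)"
proof (rule Lim_transform_eventually)
  show "((\<lambda>z. of_int (zorder f (of_real x)) * Im (Ln (z - of_real x)) + Im (l z)) \<longlongrightarrow> a + of_int (zorder f (of_real x)) * pi) (at (of_real y) within UHP)"
    using tendsto_add[OF tendsto_mult[OF tendsto_const Im_Ln_tendsto_left[OF assms(3)]] Im_l_tendsto[OF assms(1)]] assms
    by (simp add: add.commute)
  have "\<forall>\<^sub>F z in at (of_real y) within UHP. z \<in> UHP \<inter> ball (of_real x) d"
    using assms by (intro eventually_UHP_ball) auto
  then show "\<forall>\<^sub>F z in at (of_real y) within UHP. of_int (zorder f (of_real x)) * Im (Ln (z - of_real x)) + Im (l z) = Im (u z)"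
    by eventually_elim (use Im_u_eq[OF assms(1)] in auto)
qed

text \<open>The local form shows that f has neither zeros nor poles in the punctured neighbourhood;
  this makes the divisor locally finite and \<open>bval\<close> locally a step function.\<close>

lemma zorder_near:
  assumes "local_form x a l d" "\<bar>y - x\<bar> < d" "y \<noteq> x"
  shows "zorder f (of_real y) = 0"
proof -
  define S where "S = ball (of_real x :: complex) d - {of_real x}"
  define k where "k = zorder f (of_real x)"
  have S1: "open S"
    unfolding S_def by (intro open_Diff) auto
  have S2: "of_real y \<in> S"
    unfolding S_def Diff_iff of_real_in_ball_iff singleton_iff of_real_eq_iff using assms(2,3) by blast
  show ?thesis
  proof (rule zorder_eqI[where g = "\<lambda>z. (z - of_real x) powi k * exp (l z)", OF S1 S2])
    show "(\<lambda>z. (z - of_real x) powi k * exp (l z)) holomorphic_on S"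
    proof (intro holomorphic_on_mult holomorphic_on_exp' holomorphic_on_power_int holomorphic_on_diff
        holomorphic_on_ident holomorphic_on_const)
      show "l holomorphic_on S"
        by (rule holomorphic_on_subset[of l "ball (of_real x) d"]) (use assms(1) in \<open>auto simp: S_def local_form_def\<close>)
    qed (auto simp: S_def)
    show "(of_real y - of_real x) powi k * exp (l (of_real y)) \<noteq> 0"
      using assms(3) by simp
    show "f w = (w - of_real x) powi k * exp (l w) * (w - of_real y) powi 0" if "w \<in> S" for w
      using assms(1) that unfolding local_form_def S_def k_def by (simp only: power_int_0_right mult_1_right)
  qed
qed

lemma Im_u_tendsto_bval:
  assumes "zorder f (of_real y) = 0"
  shows "((\<lambda>z. Im (u z)) \<longlongrightarrow> bval y) (at (of_real y) within UHP)"
proof -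
  obtain l d where l: "local_form y (bval y) l d"
    by (rule bval_form)
  then have "d > 0"
    by (simp add: local_form_def)
  have "((\<lambda>z. Im (l z)) \<longlongrightarrow> bval y) (at (of_real y) within UHP)"
    by (rule Im_l_tendsto[OF l]) (use \<open>d > 0\<close> in simp)
  moreover have "\<forall>\<^sub>F z in at (of_real y) within UHP. z \<in> UHP \<inter> ball (of_real y) d"
    using \<open>d > 0\<close> by (intro eventually_UHP_ball) auto
  then have "\<forall>\<^sub>F z in at (of_real y) within UHP. Im (l z) = Im (u z)"
    by eventually_elim (use Im_u_eq[OF l] assms in auto)
  ultimately show ?thesis
    by (rule Lim_transform_eventually)
qed

text \<open>At regular points \<open>bval\<close> is the limit of \<open>Im (u z)\<close>, so
  uniqueness of limits lets it be read off from the local form at x. Thus \<open>bval\<close> is a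
  step function, continuous from the right.\<close>

lemma bval_near:
  assumes "local_form x (bval x) l d"
  shows "\<And>y. x \<le> y \<Longrightarrow> y < x + d \<Longrightarrow> bval y = bval x"
    and "\<And>y. x - d < y \<Longrightarrow> y < x \<Longrightarrow> bval y = bval x + of_int (zorder f (of_real x)) * pi"
proof -
  fix y assume y: "x \<le> y" "y < x + d"
  show "bval y = bval x"
  proof (cases "y = x")
    case False
    then have "zorder f (of_real y) = 0"
      using y by (intro zorder_near[OF assms]) auto
    then show ?thesis
      using tendsto_unique[OF _ Im_u_tendsto_bval Im_u_tendsto_right[OF assms, of y]] y False by simp
  qed simp
next
  fix y assume y: "x - d < y" "y < x"
  then have "zorder f (of_real y) = 0"
    by (intro zorder_near[OF assms]) auto
  then show "bval y = bval x + of_int (zorder f (of_real x)) * pi"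
    using tendsto_unique[OF _ Im_u_tendsto_bval Im_u_tendsto_left[OF assms, of y]] y by simp
qed

lemma bval_int: obtains N :: int where "bval x = of_int N * pi"
  using bval_form[of x] unfolding local_form_def by metis

text \<open>Both claims are additive under subdivision and hold on short intervals around each
  point, hence on \<open>[a, b]\<close> by bisection. Intervals open on the left and closed on the
  right match the right continuity of \<open>bval\<close>.\<close>

lemma bval_jump:
  assumes "a \<le> b"
  shows "finite {x. a < x \<and> x \<le> b \<and> zorder f (of_real x) \<noteq> 0} \<and>
    bval a - bval b = pi * of_int (\<Sum>x | a < x \<and> x \<le> b \<and> zorder f (of_real x) \<noteq> 0. zorder f (of_real x))"
proof -
  define Z where "Z = (\<lambda>a b. {x. a < x \<and> x \<le> b \<and> zorder f (of_real x) \<noteq> 0})"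
  define P where "P = (\<lambda>a b. finite (Z a b) \<and> bval a - bval b = pi * of_int (\<Sum>x\<in>Z a b. zorder f (of_real x)))"
  have "a \<le> b \<longrightarrow> P a b"
  proof (rule Bolzano[OF assms, of "\<lambda>a b. a \<le> b \<longrightarrow> P a b"])
    fix a b c assume *: "a \<le> b \<longrightarrow> P a b" "b \<le> c \<longrightarrow> P b c" "a \<le> b" "b \<le> c"
    then have f: "finite (Z a b)" "finite (Z b c)"
      by (auto simp: P_def)
    have Z: "Z a c = Z a b \<union> Z b c" "Z a b \<inter> Z b c = {}"
      using *(3,4) by (auto simp: Z_def)
    show "a \<le> c \<longrightarrow> P a c"
      using *(1,2) \<open>a \<le> b\<close> \<open>b \<le> c\<close> f unfolding P_def Z(1)
      by (simp add: sum.union_disjoint[OF f Z(2)] algebra_simps)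
  next
    fix x
    obtain l d where l: "local_form x (bval x) l d"
      by (rule bval_form)
    show "\<exists>d>0. \<forall>a b. a \<le> x \<and> x \<le> b \<and> b - a < d \<longrightarrow> a \<le> b \<longrightarrow> P a b"
    proof (intro exI[of _ d] conjI allI impI)
      show "d > 0" using l by (simp add: local_form_def)
      fix a b assume ab: "a \<le> x \<and> x \<le> b \<and> b - a < d" "a \<le> b"
      have z0: "zorder f (of_real y) = 0" if "a < y" "y \<le> b" "y \<noteq> x" for y
        using that ab by (intro zorder_near[OF l]) auto
      have b: "bval b = bval x"
        using ab by (intro bval_near(1)[OF l]) auto
      show "P a b"
      proof (cases "a = x")
        case True
        then have "Z a b = {}"
          using z0 by (auto simp: Z_def)
        then show ?thesis
          using True b by (simp add: P_def)
      next
        case False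
        then have a: "bval a = bval x + of_int (zorder f (of_real x)) * pi"
          using ab by (intro bval_near(2)[OF l]) auto
        have "Z a b = (if zorder f (of_real x) = 0 then {} else {x})"
          using z0 ab False by (auto simp: Z_def)
        then show ?thesis
          using a b by (simp add: P_def)
      qed
    qed
  qed
  then show ?thesis
    using assms by (simp add: P_def Z_def)
qed

text \<open>Bridges the open intervals of the interlacing condition and the half-open ones of
  \<open>bval_jump\<close>: immediately to the left of b there are no zeros or poles.\<close>

lemma bval_jump_open:
  assumes "a < b"
  obtains b' where "a < b'" "b' < b" 
    "{x. a < x \<and> x < b \<and> zorder f (of_real x) \<noteq> 0} = {x. a < x \<and> x \<le> b' \<and> zorder f (of_real x) \<noteq> 0}"
proof -
  obtain l d where l: "local_form b (bval b) l d"
    by (rule bval_form)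
  have d: "d > 0" using l by (simp add: local_form_def)
  define b' where "b' = max ((a + b) / 2) (b - d / 2)"
  have b': "a < b'" "b' < b" "b - d < b'"
    using assms d by (auto simp: b'_def less_max_iff_disj)
  have "zorder f (of_real y) = 0" if "b' < y" "y < b" for y
    using that b' by (intro zorder_near[OF l]) auto
  then have "y \<le> b'" if "y < b" "zorder f (of_real y) \<noteq> 0" for y
    using that by (meson not_le)
  then have "{x. a < x \<and> x < b \<and> zorder f (of_real x) \<noteq> 0} = {x. a < x \<and> x \<le> b' \<and> zorder f (of_real x) \<noteq> 0}"
    using b'(2) by (auto intro: le_less_trans)
  with b'(1,2) show thesis
    by (rule that)
qed

end

context log_real_meromorphic
begin

lemma bval_bounds:
  assumes "\<And>z. z \<in> UHP \<Longrightarrow> A \<le> Im (u z) \<and> Im (u z) \<le> B"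
  shows "A \<le> bval x" "bval x \<le> B"
    "A \<le> bval x + of_int (zorder f (of_real x)) * pi" "bval x + of_int (zorder f (of_real x)) * pi \<le> B"
proof -
  obtain l d where l: "local_form x (bval x) l d"
    by (rule bval_form)
  then have d: "d > 0" by (simp add: local_form_def)
  have ev: "\<forall>\<^sub>F z in at w within UHP. A \<le> Im (u z)" "\<forall>\<^sub>F z in at w within UHP. Im (u z) \<le> B" for w
    using eventually_in_UHP[of w] assms by (auto elim: eventually_mono)
  have "((\<lambda>z. Im (u z)) \<longlongrightarrow> bval x) (at (of_real (x + d/2)) within UHP)"
    by (rule Im_u_tendsto_right[OF l]) (use d in auto)
  then show "A \<le> bval x" "bval x \<le> B"
    using tendsto_lowerbound[OF _ ev(1)] tendsto_upperbound[OF _ ev(2)] tendsto_at_real_UHP_nontrivial by blast+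
  have "((\<lambda>z. Im (u z)) \<longlongrightarrow> bval x + of_int (zorder f (of_real x)) * pi) (at (of_real (x - d/2)) within UHP)"
    by (rule Im_u_tendsto_left[OF l]) (use d in auto)
  then show "A \<le> bval x + of_int (zorder f (of_real x)) * pi" "bval x + of_int (zorder f (of_real x)) * pi \<le> B"
    using tendsto_lowerbound[OF _ ev(1)] tendsto_upperbound[OF _ ev(2)] tendsto_at_real_UHP_nontrivial by blast+
qed

lemma bval_left: obtains y where "bval y = bval x + of_int (zorder f (of_real x)) * pi"
proof -
  obtain l d where l: "local_form x (bval x) l d"
    by (rule bval_form)
  then have d: "d > 0" by (simp add: local_form_def)
  then have "bval (x - d/2) = bval x + of_int (zorder f (of_real x)) * pi"
    by (intro bval_near(2)[OF l]) auto
  then show thesis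
    by (rule that)
qed

text \<open>At a zero or pole \<open>Im (u z)\<close> has no limit. Up to a small error it is a
  convex combination of the boundary values on the two sides, with weight the argument of
  \<open>z - x\<close> divided by pi.\<close>

lemma boundary_bounds:
  assumes "\<And>x. A \<le> bval x \<and> bval x \<le> B" "e > 0"
  shows "\<forall>\<^sub>F z in at (of_real x) within UHP. A - e < Im (u z) \<and> Im (u z) < B + e"
proof -
  obtain l d where l: "local_form x (bval x) l d"
    by (rule bval_form)
  then have d: "d > 0" by (simp add: local_form_def)
  define k where "k = real_of_int (zorder f (of_real x))"
  have left: "A \<le> bval x + k * pi" "bval x + k * pi \<le> B"
    using bval_left[of x] assms(1) unfolding k_def by metis+
  have "((\<lambda>z. Im (l z)) \<longlongrightarrow> bval x) (at (of_real x) within UHP)"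
    using d by (intro Im_l_tendsto[OF l]) auto
  then have "\<forall>\<^sub>F z in at (of_real x) within UHP. dist (Im (l z)) (bval x) < e"
    using assms(2) by (rule tendstoD)
  moreover have "\<forall>\<^sub>F z in at (of_real x) within UHP. z \<in> UHP \<inter> ball (of_real x) d"
    using d by (intro eventually_UHP_ball) auto
  ultimately show ?thesis
  proof eventually_elim
    case (elim z)
    define t where "t = Im (Ln (z - of_real x)) / pi"
    have "0 < Im (Ln (z - of_real x)) \<and> Im (Ln (z - of_real x)) < pi"
      using elim by (intro Im_Ln_pos_lt_imp) simp
    then have t: "0 < t" "t < 1"
      by (auto simp: t_def)
    have "Im (u z) = k * Im (Ln (z - of_real x)) + Im (l z)"
      using Im_u_eq[OF l, of z] elim by (simp add: k_def)
    also have "Im (Ln (z - of_real x)) = t * pi"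
      by (simp add: t_def)
    finally have eq: "Im (u z) = (1 - t) * bval x + t * (bval x + k * pi) + (Im (l z) - bval x)"
      by (simp add: algebra_simps)
    have "(1 - t) * A + t * A \<le> (1 - t) * bval x + t * (bval x + k * pi)"
      using t left assms(1)[of x] by (intro add_mono mult_left_mono) auto
    moreover have "(1 - t) * bval x + t * (bval x + k * pi) \<le> (1 - t) * B + t * B"
      using t left assms(1)[of x] by (intro add_mono mult_left_mono) auto
    moreover have "(1 - t) * A + t * A = A" "(1 - t) * B + t * B = B"
      by (simp_all add: algebra_simps)
    moreover have "\<bar>Im (l z) - bval x\<bar> < e"
      using elim by (simp add: dist_real_def)
    ultimately show ?case
      unfolding eq by linarith
  qed
qed

text \<open>The interval is extended slightly beyond b, where f has no further zeros or poles, so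
  that the interlacing condition for an open interval bounds the jump sum over the half-open
  one.\<close>

lemma bval_oscillation:
  assumes "interlacing UNIV m f" "a < b"
  shows "\<bar>bval a - bval b\<bar> \<le> real m * pi"
proof -
  obtain l d where l: "local_form b (bval b) l d"
    by (rule bval_form)
  then have d: "d > 0" by (simp add: local_form_def)
  have z: "zorder f (of_real y) = 0" if "b < y" "y < b + d" for y
    using that by (intro zorder_near[OF l]) auto
  have "x \<le> b" if "x < b + d" "zorder f (of_real x) \<noteq> 0" for x
    using z that by (meson not_le)
  then have "{x. a < x \<and> x \<le> b \<and> zorder f (of_real x) \<noteq> 0} = {x. a < x \<and> x < b + d \<and> zorder f (of_real x) \<noteq> 0}"
    using d by auto
  then have "\<bar>\<Sum>x | a < x \<and> x \<le> b \<and> zorder f (of_real x) \<noteq> 0. zorder f (of_real x)\<bar> \<le> int m"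
    using assms d unfolding interlacing_def by auto
  then have "\<bar>real_of_int (\<Sum>x | a < x \<and> x \<le> b \<and> zorder f (of_real x) \<noteq> 0. zorder f (of_real x))\<bar> \<le> real m"
    by linarith
  then have "pi * \<bar>real_of_int (\<Sum>x | a < x \<and> x \<le> b \<and> zorder f (of_real x) \<noteq> 0. zorder f (of_real x))\<bar> \<le> pi * real m"
    by (intro mult_left_mono) auto
  moreover have "bval a - bval b = pi * of_int (\<Sum>x | a < x \<and> x \<le> b \<and> zorder f (of_real x) \<noteq> 0. zorder f (of_real x))"
    using bval_jump[of a b] assms(2) by simp
  ultimately show ?thesis
    by (simp only: abs_mult) (simp add: mult.commute)
qed

text \<open>Divided by pi, \<open>bval\<close> takes integer values that differ by at most m; N is
  their minimum. These bounds then pass from the boundary to the half plane.\<close>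

lemma interlacing_imp_Im_bounds:
  assumes "bounded_quotient f" "interlacing UNIV m f"
  obtains N :: int where "\<And>z. z \<in> UHP \<Longrightarrow> of_int N * pi \<le> Im (u z) \<and> Im (u z) \<le> of_int (N + int m) * pi"
proof -
  have "\<forall>x. \<exists>N::int. bval x = of_int N * pi"
    using bval_int by metis
  then obtain n :: "real \<Rightarrow> int" where n: "\<And>x. bval x = of_int (n x) * pi"
    by metis
  have osc: "\<bar>n a - n b\<bar> \<le> int m" for a b
  proof -
    have *: "\<bar>n a - n b\<bar> \<le> int m" if "a < b" for a b
    proof -
      have "\<bar>real_of_int (n a - n b)\<bar> * pi \<le> real m * pi"
        using bval_oscillation[OF assms(2) that] unfolding n
        by (simp add: abs_mult flip: left_diff_distrib)
      then have "\<bar>real_of_int (n a - n b)\<bar> \<le> real m"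
        by simp
      then show ?thesis
        by linarith
    qed
    show ?thesis
      using *[of a b] *[of b a] by (cases a b rule: linorder_cases) auto
  qed
  \<comment> \<open>No value lies more than m below \<open>n 0\<close>, so the shift by
    \<open>n 0 - int m\<close> loses nothing under \<open>nat\<close>, and the minimum is attained
    as a least natural number.\<close>
  obtain x0 where x0: "\<And>y. nat (n x0 - (n 0 - int m)) \<le> nat (n y - (n 0 - int m))"
    using ex_has_least_nat[of "\<lambda>_. True" _ "\<lambda>x. nat (n x - (n 0 - int m))"] by auto
  have min: "n x0 \<le> n y" for y
    using x0[of y] osc[of 0 y] osc[of 0 x0] by linarith
  define N where "N = n x0"
  have bb: "of_int N * pi \<le> bval x \<and> bval x \<le> of_int (N + int m) * pi" for x
  proof -
    have "N \<le> n x" "n x \<le> N + int m"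
      using min[of x] osc[of x x0] by (auto simp: N_def)
    then have "real_of_int N \<le> of_int (n x)" "real_of_int (n x) \<le> of_int (N + int m)"
      by linarith+
    then show ?thesis
      unfolding n by (intro conjI mult_right_mono) auto
  qed
  have holf: "f holomorphic_on UHP"
    using hol by (rule holomorphic_on_subset) (use UHP_nonreal in auto)
  show thesis
    by (rule that[of N], rule log_bounds_from_boundary[OF assms(1) holf holu exp_u boundary_bounds[OF bb]])
qed

end

section \<open>Consequences of an argument confined to an interval of length m pi\<close>

locale bounded_log_real_meromorphic = log_real_meromorphic +
  fixes N :: int and m :: nat
  assumes Im_bounds: "\<And>z. z \<in> UHP \<Longrightarrow> of_int N * pi \<le> Im (u z) \<and> Im (u z) \<le> of_int (N + int m) * pi"
begin

text \<open>A sum of the divisor is a difference of two boundary values of the argument divided by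
  pi, and both values lie in the same interval of length m pi.\<close>

lemma interlacing: "interlacing UNIV m f"
  unfolding interlacing_def
proof (intro conjI allI impI ballI)
  show "f nicely_meromorphic_on UNIV" by (rule mero)
  show "\<exists>z\<in>UNIV. f z \<noteq> 0"
    using nz_UHP[of \<i>] by auto
  show "z \<in> \<real>" if "f z = 0 \<or> is_pole f z" for z
  proof (rule ccontr)
    assume z: "z \<notin> \<real>"
    have "f analytic_on {z}"
      by (rule analytic_at_nonreal[OF hol z])
    then have "\<not> is_pole f z"
      by (rule analytic_at_imp_no_pole)
    then show False
      using that nz_nonreal[OF z] by simp
  qed
  fix a b :: real assume "a < b"
  then obtain b' where b': "a < b'" "b' < b" 
    "{x. a < x \<and> x < b \<and> zorder f (of_real x) \<noteq> 0} = {x. a < x \<and> x \<le> b' \<and> zorder f (of_real x) \<noteq> 0}"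
    by (rule bval_jump_open)
  define s where "s = (\<Sum>x | a < x \<and> x \<le> b' \<and> zorder f (of_real x) \<noteq> 0. zorder f (of_real x))"
  have "pi * of_int s = bval a - bval b'"
    using bval_jump[of a b'] b'(1) by (simp add: s_def)
  moreover have "bval a \<le> of_int (N + int m) * pi" "of_int N * pi \<le> bval a" "bval b' \<le> of_int (N + int m) * pi" "of_int N * pi \<le> bval b'"
    using bval_bounds[OF Im_bounds] by blast+
  moreover have "of_int (N + int m) * pi = of_int N * pi + real m * pi"
    by (simp add: algebra_simps)
  ultimately have "\<bar>pi * of_int s\<bar> \<le> real m * pi"
    by linarith
  then have "\<bar>real_of_int s\<bar> \<le> real m"
    by (simp add: abs_mult mult.commute)
  then show "\<bar>\<Sum>x | a < x \<and> x < b \<and> zorder f (of_real x) \<noteq> 0. zorder f (of_real x)\<bar> \<le> int m"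
    unfolding b'(3) s_def[symmetric] by linarith
qed simp_all

text \<open>To the left of x the argument is at least N pi, to the right at most (N + m) pi, and the
  former exceeds the latter by the order times pi.\<close>

lemma zorder_ge: "zorder f (of_real x) \<ge> - int m"
proof -
  have "real_of_int N * pi \<le> bval x + of_int (zorder f (of_real x)) * pi" "bval x \<le> of_int (N + int m) * pi"
    using bval_bounds[OF Im_bounds] by blast+
  then have "0 \<le> (real m + of_int (zorder f (of_real x))) * pi"
    by (simp add: algebra_simps)
  then have "0 \<le> real m + of_int (zorder f (of_real x))"
    using pi_gt_zero by (simp add: zero_le_mult_iff)
  then show ?thesis
    by linarith
qed

text \<open>The factor \<open>cos (of_int N * pi)\<close> is the sign of N even or odd. It is the
  same at every x: at a pole of order m the argument has to pass from one end of its range to the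
  other, which fixes the sign of the leading coefficient. At all other points the limit is
  0.\<close>

lemma pole_limit:
  obtains L :: real where "L \<ge> 0" "L > 0 \<longleftrightarrow> zorder f (of_real x) = - int m"
    "((\<lambda>z. (of_real x - z) ^ m * f z) \<longlongrightarrow> of_real (cos (of_int N * pi) * L)) (at (of_real x))"
proof -
  obtain l d where l: "local_form x (bval x) l d"
    by (rule bval_form)
  then have d: "d > 0" and holl: "l holomorphic_on ball (of_real x) d" and lx: "Im (l (of_real x)) = bval x"
    and fz: "\<And>z. z \<in> ball (of_real x) d - {of_real x} \<Longrightarrow> f z = (z - of_real x) powi zorder f (of_real x) * exp (l z)"
    by (auto simp: local_form_def)
  define X :: complex where "X = of_real x"
  define k where "k = zorder f X"
  define j where "j = nat (k + int m)"
  have j: "int j = k + int m"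
    using zorder_ge[of x] by (simp add: j_def k_def X_def)
  have "isCont l X"
    using holomorphic_on_imp_continuous_on[OF holl] d by (auto simp: X_def intro!: continuous_on_interior)
  then have "((\<lambda>z. (-1) ^ m * ((z - X) ^ j * exp (l z))) \<longlongrightarrow> (-1) ^ m * ((X - X) ^ j * exp (l X))) (at X)"
    by (intro tendsto_intros) (simp add: isCont_def)
  moreover have "\<forall>\<^sub>F z in at X. z \<in> ball X d - {X}"
    using d eventually_at_in_open[of "ball X d" X] by simp
  then have "\<forall>\<^sub>F z in at X. (-1) ^ m * ((z - X) ^ j * exp (l z)) = (X - z) ^ m * f z"
  proof eventually_elim
    case (elim z)
    then have nz: "z - X \<noteq> 0"
      by auto
    have "(z - X) ^ j = (z - X) powi (int m + k)"
      by (simp add: add.commute flip: j)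
    also have "\<dots> = (z - X) ^ m * (z - X) powi k"
      using nz by (simp add: power_int_add)
    moreover have "(X - z) ^ m = (-1) ^ m * (z - X) ^ m"
      by (metis minus_diff_eq mult_minus1 power_mult_distrib)
    ultimately show ?case
      using fz[of z] elim by (simp add: X_def k_def)
  qed
  ultimately have lim: "((\<lambda>z. (X - z) ^ m * f z) \<longlongrightarrow> (-1) ^ m * ((X - X) ^ j * exp (l X))) (at X)"
    by (rule Lim_transform_eventually)
  show thesis
  proof (cases "j = 0")
    case True
    then have k: "k = - int m"
      using j by simp
    \<comment> \<open>A pole of order m leaves no slack in the two bounds, so the argument
      immediately to the right of x is exactly (N + m) pi; the resulting power of -1 cancels against
      that of \<open>(X - z) ^ m\<close>.\<close>
    have "of_int N * pi \<le> bval x - real m * pi" "bval x \<le> of_int (N + int m) * pi"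
      using bval_bounds(2,3)[OF Im_bounds, of x] k by (auto simp: k_def X_def)
    then have bx: "bval x = of_int N * pi + real m * pi"
      by (simp add: algebra_simps)
    have c: "cos (bval x) = cos (of_int N * pi) * (-1) ^ m" "sin (bval x) = 0"
      unfolding bx cos_add sin_add by (simp_all add: sin_zero_iff_int2)
    have "exp (l X) = of_real (exp (Re (l X)) * cos (bval x))"
      using c(2) lx by (simp add: complex_eq_iff Re_exp Im_exp X_def)
    then have "(-1) ^ m * ((X - X) ^ j * exp (l X)) = of_real (cos (of_int N * pi) * exp (Re (l X)))"
      unfolding c(1) using True by (simp add: flip: power_mult_distrib)
    then show thesis
      using lim k by (intro that[of "exp (Re (l X))"]) (simp_all add: X_def k_def)
  next
    case False
    then have z: "zorder f (of_real x) \<noteq> - int m"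
      using j by (simp add: k_def X_def)
    have "(-1) ^ m * ((X - X) ^ j * exp (l X)) = of_real (cos (of_int N * pi) * 0)"
      using False by simp
    with lim have "((\<lambda>z. (X - z) ^ m * f z) \<longlongrightarrow> of_real (cos (of_int N * pi) * 0)) (at X)"
      by (simp only:)
    then show thesis
      using z by (intro that[of 0]) (simp_all add: X_def)
  qed
qed

text \<open>After subtraction of N pi the argument lies between 0 and m pi; division of the
  logarithm by m brings it into the range from 0 to pi, where the sine is nonnegative. The
  subtraction costs the sign \<open>cos (of_int N * pi)\<close>.\<close>

lemma pick_root:
  assumes "m \<ge> 1"
  obtains \<phi> where "pick \<phi>" "\<And>z. z \<in> UHP \<Longrightarrow> f z = of_real (cos (of_int N * pi)) * \<phi> z ^ m"
proof (rule that)
  define \<phi> where "\<phi> = (\<lambda>z. exp ((u z - \<i> * of_real (of_int N * pi)) / of_nat m))"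
  show "pick \<phi>"
    unfolding pick_def
  proof
    show "\<phi> holomorphic_on UHP"
      unfolding \<phi>_def using assms by (intro holomorphic_intros holu) auto
    show "\<forall>z\<in>UHP. 0 \<le> Im (\<phi> z)"
    proof
      fix z assume "z \<in> UHP"
      note b = Im_bounds[OF this]
      define t where "t = (Im (u z) - of_int N * pi) / real m"
      have "0 \<le> t" "t \<le> pi"
        using b assms by (auto simp: t_def field_simps)
      then have "0 \<le> sin t"
        by (rule sin_ge_zero)
      moreover have "Im ((u z - \<i> * of_real (of_int N * pi)) / of_nat m) = t"
        by (simp add: t_def Im_divide_of_nat)
      ultimately show "0 \<le> Im (\<phi> z)"
        unfolding \<phi>_def Im_exp by simp
    qed
  qed
  fix z assume z: "z \<in> UHP"
  have "\<phi> z ^ m = exp (u z - \<i> * of_real (of_int N * pi))"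
    unfolding \<phi>_def using assms by (simp flip: exp_of_nat_mult)
  also have "\<dots> = f z * exp (- (\<i> * of_real (of_int N * pi)))"
    by (simp only: exp_diff exp_u[OF z] exp_minus divide_inverse)
  finally have "of_real (cos (of_int N * pi)) * \<phi> z ^ m = f z * (of_real (cos (of_int N * pi)) * exp (- (\<i> * of_real (of_int N * pi))))"
    by (simp only: mult.left_commute)
  moreover have "exp (- (\<i> * of_real (of_int N * pi))) = of_real (cos (of_int N * pi))"
    by (simp add: complex_eq_iff Re_exp Im_exp sin_zero_iff_int2)
  moreover have "cos (of_int N * pi) * cos (of_int N * pi) = (1::real)"
  proof -
    have "sin (of_int N * pi) = 0"
      by (auto simp: sin_zero_iff_int2)
    then show ?thesis
      using sin_cos_squared_add[of "of_int N * pi"] by (simp add: power2_eq_square)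
  qed
  ultimately show "f z = of_real (cos (of_int N * pi)) * \<phi> z ^ m"
    by (simp flip: of_real_mult)
qed

lemma leading_limit_exists:
  assumes "m \<ge> 1"
  obtains b :: real where "b \<ge> 0" "leading_limit m f (of_real (cos (of_int N * pi) * b))"
proof -
  obtain \<phi> where \<phi>: "pick \<phi>" "\<And>z. z \<in> UHP \<Longrightarrow> f z = of_real (cos (of_int N * pi)) * \<phi> z ^ m"
    by (rule pick_root[OF assms]) (rule that)
  obtain b :: real where b: "b \<ge> 0" "((\<lambda>r::real. \<phi> (\<i> * of_real r) / (\<i> * of_real r)) \<longlongrightarrow> of_real b) at_top"
    using pick_scaled_limit[OF \<phi>(1)] by metis
  show thesis
  proof (rule that[of "b ^ m"])
    show "leading_limit m f (of_real (cos (of_int N * pi) * b ^ m))"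
      unfolding leading_limit_def
    proof (rule Lim_transform_eventually)
      show "((\<lambda>r::real. of_real (cos (of_int N * pi)) * (\<phi> (\<i> * of_real r) / (\<i> * of_real r)) ^ m) \<longlongrightarrow> of_real (cos (of_int N * pi) * b ^ m)) at_top"
        unfolding of_real_mult of_real_power by (intro tendsto_intros b)
      show "\<forall>\<^sub>F r::real in at_top. of_real (cos (of_int N * pi)) * (\<phi> (\<i> * of_real r) / (\<i> * of_real r)) ^ m = f (\<i> * of_real r) / (\<i> * of_real r) ^ m"
        using eventually_gt_at_top[of 0]
      proof eventually_elim
        case (elim r)
        show ?case
          using \<phi>(2)[of "\<i> * of_real r"] elim by (simp add: power_divide)
      qed
    qed
  qed (use b in auto)
qed

end

section \<open>Hermitian forms, Schur complements and determinants\<close>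

text \<open>Matrices are handled as functions of two indices; only the entries with indices below \<open>n\<close> matter.\<close>

definition qform :: "nat \<Rightarrow> (nat \<Rightarrow> nat \<Rightarrow> complex) \<Rightarrow> (nat \<Rightarrow> complex) \<Rightarrow> complex" where
  "qform n A v = (\<Sum>i<n. \<Sum>j<n. cnj (v i) * A i j * v j)"

definition fdet :: "nat \<Rightarrow> (nat \<Rightarrow> nat \<Rightarrow> complex) \<Rightarrow> complex" where
  "fdet n A = Determinant.det (mat n n (\<lambda>(i, j). A i j))"

definition schur :: "(nat \<Rightarrow> nat \<Rightarrow> complex) \<Rightarrow> nat \<Rightarrow> nat \<Rightarrow> complex" where
  "schur B i j = B (Suc i) (Suc j) - B (Suc i) 0 * B 0 (Suc j) / B 0 0"

lemma qform_cong:
  assumes "\<And>i j. i < n \<Longrightarrow> j < n \<Longrightarrow> A i j = B i j" "\<And>i. i < n \<Longrightarrow> v i = w i"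
  shows "qform n A v = qform n B w"
  unfolding qform_def using assms by (intro sum.cong) auto

lemma fdet_cong:
  assumes "\<And>i j. i < n \<Longrightarrow> j < n \<Longrightarrow> A i j = B i j"
  shows "fdet n A = fdet n B"
  unfolding fdet_def using assms by (intro arg_cong[of _ _ Determinant.det] eq_matI) auto

lemma fdet_leibniz:
  "fdet n A = (\<Sum>p | p permutes {0..<n}. signof p * (\<Prod>i=0..<n. A i (p i)))"
proof -
  have "fdet n A = (\<Sum>p | p permutes {0..<n}. signof p * (\<Prod>i=0..<n. mat n n (\<lambda>(i, j). A i j) $$ (i, p i)))"
    unfolding fdet_def by (rule det_def') auto
  also have "\<dots> = (\<Sum>p | p permutes {0..<n}. signof p * (\<Prod>i=0..<n. A i (p i)))"
    by (intro sum.cong prod.cong refl arg_cong2[of _ _ _ _ "(*)"]) (auto dest: permutes_in_image)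
  finally show ?thesis .
qed

lemma fdet_0 [simp]: "fdet 0 A = 1"
  by (simp add: fdet_def)

lemma fdet_1 [simp]: "fdet (Suc 0) A = A 0 0"
  by (simp add: fdet_def det_single)

lemma qform_cnj: "cnj (qform n A v) = qform n (\<lambda>i j. cnj (A j i)) v"
proof -
  have "cnj (qform n A v) = (\<Sum>i<n. \<Sum>j<n. cnj (v j) * cnj (A i j) * v i)"
    unfolding qform_def cnj_sum complex_cnj_mult complex_cnj_cnj
    by (intro sum.cong refl) (simp only: mult_ac)
  also have "\<dots> = (\<Sum>j<n. \<Sum>i<n. cnj (v j) * cnj (A i j) * v i)"
    by (rule sum.swap)
  finally show ?thesis
    by (simp add: qform_def)
qed

lemma qform_scale: "qform n A (\<lambda>i. c * v i) = of_real ((cmod c)\<^sup>2) * qform n A v"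
  by (simp add: qform_def sum_distrib_left complex_norm_square mult_ac del: of_real_power)

lemma qform_unit:
  assumes "i < n"
  shows "qform n A (\<lambda>k. if k = i then 1 else 0) = A i i"
proof -
  have "qform n A (\<lambda>k. if k = i then 1 else 0) = (\<Sum>k<n. if k = i then A i i else 0)"
    unfolding qform_def using assms by (intro sum.cong refl) (auto simp: if_distrib[of cnj] if_distrib[of "\<lambda>x. _ * x"] sum.delta cong: if_cong)
  then show ?thesis
    using assms by (simp add: sum.delta)
qed

lemma qform_two:
  assumes "i < n" "j < n" "i \<noteq> j"
  shows "qform n A (\<lambda>k. if k = i then a else if k = j then c else 0) =
    cnj a * a * A i i + cnj a * c * A i j + cnj c * a * A j i + cnj c * c * A j j"
proof -
  define v where "v = (\<lambda>k. if k = i then a else if k = j then c else 0)"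
  have sub: "(\<Sum>k<n. g k * v k) = g i * a + g j * c" for g :: "nat \<Rightarrow> complex"
  proof -
    have "(\<Sum>k<n. g k * v k) = (\<Sum>k\<in>{i, j}. g k * v k)"
      using assms by (intro sum.mono_neutral_right) (auto simp: v_def)
    then show ?thesis
      using assms by (simp add: v_def)
  qed
  have sub': "(\<Sum>k<n. cnj (v k) * g k) = cnj a * g i + cnj c * g j" for g :: "nat \<Rightarrow> complex"
  proof -
    have "(\<Sum>k<n. cnj (v k) * g k) = (\<Sum>k\<in>{i, j}. cnj (v k) * g k)"
      using assms by (intro sum.mono_neutral_right) (auto simp: v_def)
    then show ?thesis
      using assms by (simp add: v_def)
  qed
  have "qform n A v = (\<Sum>k<n. cnj (v k) * (\<Sum>l<n. A k l * v l))"
    by (simp add: qform_def sum_distrib_left mult.assoc)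
  then show ?thesis
    unfolding v_def[symmetric] sub sub' by (simp add: algebra_simps)
qed

text \<open>The second test vector carries \<open>\<i>\<close> so that in the combination the entry
  \<open>A j i\<close> cancels. This recovers all entries, and limits of entries, from values of the
  form, without assuming A Hermitian.\<close>

lemma polarization:
  assumes "i < n" "j < n" "i \<noteq> j"
  shows "A i j = (qform n A (\<lambda>k. if k = i then 1 else if k = j then 1 else 0)
      - \<i> * qform n A (\<lambda>k. if k = i then 1 else if k = j then \<i> else 0)
      - (1 - \<i>) * (A i i + A j j)) / 2"
  unfolding qform_two[OF assms] by (simp add: algebra_simps)

lemma qform_eq_0_imp:
  assumes "\<And>v. qform n A v = 0" "i < n" "j < n"
  shows "A i j = 0"
  using assms qform_unit[of _ n A] polarization[of i n j A] by (cases "i = j") auto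

text \<open>Completing the square: with \<beta> the sum over the first row and \<gamma> the one over
  the first column, the summands before the Schur complement combine to \<open>(cnj (v 0) * B 0 0 +
  \<gamma>) * (B 0 0 * v 0 + \<beta>) / B 0 0\<close>.\<close>

lemma qform_Suc_schur:
  assumes "B 0 0 \<noteq> 0"
  shows "qform (Suc n) B v = cnj (v 0) * B 0 0 * v 0 + cnj (v 0) * (\<Sum>j<n. B 0 (Suc j) * v (Suc j))
     + (\<Sum>i<n. cnj (v (Suc i)) * B (Suc i) 0) * v 0
     + (\<Sum>i<n. cnj (v (Suc i)) * B (Suc i) 0) * (\<Sum>j<n. B 0 (Suc j) * v (Suc j)) / B 0 0
     + qform n (schur B) (\<lambda>i. v (Suc i))"
proof -
  define w where "w = (\<lambda>i. v (Suc i))"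
  have "qform n (schur B) w = (\<Sum>i<n. \<Sum>j<n. cnj (w i) * B (Suc i) (Suc j) * w j)
      - (\<Sum>i<n. \<Sum>j<n. (cnj (w i) * B (Suc i) 0) * (B 0 (Suc j) * w j)) / B 0 0"
    by (simp add: qform_def schur_def algebra_simps sum_subtractf sum_divide_distrib)
  also have "(\<Sum>i<n. \<Sum>j<n. (cnj (w i) * B (Suc i) 0) * (B 0 (Suc j) * w j)) = 
      (\<Sum>i<n. cnj (w i) * B (Suc i) 0) * (\<Sum>j<n. B 0 (Suc j) * w j)"
    by (simp add: sum_product)
  finally have s: "qform n (schur B) w = (\<Sum>i<n. \<Sum>j<n. cnj (w i) * B (Suc i) (Suc j) * w j)
      - (\<Sum>i<n. cnj (w i) * B (Suc i) 0) * (\<Sum>j<n. B 0 (Suc j) * w j) / B 0 0" .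
  have "qform (Suc n) B v = cnj (v 0) * B 0 0 * v 0 + (\<Sum>j<n. cnj (v 0) * B 0 (Suc j) * w j)
     + (\<Sum>i<n. cnj (w i) * B (Suc i) 0 * v 0 + (\<Sum>j<n. cnj (w i) * B (Suc i) (Suc j) * w j))"
    unfolding qform_def sum.lessThan_Suc_shift w_def by simp
  also have "\<dots> = cnj (v 0) * B 0 0 * v 0 + cnj (v 0) * (\<Sum>j<n. B 0 (Suc j) * w j)
     + (\<Sum>i<n. cnj (w i) * B (Suc i) 0) * v 0 + (\<Sum>i<n. \<Sum>j<n. cnj (w i) * B (Suc i) (Suc j) * w j)"
    by (simp add: sum.distrib sum_distrib_left sum_distrib_right mult.assoc)
  finally show ?thesis
    unfolding w_def using s[unfolded w_def] by simp
qed

text \<open>The new first coordinate c is chosen to annihilate the factor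
  \<open>B 0 0 * c + \<beta>\<close> of the completed square.\<close>

lemma qform_schur:
  assumes "B 0 0 \<noteq> 0"
  obtains c where "qform n (schur B) w = qform (Suc n) B (\<lambda>i. case i of 0 \<Rightarrow> c | Suc k \<Rightarrow> w k)"
proof
  define c where "c = - (\<Sum>j<n. B 0 (Suc j) * w j) / B 0 0"
  have c: "B 0 0 * c = - (\<Sum>j<n. B 0 (Suc j) * w j)"
    using assms by (simp add: c_def)
  show "qform n (schur B) w = qform (Suc n) B (\<lambda>i. case i of 0 \<Rightarrow> c | Suc k \<Rightarrow> w k)"
    unfolding qform_Suc_schur[where B = B, OF assms] using c by (simp add: mult.assoc) (simp add: c_def)
qed

text \<open>Elimination of the first column by a unit lower triangular matrix leaves a block upper
  triangular one, with blocks \<open>B 0 0\<close> and the Schur complement.\<close>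

lemma fdet_schur:
  assumes "B 0 0 \<noteq> 0"
  shows "fdet (Suc n) B = B 0 0 * fdet n (schur B)"
proof -
  define M where "M = mat (Suc n) (Suc n) (\<lambda>(i, j). B i j)"
  define L where "L = mat (Suc n) (Suc n) (\<lambda>(i, j). if i = j then 1 else if j = 0 then - B i 0 / B 0 0 else 0)"
  have carr: "M \<in> carrier_mat (Suc n) (Suc n)" "L \<in> carrier_mat (Suc n) (Suc n)"
    by (auto simp: M_def L_def)
  have "Determinant.det L = prod_list (diag_mat L)"
    by (rule det_lower_triangular[of "Suc n"]) (auto simp: L_def)
  also have "diag_mat L = map (\<lambda>_. 1) [0..<Suc n]"
    unfolding diag_mat_def by (rule map_cong) (auto simp: L_def)
  finally have dL: "Determinant.det L = 1"
    by (simp add: map_replicate_const)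
  define F where "F = four_block_mat (mat 1 1 (\<lambda>_. B 0 0)) (mat 1 n (\<lambda>(i, j). B 0 (Suc j))) (0\<^sub>m n 1) (mat n n (\<lambda>(i, j). schur B i j))"
  have "L * M = F"
  proof (rule eq_matI)
    fix i j assume ij: "i < dim_row F" "j < dim_col F"
    then have ij': "i < Suc n" "j < Suc n"
      by (auto simp: F_def)
    have "(L * M) $$ (i, j) = (\<Sum>k = 0..<Suc n. L $$ (i, k) * M $$ (k, j))"
      using ij' carr by (auto simp: scalar_prod_def)
    also have "\<dots> = (\<Sum>k = 0..<Suc n. (if k = i then B i j else 0) + (if k = 0 then (if i = 0 then 0 else - B i 0 / B 0 0 * B 0 j) else 0))"
      using ij' by (intro sum.cong) (auto simp: L_def M_def)
    also have "\<dots> = B i j + (if i = 0 then 0 else - B i 0 / B 0 0 * B 0 j)"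
      using ij' by (simp add: sum.distrib sum.delta)
    also have "\<dots> = F $$ (i, j)"
      using ij' assms by (cases i; cases j) (auto simp: F_def schur_def)
    finally show "(L * M) $$ (i, j) = F $$ (i, j)" .
  qed (auto simp: F_def M_def L_def)
  moreover have "Determinant.det F = Determinant.det (mat 1 1 (\<lambda>_. B 0 0)) * Determinant.det (mat n n (\<lambda>(i, j). schur B i j))"
    unfolding F_def by (rule det_four_block_mat_lower_left_zero) auto
  moreover have "Determinant.det (L * M) = Determinant.det L * Determinant.det M"
    by (rule det_mult[OF carr(2,1)])
  ultimately show ?thesis
    using dL by (simp add: fdet_def M_def det_single)
qed

subsection \<open>Positivity from principal minors\<close>

lemma fdet_2: "fdet 2 B = B 0 0 * B 1 1 - B 0 1 * B 1 0"
proof -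
  define t where "t = Transposition.transpose (0::nat) 1"
  have I: "{0..<2} = {0, 1::nat}"
    by auto
  have P: "{p. p permutes {0..<2::nat}} = {id, t}"
    unfolding I permutes_doubleton_iff t_def by auto
  have "id \<noteq> t"
    unfolding t_def by (metis id_apply transpose_apply_first zero_neq_one)
  moreover have "signof t = (-1 :: complex)"
    by (simp add: t_def sign_swap_id)
  moreover have "t 0 = 1" "t 1 = 0"
    by (simp_all add: t_def)
  ultimately show ?thesis
    unfolding fdet_leibniz P unfolding I by (simp add: sign_id)
qed

text \<open>If \<open>B 0 0\<close> vanishes, the minors of order 2 containing index 0 force the
  first row and column to vanish. Otherwise the square is completed, and the principal minors of the
  Schur complement are those of B containing index 0, divided by \<open>B 0 0\<close>.\<close>

lemma psd_from_principal_minors: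
  assumes "\<And>i j. i < n \<Longrightarrow> j < n \<Longrightarrow> B i j = cnj (B j i)"
    and "\<And>idx. sorted_wrt (<) idx \<Longrightarrow> set idx \<subseteq> {..<n} \<Longrightarrow> 0 \<le> fdet (length idx) (\<lambda>k l. B (idx ! k) (idx ! l))"
  shows "0 \<le> qform n B v"
  using assms
proof (induction n arbitrary: B v)
  case 0
  then show ?case by (simp add: qform_def)
next
  case (Suc n)
  note herm = Suc.prems(1) and minor = Suc.prems(2)
  have B00: "0 \<le> B 0 0"
    using minor[of "[0]"] by simp
  have sorted: "sorted_wrt (<) (0 # map Suc idx)" "sorted_wrt (<) (map Suc idx)" if "sorted_wrt (<) idx" for idx
    using that by (auto simp: sorted_wrt_map)
  show ?case
  proof (cases "B 0 0 = 0")
    case True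
    have z: "B 0 (Suc j) = 0" "B (Suc j) 0 = 0" if "j < n" for j
    proof -
      have "0 \<le> fdet 2 (\<lambda>k l. B ([0, Suc j] ! k) ([0, Suc j] ! l))"
        using minor[of "[0, Suc j]"] that by (simp add: numeral_2_eq_2)
      also have "\<dots> = - (B 0 (Suc j) * B (Suc j) 0)"
        using True by (simp add: fdet_2)
      also have "B (Suc j) 0 = cnj (B 0 (Suc j))"
        using that by (intro herm) auto
      also have "- (B 0 (Suc j) * cnj (B 0 (Suc j))) = - of_real ((cmod (B 0 (Suc j)))\<^sup>2)"
        by (simp only: complex_norm_square)
      finally have "(cmod (B 0 (Suc j)))\<^sup>2 \<le> 0"
        by (simp add: less_eq_complex_def)
      then show "B 0 (Suc j) = 0" by simp
      then show "B (Suc j) 0 = 0"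
        using herm[of "Suc j" 0] that by simp
    qed
    have "qform (Suc n) B v = qform n (\<lambda>i j. B (Suc i) (Suc j)) (\<lambda>i. v (Suc i))"
      unfolding qform_def sum.lessThan_Suc_shift using True z by simp
    also have "0 \<le> \<dots>"
    proof (rule Suc.IH)
      fix idx :: "nat list" assume idx: "sorted_wrt (<) idx" "set idx \<subseteq> {..<n}"
      have "0 \<le> fdet (length (map Suc idx)) (\<lambda>k l. B (map Suc idx ! k) (map Suc idx ! l))"
        using idx sorted by (intro minor) auto
      also have "\<dots> = fdet (length idx) (\<lambda>k l. B (Suc (idx ! k)) (Suc (idx ! l)))"
        unfolding length_map by (rule fdet_cong) simp
      finally show "0 \<le> fdet (length idx) (\<lambda>k l. B (Suc (idx ! k)) (Suc (idx ! l)))" .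
    qed (rule herm, auto)
    finally show ?thesis .
  next
    case False
    define b where "b = Re (B 0 0)"
    have b: "B 0 0 = of_real b" "b > 0"
      using B00 False by (auto simp: less_eq_complex_def b_def complex_eq_iff)
    have S: "0 \<le> qform n (schur B) (\<lambda>i. v (Suc i))"
    proof (rule Suc.IH)
      fix i j assume "i < n" "j < n"
      then have "cnj (B (Suc j) (Suc i)) = B (Suc i) (Suc j)" "cnj (B 0 (Suc i)) = B (Suc i) 0" "cnj (B (Suc j) 0) = B 0 (Suc j)"
        by (intro herm[THEN HOL.sym]; simp)+
      then show "schur B i j = cnj (schur B j i)"
        using b by (simp add: schur_def mult.commute)
    next
      fix idx :: "nat list" assume idx: "sorted_wrt (<) idx" "set idx \<subseteq> {..<n}"
      \<comment> \<open>The principal submatrix of B on the index 0 and the shifted indices; its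
        Schur complement is a principal submatrix of \<open>schur B\<close>.\<close>
      define C where "C = (\<lambda>k l. B ((0 # map Suc idx) ! k) ((0 # map Suc idx) ! l))"
      have "0 \<le> fdet (length (0 # map Suc idx)) C"
        unfolding C_def using idx sorted by (intro minor) auto
      also have "\<dots> = B 0 0 * fdet (length idx) (schur C)"
        using fdet_schur[of C "length idx"] False by (simp add: C_def)
      also have "fdet (length idx) (schur C) = fdet (length idx) (\<lambda>k l. schur B (idx ! k) (idx ! l))"
        by (rule fdet_cong) (simp add: schur_def C_def)
      finally show "0 \<le> fdet (length idx) (\<lambda>k l. schur B (idx ! k) (idx ! l))"
        using b by (simp add: less_eq_complex_def zero_le_mult_iff)
    qed
    define \<beta> where "\<beta> = (\<Sum>j<n. B 0 (Suc j) * v (Suc j))"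
    have \<gamma>: "(\<Sum>i<n. cnj (v (Suc i)) * B (Suc i) 0) = cnj \<beta>"
      unfolding \<beta>_def cnj_sum
    proof (intro sum.cong refl)
      fix i assume "i \<in> {..<n}"
      then have "B (Suc i) 0 = cnj (B 0 (Suc i))"
        by (intro herm) auto
      then show "cnj (v (Suc i)) * B (Suc i) 0 = cnj (B 0 (Suc i) * v (Suc i))"
        by simp
    qed
    have "qform (Suc n) B v = cnj (v 0) * B 0 0 * v 0 + cnj (v 0) * \<beta> + cnj \<beta> * v 0 + cnj \<beta> * \<beta> / B 0 0
        + qform n (schur B) (\<lambda>i. v (Suc i))"
      unfolding qform_Suc_schur[where B = B, OF False] \<gamma> \<beta>_def[symmetric] ..
    also have "cnj (v 0) * B 0 0 * v 0 + cnj (v 0) * \<beta> + cnj \<beta> * v 0 + cnj \<beta> * \<beta> / B 0 0 = (of_real b * v 0 + \<beta>) * cnj (of_real b * v 0 + \<beta>) / of_real b"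
      using b by (simp add: add_divide_distrib distrib_left distrib_right mult_ac)
    also have "\<dots> = of_real ((cmod (of_real b * v 0 + \<beta>))\<^sup>2 / b)"
      by (simp only: complex_norm_square[symmetric] of_real_divide)
    finally show ?thesis
      using S b by (simp add: less_eq_complex_def)
  qed
qed

subsection \<open>Congruence\<close>

definition congr :: "nat \<Rightarrow> (nat \<Rightarrow> nat \<Rightarrow> complex) \<Rightarrow> (nat \<Rightarrow> nat \<Rightarrow> complex) \<Rightarrow> nat \<Rightarrow> nat \<Rightarrow> complex" where
  "congr n P A i j = (\<Sum>k<n. \<Sum>l<n. cnj (P k i) * A k l * P l j)"

lemma qform_congr: "qform n (congr n P A) w = qform n A (\<lambda>k. \<Sum>j<n. P k j * w j)"
proof -
  define I where "I = {..<n} \<times> {..<n}"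
  have "qform n (congr n P A) w = (\<Sum>(i, j)\<in>I. \<Sum>(k, l)\<in>I. cnj (w i) * (cnj (P k i) * A k l * P l j) * w j)"
    by (simp add: qform_def congr_def I_def sum.cartesian_product[symmetric] sum_distrib_left sum_distrib_right)
  also have "\<dots> = (\<Sum>(k, l)\<in>I. \<Sum>(i, j)\<in>I. cnj (w i) * (cnj (P k i) * A k l * P l j) * w j)"
    unfolding case_prod_beta by (rule sum.swap)
  also have "\<dots> = (\<Sum>(k, l)\<in>I. cnj (\<Sum>i<n. P k i * w i) * A k l * (\<Sum>j<n. P l j * w j))"
  proof (intro sum.cong refl, clarify)
    fix k l
    have "cnj (\<Sum>i<n. P k i * w i) * A k l * (\<Sum>j<n. P l j * w j) = (\<Sum>i<n. cnj (P k i * w i) * A k l) * (\<Sum>j<n. P l j * w j)"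
      by (simp add: sum_distrib_right)
    also have "\<dots> = (\<Sum>i<n. \<Sum>j<n. cnj (P k i * w i) * A k l * (P l j * w j))"
      by (rule sum_product)
    finally show "(\<Sum>(i, j)\<in>I. cnj (w i) * (cnj (P k i) * A k l * P l j) * w j) = cnj (\<Sum>i<n. P k i * w i) * A k l * (\<Sum>j<n. P l j * w j)"
      by (simp add: I_def sum.cartesian_product[symmetric] mult_ac)
  qed
  finally show ?thesis
    by (simp add: qform_def I_def sum.cartesian_product[symmetric])
qed

lemma fdet_congr_unitriangular:
  assumes "\<And>i. i < n \<Longrightarrow> P i i = 1" "\<And>i j. i < j \<Longrightarrow> j < n \<Longrightarrow> P i j = 0"
  shows "fdet n (congr n P A) = fdet n A"
proof -
  define M where "M = mat n n (\<lambda>(i, j). A i j)"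
  define R where "R = mat n n (\<lambda>(i, j). P i j)"
  define L where "L = mat n n (\<lambda>(i, j). cnj (P j i))"
  have c: "M \<in> carrier_mat n n" "R \<in> carrier_mat n n" "L \<in> carrier_mat n n"
    by (auto simp: M_def R_def L_def)
  have "Determinant.det R = prod_list (diag_mat R)"
    by (rule det_lower_triangular[OF _ c(2)]) (use assms in \<open>auto simp: R_def\<close>)
  also have "diag_mat R = map (\<lambda>_. 1) [0..<n]"
    unfolding diag_mat_def by (rule map_cong) (use assms in \<open>auto simp: R_def\<close>)
  finally have dR: "Determinant.det R = 1"
    by (simp add: map_replicate_const)
  have "Determinant.det L = prod_list (diag_mat L)"
    by (rule det_upper_triangular[OF _ c(3)]) (use assms in \<open>auto simp: L_def upper_triangular_def\<close>)
  also have "diag_mat L = map (\<lambda>_. 1) [0..<n]"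
    unfolding diag_mat_def by (rule map_cong) (use assms in \<open>auto simp: L_def\<close>)
  finally have dL: "Determinant.det L = 1"
    by (simp add: map_replicate_const)
  have "mat n n (\<lambda>(i, j). congr n P A i j) = L * (M * R)"
  proof (rule eq_matI)
    fix i j assume "i < dim_row (L * (M * R))" "j < dim_col (L * (M * R))"
    then have ij: "i < n" "j < n"
      by (auto simp: L_def R_def)
    have "(L * (M * R)) $$ (i, j) = (\<Sum>k = 0..<n. L $$ (i, k) * (M * R) $$ (k, j))"
      using ij c by (auto simp: scalar_prod_def)
    also have "\<dots> = (\<Sum>k = 0..<n. cnj (P k i) * (\<Sum>l = 0..<n. A k l * P l j))"
      using ij c by (intro sum.cong refl) (auto simp: scalar_prod_def L_def M_def R_def)
    finally show "mat n n (\<lambda>(i, j). congr n P A i j) $$ (i, j) = (L * (M * R)) $$ (i, j)"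
      using ij by (simp add: congr_def sum_distrib_left mult.assoc atLeast0LessThan)
  qed (auto simp: L_def R_def)
  then show ?thesis
    using dL dR det_mult[OF c(3) mult_carrier_mat[OF c(1,2)]] det_mult[OF c(1,2)]
    by (simp add: fdet_def M_def)
qed

subsection \<open>Matrix-valued Herglotz functions\<close>

lemma mat_adjoint_index:
  assumes "A \<in> carrier_mat n m" "i < m" "j < n"
  shows "mat_adjoint A $$ (i, j) = cnj (A $$ (j, i))"
  using assms unfolding mat_adjoint_def by (simp add: mat_of_rows_index conjugate_complex_def)

lemma mat_adjoint_carrier: "A \<in> carrier_mat n m \<Longrightarrow> mat_adjoint A \<in> carrier_mat m n"
  unfolding mat_adjoint_def by (auto simp: mat_of_rows_def)

abbreviation entries :: "complex mat \<Rightarrow> nat \<Rightarrow> nat \<Rightarrow> complex" where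
  "entries M \<equiv> \<lambda>i j. M $$ (i, j)"

lemma psd_iff_qform:
  assumes "M \<in> carrier_mat n n"
  shows "psd n M \<longleftrightarrow> (\<forall>v. 0 \<le> qform n (entries M) v)"
proof -
  have eq: "(M *\<^sub>v w) \<bullet>c w = qform n (entries M) (\<lambda>i. w $ i)" if "w \<in> carrier_vec n" for w
  proof -
    have "(M *\<^sub>v w) \<bullet>c w = (\<Sum>i = 0..<n. (\<Sum>j = 0..<n. M $$ (i, j) * w $ j) * cnj (w $ i))"
      using assms that by (auto simp: scalar_prod_def conjugate_complex_def intro!: sum.cong)
    also have "\<dots> = qform n (entries M) (\<lambda>i. w $ i)"
      by (simp add: qform_def sum_distrib_left atLeast0LessThan mult_ac)
    finally show ?thesis .
  qed
  have "(\<forall>w\<in>carrier_vec n. 0 \<le> qform n (entries M) (\<lambda>i. w $ i)) \<longleftrightarrow> (\<forall>v. 0 \<le> qform n (entries M) v)"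
  proof safe
    fix v :: "nat \<Rightarrow> complex"
    assume "\<forall>w\<in>carrier_vec n. 0 \<le> qform n (entries M) (\<lambda>i. w $ i)"
    then have "0 \<le> qform n (entries M) (\<lambda>i. vec n v $ i)"
      using vec_carrier by blast
    also have "\<dots> = qform n (entries M) v"
      by (rule qform_cong) auto
    finally show "0 \<le> qform n (entries M) v" .
  qed blast
  then show ?thesis
    using assms eq by (simp add: psd_def)
qed

lemma mat_Im_carrier: "M \<in> carrier_mat n n \<Longrightarrow> mat_Im M \<in> carrier_mat n n"
  unfolding mat_Im_def by (intro smult_carrier_mat minus_carrier_mat mat_adjoint_carrier)

lemma mat_Im_index:
  assumes "M \<in> carrier_mat n n" "i < n" "j < n"
  shows "mat_Im M $$ (i, j) = (M $$ (i, j) - cnj (M $$ (j, i))) / (2 * \<i>)"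
  using assms mat_adjoint_carrier[OF assms(1)] by (simp add: mat_Im_def mat_adjoint_index)

lemma qform_mat_Im:
  assumes "M \<in> carrier_mat n n"
  shows "qform n (entries (mat_Im M)) v = of_real (Im (qform n (entries M) v))"
proof -
  have "qform n (entries (mat_Im M)) v = qform n (\<lambda>i j. (M $$ (i, j) - cnj (M $$ (j, i))) / (2 * \<i>)) v"
    by (rule qform_cong) (use assms in \<open>auto simp: mat_Im_index\<close>)
  also have "\<dots> = (qform n (entries M) v - qform n (\<lambda>i j. cnj (M $$ (j, i))) v) / (2 * \<i>)"
  proof -
    have "c * ((a - b) / d) * w = (c * a * w - c * b * w) / d" for a b c d w :: complex
      by (simp add: diff_divide_distrib left_diff_distrib right_diff_distrib)
    then show ?thesis
      unfolding qform_def sum_subtractf[symmetric] sum_divide_distrib by (intro sum.cong refl)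
  qed
  also have "qform n (\<lambda>i j. cnj (M $$ (j, i))) v = cnj (qform n (entries M) v)"
    by (rule qform_cnj[symmetric])
  finally show ?thesis
    by (simp only: complex_diff_cnj) (simp add: field_simps)
qed

lemma psd_mat_Im_iff:
  assumes "M \<in> carrier_mat n n"
  shows "psd n (mat_Im M) \<longleftrightarrow> (\<forall>v. 0 \<le> Im (qform n (entries M) v))"
  using assms by (simp add: psd_iff_qform[OF mat_Im_carrier] qform_mat_Im less_eq_complex_def)

text \<open>The Herglotz property with positivity expressed by scalar forms, for index functions
  instead of matrices, so that Schur complements and principal submatrices fit in directly.\<close>

definition herglotz_family :: "nat \<Rightarrow> (complex \<Rightarrow> nat \<Rightarrow> nat \<Rightarrow> complex) \<Rightarrow> bool" where
  "herglotz_family n A \<longleftrightarrow>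
     (\<forall>i<n. \<forall>j<n. (\<lambda>z. A z i j) holomorphic_on - \<real>) \<and>
     (\<forall>z. z \<notin> \<real> \<longrightarrow> (\<forall>i<n. \<forall>j<n. A (cnj z) i j = cnj (A z j i))) \<and>
     (\<forall>z\<in>UHP. \<forall>v. 0 \<le> Im (qform n (A z) v))"

lemma cnj_in_Reals_iff [simp]: "cnj z \<in> \<real> \<longleftrightarrow> z \<in> \<real>"
  by (simp add: complex_is_Real_iff)

lemma herglotz_iff:
  fixes Q :: "complex \<Rightarrow> complex mat"
  assumes "\<And>z. Q z \<in> carrier_mat n n"
  shows "herglotz n Q \<longleftrightarrow> herglotz_family n (\<lambda>z. entries (Q z))"
proof -
  have "sharp_real_on (- \<real>) Q \<longleftrightarrow> (\<forall>z. z \<notin> \<real> \<longrightarrow> (\<forall>i<n. \<forall>j<n. Q (cnj z) $$ (i, j) = cnj (Q z $$ (j, i))))"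
  proof
    assume s: "sharp_real_on (- \<real>) Q"
    show "\<forall>z. z \<notin> \<real> \<longrightarrow> (\<forall>i<n. \<forall>j<n. Q (cnj z) $$ (i, j) = cnj (Q z $$ (j, i)))"
    proof (intro allI impI)
      fix z :: complex and i j assume "z \<notin> \<real>" "i < n" "j < n"
      then have "cnj z \<in> - \<real>"
        by simp
      then have "Q (cnj z) = mat_adjoint (Q (cnj (cnj z)))"
        using s unfolding sharp_real_on_def sharp_def by blast
      then show "Q (cnj z) $$ (i, j) = cnj (Q z $$ (j, i))"
        using mat_adjoint_index[OF assms \<open>i < n\<close> \<open>j < n\<close>] by simp
    qed
  next
    assume s: "\<forall>z. z \<notin> \<real> \<longrightarrow> (\<forall>i<n. \<forall>j<n. Q (cnj z) $$ (i, j) = cnj (Q z $$ (j, i)))"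
    show "sharp_real_on (- \<real>) Q"
      unfolding sharp_real_on_def sharp_def
    proof (intro conjI ballI)
      fix z :: complex assume "z \<in> - \<real>"
      then have z: "cnj z \<notin> \<real>"
        by simp
      show "Q z = mat_adjoint (Q (cnj z))"
      proof (rule eq_matI)
        fix i j assume "i < dim_row (mat_adjoint (Q (cnj z)))" "j < dim_col (mat_adjoint (Q (cnj z)))"
        then have ij: "i < n" "j < n"
          using mat_adjoint_carrier[OF assms, of "cnj z"] by auto
        have "Q (cnj (cnj z)) $$ (i, j) = cnj (Q (cnj z) $$ (j, i))"
          using s z ij by blast
        then show "Q z $$ (i, j) = mat_adjoint (Q (cnj z)) $$ (i, j)"
          using mat_adjoint_index[OF assms ij] by simp
      qed (use assms[of z] mat_adjoint_carrier[OF assms, of "cnj z"] in auto)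
    qed auto
  qed
  then show ?thesis
    using assms by (simp add: herglotz_def herglotz_family_def psd_mat_Im_iff)
qed

lemma qform_1 [simp]: "qform (Suc 0) A v = of_real ((cmod (v 0))\<^sup>2) * A 0 0"
  by (simp add: qform_def complex_norm_square mult_ac del: of_real_power)

lemma scalar_meromorphic_herglotz_iff:
  "scalar_meromorphic_herglotz g \<longleftrightarrow> g nicely_meromorphic_on UNIV \<and> g holomorphic_on - \<real> \<and>
     (\<forall>z. z \<notin> \<real> \<longrightarrow> g (cnj z) = cnj (g z)) \<and> (\<forall>z\<in>UHP. 0 \<le> Im (g z))"
proof -
  have "(\<forall>v::nat \<Rightarrow> complex. 0 \<le> (cmod (v 0))\<^sup>2 * Im (g z)) \<longleftrightarrow> 0 \<le> Im (g z)" for z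
  proof
    assume "\<forall>v::nat \<Rightarrow> complex. 0 \<le> (cmod (v 0))\<^sup>2 * Im (g z)"
    from spec[OF this, of "\<lambda>_. 1"] show "0 \<le> Im (g z)"
      by simp
  qed auto
  then show ?thesis
    unfolding scalar_meromorphic_herglotz_def
    by (subst herglotz_iff) (auto simp: herglotz_family_def)
qed

lemma qform_holomorphic:
  assumes "\<And>i j. i < n \<Longrightarrow> j < n \<Longrightarrow> (\<lambda>z. A z i j) holomorphic_on S"
  shows "(\<lambda>z. qform n (A z) v) holomorphic_on S"
  unfolding qform_def using assms by (intro holomorphic_on_sum holomorphic_on_mult holomorphic_on_const) auto

lemma qform_meromorphic:
  assumes "\<And>i j. i < n \<Longrightarrow> j < n \<Longrightarrow> (\<lambda>z. A z i j) meromorphic_on S"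
  shows "(\<lambda>z. qform n (A z) v) meromorphic_on S"
  unfolding qform_def using assms by (intro meromorphic_on_sum meromorphic_on_mult meromorphic_on_const) auto

lemma qform_symmetric:
  assumes "\<And>i j. i < n \<Longrightarrow> j < n \<Longrightarrow> A (cnj z) i j = cnj (A z j i)"
  shows "qform n (A (cnj z)) v = cnj (qform n (A z) v)"
  unfolding qform_cnj by (rule qform_cong) (use assms in auto)

lemma nonreal_cases:
  assumes "z \<notin> \<real>" obtains "z \<in> UHP" | "cnj z \<in> UHP"
  using assms by (cases "Im z" "0::real" rule: linorder_cases) (auto simp: complex_is_Real_iff)

lemma herglotz_zero_free:
  assumes hol: "g holomorphic_on - \<real>" and sym: "\<And>z. z \<notin> \<real> \<Longrightarrow> g (cnj z) = cnj (g z)"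
    and Im: "\<And>z. z \<in> UHP \<Longrightarrow> 0 \<le> Im (g z)" and z0: "z0 \<in> UHP" "g z0 \<noteq> 0" and "z \<notin> \<real>"
  shows "g z \<noteq> 0"
proof -
  have *: "g z \<noteq> 0" if "z \<in> UHP" for z
  proof
    assume "g z = 0"
    have "g constant_on UHP"
      by (rule open_map_Im_strict[where c = 0 and z = z])
        (use hol Im that \<open>g z = 0\<close> UHP_nonreal in \<open>auto intro: holomorphic_on_subset simp del: UHP_iff\<close>)
    then have "g z0 = g z"
      using that z0 by (auto simp: constant_on_def)
    then show False
      using \<open>g z = 0\<close> z0 by simp
  qed
  show ?thesis
    using \<open>z \<notin> \<real>\<close>
  proof (cases rule: nonreal_cases)
    case 2
    then have "g (cnj z) \<noteq> 0"
      by (rule *)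
    then show ?thesis
      using sym[OF \<open>z \<notin> \<real>\<close>] by simp
  qed (rule *)
qed

text \<open>Splitting off a nonzero value of the form as a pivot, the Schur complement is again Herglotz, because
  its form is the restriction of the original one to a subspace.\<close>

theorem herglotz_family_det:
  assumes "herglotz_family n A" "\<And>i j. i < n \<Longrightarrow> j < n \<Longrightarrow> (\<lambda>z. A z i j) meromorphic_on UNIV"
  shows "\<exists>g. (\<forall>j<n. scalar_meromorphic_herglotz (g j)) \<and> (\<forall>z. z \<notin> \<real> \<longrightarrow> fdet n (A z) = (\<Prod>j<n. g j z))"
  using assms
proof (induction n arbitrary: A)
  case 0
  then show ?case by simp
next
  case (Suc n)
  have hol: "(\<lambda>z. A z i j) holomorphic_on - \<real>" if "i < Suc n" "j < Suc n" for i j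
    using Suc.prems(1) that by (auto simp: herglotz_family_def)
  have sym: "A (cnj z) i j = cnj (A z j i)" if "z \<notin> \<real>" "i < Suc n" "j < Suc n" for z i j
    using Suc.prems(1) that by (auto simp: herglotz_family_def)
  have pos: "0 \<le> Im (qform (Suc n) (A z) v)" if "z \<in> UHP" for z v
    using Suc.prems(1) that by (auto simp: herglotz_family_def)
  note mer = Suc.prems(2)
  show ?case
  proof (cases "\<exists>v. \<exists>z\<in>UHP. qform (Suc n) (A z) v \<noteq> 0")
    case False
    have z: "A z i j = 0" if z: "z \<notin> \<real>" and ij: "i < Suc n" "j < Suc n" for z i j
      using z
    proof (cases rule: nonreal_cases)
      case 1
      then show ?thesis
        using False ij by (intro qform_eq_0_imp[of "Suc n" "A z"]) auto
    next
      case 2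
      then have "A (cnj z) j i = 0"
        using False ij by (intro qform_eq_0_imp[of "Suc n" "A (cnj z)"]) auto
      then show ?thesis
        using sym[OF z ij(2,1)] by simp
    qed
    have "fdet (Suc n) (A z) = (\<Prod>j<Suc n. 0)" if "z \<notin> \<real>" for z
    proof -
      have "fdet (Suc n) (A z) = fdet (Suc n) (\<lambda>i j. 0)"
        by (rule fdet_cong) (use z that in auto)
      then show ?thesis
        by (simp add: fdet_leibniz)
    qed
    then show ?thesis
      by (intro exI[of _ "\<lambda>_ _. 0"]) (auto simp: scalar_meromorphic_herglotz_iff)
  next
    case True
    then obtain v1 z0 where v1: "z0 \<in> UHP" "qform (Suc n) (A z0) v1 \<noteq> 0"
      by blast
    \<comment> \<open>The pivot vector has to be scaled to first coordinate 1, but that coordinate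
      of v1 may vanish. A small multiple of the first unit vector is added; by continuity the form
      at z0 stays nonzero.\<close>
    define q0 where "q0 = (\<lambda>t::real. qform (Suc n) (A z0) (\<lambda>i. v1 i + (if i = 0 then of_real t else 0)))"
    have "isCont (\<lambda>t::real. if i = 0 then of_real t else 0 :: complex) 0" for i :: nat
      by (cases "i = 0") (auto intro!: continuous_intros)
    then have "isCont q0 0"
      unfolding q0_def qform_def by (intro continuous_intros)
    then have "(q0 \<longlongrightarrow> q0 0) (at_right 0)"
      by (simp add: isCont_def filterlim_at_split)
    moreover have "q0 0 = qform (Suc n) (A z0) v1"
      unfolding q0_def by (rule qform_cong) auto
    ultimately have "\<forall>\<^sub>F t in at_right 0. q0 t \<noteq> 0"
      using v1 tendsto_imp_eventually_ne by metis
    moreover have "\<forall>\<^sub>F t in at_right (0::real). v1 0 + of_real t \<noteq> 0"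
    proof (cases "v1 0 = 0")
      case True
      then show ?thesis
        by (auto simp: eventually_at_right_field intro!: exI[of _ 1])
    next
      case False
      have "((\<lambda>t::real. v1 0 + of_real t) \<longlongrightarrow> v1 0 + of_real 0) (at_right 0)"
        by (intro tendsto_intros)
      then show ?thesis
        using False tendsto_imp_eventually_ne by fastforce
    qed
    ultimately have "\<forall>\<^sub>F t in at_right 0. q0 t \<noteq> 0 \<and> v1 0 + of_real t \<noteq> 0"
      by (rule eventually_conj)
    then obtain t where t: "q0 t \<noteq> 0" "v1 0 + of_real t \<noteq> 0"
      using eventually_happens trivial_limit_at_right_real by blast
    define v where "v = (\<lambda>i. inverse (v1 0 + of_real t) * (v1 i + (if i = 0 then of_real t else 0)))"
    have v0: "v 0 = 1"
      using t(2) by (simp add: v_def)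
    have vq: "qform (Suc n) (A z0) v \<noteq> 0"
      using t unfolding v_def qform_scale by (simp add: q0_def)
    \<comment> \<open>The identity with its first column replaced by v. It is unit lower triangular
      since v 0 = 1, so the congruence preserves the determinant and moves the value of the form at
      v to the corner entry.\<close>
    define P where "P = (\<lambda>k j. if j = 0 then v k else if k = j then 1 else 0 :: complex)"
    define B where "B = (\<lambda>z. congr (Suc n) P (A z))"
    define q where "q = (\<lambda>z. qform (Suc n) (A z) v)"
    have B00: "B z 0 0 = q z" for z
      by (simp add: B_def congr_def P_def q_def qform_def)
    have detB: "fdet (Suc n) (B z) = fdet (Suc n) (A z)" for z
      unfolding B_def by (rule fdet_congr_unitriangular) (auto simp: P_def v0)
    have holB: "(\<lambda>z. B z i j) holomorphic_on - \<real>" if "i < Suc n" "j < Suc n" for i j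
      unfolding B_def congr_def using hol
      by (intro holomorphic_on_sum holomorphic_on_mult holomorphic_on_const) auto
    have merB: "(\<lambda>z. B z i j) meromorphic_on UNIV" if "i < Suc n" "j < Suc n" for i j
      unfolding B_def congr_def using mer
      by (intro meromorphic_on_sum meromorphic_on_mult meromorphic_on_const) auto
    have symB: "B (cnj z) i j = cnj (B z j i)" if z: "z \<notin> \<real>" for z i j
    proof -
      have "B (cnj z) i j = (\<Sum>k<Suc n. \<Sum>l<Suc n. cnj (P k i) * cnj (A z l k) * P l j)"
        unfolding B_def congr_def using sym[OF z] by (intro sum.cong refl) auto
      also have "\<dots> = (\<Sum>l<Suc n. \<Sum>k<Suc n. cnj (P k i) * cnj (A z l k) * P l j)"
        by (rule sum.swap)
      also have "\<dots> = cnj (B z j i)"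
        unfolding B_def congr_def cnj_sum complex_cnj_mult complex_cnj_cnj
        by (intro sum.cong refl) (simp only: mult_ac)
      finally show ?thesis .
    qed
    have posB: "0 \<le> Im (qform (Suc n) (B z) w)" if "z \<in> UHP" for z w
      unfolding B_def qform_congr by (rule pos[OF that])
    have holq: "q holomorphic_on - \<real>"
      unfolding q_def by (rule qform_holomorphic) (rule hol)
    have merq: "q meromorphic_on UNIV"
      unfolding q_def by (rule qform_meromorphic) (rule mer)
    have symq: "q (cnj z) = cnj (q z)" if "z \<notin> \<real>" for z
      unfolding q_def by (rule qform_symmetric) (rule sym[OF that])
    have posq: "0 \<le> Im (q z)" if "z \<in> UHP" for z
      unfolding q_def by (rule pos[OF that])
    have nzq: "q z \<noteq> 0" if "z \<notin> \<real>" for z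
      by (rule herglotz_zero_free[OF holq symq posq v1(1) _ that]) (use vq in \<open>auto simp: q_def\<close>)
    define S where "S = (\<lambda>z. schur (B z))"
    have "herglotz_family n S"
      unfolding herglotz_family_def
    proof (intro conjI allI impI ballI)
      fix i j assume ij: "i < n" "j < n"
      show "(\<lambda>z. S z i j) holomorphic_on - \<real>"
        unfolding S_def schur_def B00 using ij nzq
        by (intro holomorphic_on_diff holomorphic_on_divide holomorphic_on_mult holB holq) auto
    next
      fix z :: complex and i j assume z: "z \<notin> \<real>"
      show "S (cnj z) i j = cnj (S z j i)"
        unfolding S_def schur_def B00 symB[OF z] symq[OF z] by (simp add: mult.commute)
    next
      fix z v assume z: "z \<in> UHP"
      have "B z 0 0 \<noteq> 0"
        using nzq[OF UHP_nonreal[OF z]] by (simp add: B00)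
      then obtain c where "qform n (S z) v = qform (Suc n) (B z) (\<lambda>i. case i of 0 \<Rightarrow> c | Suc k \<Rightarrow> v k)"
        unfolding S_def by (rule qform_schur)
      then show "0 \<le> Im (qform n (S z) v)"
        using posB[OF z] by simp
    qed
    moreover have "(\<lambda>z. S z i j) meromorphic_on UNIV" if "i < n" "j < n" for i j
      unfolding S_def schur_def B00 using that
      by (intro meromorphic_on_diff meromorphic_on_divide meromorphic_on_mult merB merq) auto
    ultimately obtain g where g: "\<And>j. j < n \<Longrightarrow> scalar_meromorphic_herglotz (g j)"
      "\<And>z. z \<notin> \<real> \<Longrightarrow> fdet n (S z) = (\<Prod>j<n. g j z)"
      using Suc.IH[of S] by blast
    define g0 where "g0 = remove_sings q"
    have g0: "g0 z = q z" if "z \<notin> \<real>" for z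
      unfolding g0_def
    proof (rule remove_sings_at_analytic)
      show "q analytic_on {z}"
        by (rule analytic_at_nonreal[OF holq that])
    qed
    have "scalar_meromorphic_herglotz g0"
      unfolding scalar_meromorphic_herglotz_iff
    proof (intro conjI allI impI ballI)
      show "g0 nicely_meromorphic_on UNIV"
        unfolding g0_def using merq by (rule remove_sings_nicely_meromorphic)
      show "g0 holomorphic_on - \<real>"
        using holq by (rule holomorphic_transform) (simp add: g0)
    qed (simp_all add: g0 symq posq UHP_nonreal del: UHP_iff)
    moreover have "fdet (Suc n) (A z) = g0 z * (\<Prod>j<n. g j z)" if "z \<notin> \<real>" for z
      using fdet_schur[of "B z" n] nzq[OF that] g(2)[OF that] g0[OF that] by (simp add: detB B00 S_def)
    ultimately show ?thesis
      using g(1)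
      by (intro exI[of _ "\<lambda>j. case j of 0 \<Rightarrow> g0 | Suc k \<Rightarrow> g k"])
        (auto simp: less_Suc_eq_0_disj prod.lessThan_Suc_shift simp del: prod.lessThan_Suc)
  qed
qed

section \<open>Growth of the entries\<close>

lemma pick_const_or_strict:
  assumes "pick g"
  shows "g constant_on UHP \<or> (\<forall>z\<in>UHP. 0 < Im (g z))"
proof (rule disjCI)
  assume "\<not> (\<forall>z\<in>UHP. 0 < Im (g z))"
  then obtain z where z: "z \<in> UHP" "Im (g z) = 0"
    using assms unfolding pick_def by (meson antisym not_le)
  show "g constant_on UHP"
    by (rule open_map_Im_strict[of g 0 z]) (use assms z in \<open>auto simp: pick_def\<close>)
qed

lemma pick_zero_or_zero_free:
  assumes "pick g"
  shows "(\<forall>z\<in>UHP. g z = 0) \<or> (\<forall>z\<in>UHP. g z \<noteq> 0)"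
  using pick_const_or_strict[OF assms]
proof
  assume "g constant_on UHP"
  then show ?thesis
    by (auto simp: constant_on_def simp del: UHP_iff)
next
  assume "\<forall>z\<in>UHP. 0 < Im (g z)"
  then show ?thesis
    by (metis less_irrefl zero_complex.sel(2))
qed

text \<open>A nonconstant Pick function avoids the cut of \<open>Ln\<close>; a constant one may be a
  negative number, and is therefore treated separately.\<close>

lemma pick_log:
  assumes "pick g" "\<And>z. z \<in> UHP \<Longrightarrow> g z \<noteq> 0"
  obtains u where "u holomorphic_on UHP" "\<And>z. z \<in> UHP \<Longrightarrow> exp (u z) = g z"
    "\<And>z. z \<in> UHP \<Longrightarrow> 0 \<le> Im (u z) \<and> Im (u z) \<le> pi"
proof (rule that[of "\<lambda>z. Ln (g z)"])
  have hol: "g holomorphic_on UHP" and nn: "\<And>z. z \<in> UHP \<Longrightarrow> 0 \<le> Im (g z)"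
    using assms(1) by (auto simp: pick_def)
  show "(\<lambda>z. Ln (g z)) holomorphic_on UHP"
    using pick_const_or_strict[OF assms(1)]
  proof
    assume "g constant_on UHP"
    then obtain c where "\<And>z. z \<in> UHP \<Longrightarrow> g z = c"
      unfolding constant_on_def by blast
    then show ?thesis
      by (intro holomorphic_transform[OF holomorphic_on_const[of "Ln c"]]) auto
  next
    assume "\<forall>z\<in>UHP. 0 < Im (g z)"
    then show ?thesis
      by (intro holomorphic_on_Ln' hol) (force simp: complex_nonpos_Reals_iff)
  qed
  show "exp (Ln (g z)) = g z" "0 \<le> Im (Ln (g z)) \<and> Im (Ln (g z)) \<le> pi" if "z \<in> UHP" for z
    using assms(2)[OF that] nn[OF that] Im_Ln_pos_le by auto
qed

text \<open>Dividing the argument by k confines the root to a sector. For k = 2 this is the closed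
  first quadrant; for k = 4 the product of two roots still lies in that quadrant.\<close>

lemma pick_kth_root:
  assumes "pick g" "k \<ge> 1"
  obtains \<rho> where "\<rho> holomorphic_on UHP" "\<And>z. z \<in> UHP \<Longrightarrow> \<rho> z ^ k = g z"
    "\<And>z. z \<in> UHP \<Longrightarrow> \<exists>r t. 0 \<le> r \<and> 0 \<le> t \<and> t \<le> pi / real k \<and> \<rho> z = of_real r * cis t"
  using pick_zero_or_zero_free[OF assms(1)]
proof
  assume z: "\<forall>z\<in>UHP. g z = 0"
  have "\<exists>r t. 0 \<le> r \<and> 0 \<le> t \<and> t \<le> pi / real k \<and> 0 = of_real r * cis t"
    by (intro exI[of _ 0]) auto
  then show thesis
    using z assms(2) by (intro that[of "\<lambda>_. 0"]) auto
next
  assume "\<forall>z\<in>UHP. g z \<noteq> 0"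
  then obtain u where u: "u holomorphic_on UHP" "\<And>z. z \<in> UHP \<Longrightarrow> exp (u z) = g z"
    "\<And>z. z \<in> UHP \<Longrightarrow> 0 \<le> Im (u z) \<and> Im (u z) \<le> pi"
    using pick_log[OF assms(1)] by blast
  show thesis
  proof (rule that[of "\<lambda>z. exp (u z / of_nat k)"])
    show "(\<lambda>z. exp (u z / of_nat k)) holomorphic_on UHP"
      using assms(2) by (intro holomorphic_intros u) auto
    show "exp (u z / of_nat k) ^ k = g z" if "z \<in> UHP" for z
      using assms(2) u(2)[OF that] by (simp flip: exp_of_nat_mult)
    fix z assume z: "z \<in> UHP"
    show "\<exists>r t. 0 \<le> r \<and> 0 \<le> t \<and> t \<le> pi / real k \<and> exp (u z / of_nat k) = of_real r * cis t"
    proof (intro exI conjI)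
      show "exp (u z / of_nat k) = of_real (exp (Re (u z / of_nat k))) * cis (Im (u z / of_nat k))"
        by (simp add: exp_eq_polar exp_of_real)
      show "0 \<le> Im (u z / of_nat k)" "Im (u z / of_nat k) \<le> pi / real k"
        using u(3)[OF z] by (auto simp: Im_divide_of_nat divide_right_mono)
    qed auto
  qed
qed

lemma cis_first_quadrant:
  assumes "0 \<le> r" "0 \<le> t" "t \<le> pi / 2"
  shows "0 \<le> Re (of_real r * cis t)" "0 \<le> Im (of_real r * cis t)"
  using assms cos_ge_zero[of t] sin_ge_zero[of t] by auto

lemma cmod_le_first_quadrant:
  assumes "0 \<le> Re a" "0 \<le> Im a" "0 \<le> Re b" "0 \<le> Im b"
  shows "cmod a \<le> cmod (a + b)" "cmod b \<le> cmod (a + b)"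
proof -
  have "(Re a)\<^sup>2 + (Im a)\<^sup>2 \<le> (Re (a + b))\<^sup>2 + (Im (a + b))\<^sup>2"
    using assms by (intro add_mono power_mono) auto
  then show "cmod a \<le> cmod (a + b)"
    by (simp add: cmod_def)
  have "(Re b)\<^sup>2 + (Im b)\<^sup>2 \<le> (Re (a + b))\<^sup>2 + (Im (a + b))\<^sup>2"
    using assms by (intro add_mono power_mono) auto
  then show "cmod b \<le> cmod (a + b)"
    by (simp add: cmod_def)
qed

lemma bounded_on_imaginary_axis:
  assumes hol: "\<Phi> holomorphic_on UHP"
    and 0: "\<forall>\<^sub>F z in at 0 within UHP. cmod (\<Phi> z) < M"
    and top: "\<forall>\<^sub>F \<eta> in at_top. cmod (\<Phi> (\<i> * of_real \<eta>)) \<le> M"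
  obtains B where "B \<ge> 1" "\<And>\<eta>. \<eta> > 0 \<Longrightarrow> cmod (\<Phi> (\<i> * of_real \<eta>)) \<le> B"
proof -
  obtain d where d: "d > 0" "\<And>z. z \<in> UHP \<Longrightarrow> z \<noteq> 0 \<Longrightarrow> dist z 0 < d \<Longrightarrow> cmod (\<Phi> z) < M"
    using 0 unfolding eventually_at by blast
  obtain N where N: "\<And>\<eta>. \<eta> \<ge> N \<Longrightarrow> cmod (\<Phi> (\<i> * of_real \<eta>)) \<le> M"
    using top unfolding eventually_at_top_linorder by blast
  have "continuous_on {d/2..N} (\<lambda>\<eta>::real. \<Phi> (\<i> * of_real \<eta>))"
    using d by (intro continuous_on_compose2[OF holomorphic_on_imp_continuous_on[OF hol]] continuous_intros) auto
  then have "compact ((\<lambda>\<eta>::real. \<Phi> (\<i> * of_real \<eta>)) ` {d/2..N})"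
    by (rule compact_continuous_image) simp
  then have "bounded ((\<lambda>\<eta>::real. \<Phi> (\<i> * of_real \<eta>)) ` {d/2..N})"
    by (rule compact_imp_bounded)
  then obtain K where K: "\<And>\<eta>. \<eta> \<in> {d/2..N} \<Longrightarrow> cmod (\<Phi> (\<i> * of_real \<eta>)) \<le> K"
    unfolding bounded_iff by blast
  show thesis
  proof (rule that[of "max 1 (max M K)"])
    fix \<eta> :: real assume \<eta>: "\<eta> > 0"
    consider "\<eta> < d" | "\<eta> \<ge> N" | "\<eta> \<in> {d/2..N}"
      using d by force
    then show "cmod (\<Phi> (\<i> * of_real \<eta>)) \<le> max 1 (max M K)"
    proof cases
      case 1
      then have "cmod (\<Phi> (\<i> * of_real \<eta>)) < M"
        using \<eta> by (intro d(2)) (auto simp: norm_mult)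
      then show ?thesis
        by linarith
    next
      case 2
      then show ?thesis
        using N[of \<eta>] by linarith
    next
      case 3
      then show ?thesis
        using K[of \<eta>] by linarith
    qed
  qed auto
qed

text \<open>The function \<open>\<Psi>\<close> dominates \<open>a\<close> on the real axis. It is the square of a sum of functions with values in
  the closed first quadrant, so that no cancellation occurs in the sum.\<close>

lemma offdiagonal_bound:
  assumes hola: "a holomorphic_on UHP" and bq: "bounded_quotient a"
    and pick: "pick \<phi>\<^sub>1" "pick \<phi>\<^sub>2" "pick \<phi>\<^sub>3"
    and ab: "\<And>z. z \<in> UHP \<Longrightarrow> cmod (a z) * cmod (b z) \<le> cmod (\<phi>\<^sub>1 z) * cmod (\<phi>\<^sub>2 z) + (cmod (\<phi>\<^sub>3 z))\<^sup>2"
    and bd: "\<And>x. \<forall>\<^sub>F z in at (of_real x) within UHP. cmod (a z) \<le> 2 * cmod (b z)"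
    and gr: "\<forall>\<^sub>F \<eta> in at_top. cmod (a (\<i> * of_real \<eta>)) \<le> C0 * \<eta>"
  obtains C where "C \<ge> 0" "\<And>z. z \<in> UHP \<Longrightarrow> cmod (a z) \<le> C * (cmod (z + \<i>))\<^sup>2 / Im z"
proof -
  have "pick (\<lambda>z. z)"
    by (auto simp: pick_def intro!: holomorphic_intros)
  obtain \<rho>\<^sub>1 where r1: "\<rho>\<^sub>1 holomorphic_on UHP" "\<And>z. z \<in> UHP \<Longrightarrow> \<rho>\<^sub>1 z ^ 4 = \<phi>\<^sub>1 z"
    "\<And>z. z \<in> UHP \<Longrightarrow> \<exists>r t. 0 \<le> r \<and> 0 \<le> t \<and> t \<le> pi / real 4 \<and> \<rho>\<^sub>1 z = of_real r * cis t"
    by (rule pick_kth_root[OF pick(1), of 4]) auto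
  obtain \<rho>\<^sub>2 where r2: "\<rho>\<^sub>2 holomorphic_on UHP" "\<And>z. z \<in> UHP \<Longrightarrow> \<rho>\<^sub>2 z ^ 4 = \<phi>\<^sub>2 z"
    "\<And>z. z \<in> UHP \<Longrightarrow> \<exists>r t. 0 \<le> r \<and> 0 \<le> t \<and> t \<le> pi / real 4 \<and> \<rho>\<^sub>2 z = of_real r * cis t"
    by (rule pick_kth_root[OF pick(2), of 4]) auto
  obtain \<rho>\<^sub>3 where r3: "\<rho>\<^sub>3 holomorphic_on UHP" "\<And>z. z \<in> UHP \<Longrightarrow> \<rho>\<^sub>3 z ^ 2 = \<phi>\<^sub>3 z"
    "\<And>z. z \<in> UHP \<Longrightarrow> \<exists>r t. 0 \<le> r \<and> 0 \<le> t \<and> t \<le> pi / real 2 \<and> \<rho>\<^sub>3 z = of_real r * cis t"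
    by (rule pick_kth_root[OF pick(3), of 2]) auto
  obtain \<rho>\<^sub>4 where r4: "\<rho>\<^sub>4 holomorphic_on UHP" "\<And>z. z \<in> UHP \<Longrightarrow> \<rho>\<^sub>4 z ^ 2 = z"
    "\<And>z. z \<in> UHP \<Longrightarrow> \<exists>r t. 0 \<le> r \<and> 0 \<le> t \<and> t \<le> pi / real 2 \<and> \<rho>\<^sub>4 z = of_real r * cis t"
    by (rule pick_kth_root[OF \<open>pick (\<lambda>z. z)\<close>, of 2]) auto
  define \<Psi>\<^sub>0 where "\<Psi>\<^sub>0 = (\<lambda>z. \<rho>\<^sub>1 z * \<rho>\<^sub>2 z + (\<rho>\<^sub>3 z + (\<rho>\<^sub>4 z + 1)))"
  \<comment> \<open>The product \<open>\<rho>\<^sub>1 z * \<rho>\<^sub>2 z\<close> is a fourth root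
    of \<open>\<phi>\<^sub>1 z * \<phi>\<^sub>2 z\<close> in the first quadrant. The summand
    \<open>\<rho>\<^sub>4 z\<close>, a square root of z, makes the square at least
    \<open>cmod z\<close>, to absorb the linear growth on the imaginary axis; the summand 1 excludes
    zeros.\<close>
  define \<Psi> where "\<Psi> = (\<lambda>z. (\<Psi>\<^sub>0 z)\<^sup>2)"
  have low: "cmod (\<rho>\<^sub>1 z * \<rho>\<^sub>2 z) \<le> cmod (\<Psi>\<^sub>0 z)" "cmod (\<rho>\<^sub>3 z) \<le> cmod (\<Psi>\<^sub>0 z)"
    "cmod (\<rho>\<^sub>4 z) \<le> cmod (\<Psi>\<^sub>0 z)" "1 \<le> cmod (\<Psi>\<^sub>0 z)" if z: "z \<in> UHP" for z
  proof -
    obtain s1 t1 where 1: "0 \<le> s1" "0 \<le> t1" "t1 \<le> pi / 4" "\<rho>\<^sub>1 z = of_real s1 * cis t1"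
      using r1(3)[OF z] by auto
    obtain s2 t2 where 2: "0 \<le> s2" "0 \<le> t2" "t2 \<le> pi / 4" "\<rho>\<^sub>2 z = of_real s2 * cis t2"
      using r2(3)[OF z] by auto
    obtain s3 t3 where 3: "0 \<le> s3" "0 \<le> t3" "t3 \<le> pi / 2" "\<rho>\<^sub>3 z = of_real s3 * cis t3"
      using r3(3)[OF z] by auto
    obtain s4 t4 where 4: "0 \<le> s4" "0 \<le> t4" "t4 \<le> pi / 2" "\<rho>\<^sub>4 z = of_real s4 * cis t4"
      using r4(3)[OF z] by auto
    have 12: "\<rho>\<^sub>1 z * \<rho>\<^sub>2 z = of_real (s1 * s2) * cis (t1 + t2)"
      by (simp add: 1 2 cis_mult)
    have q12: "0 \<le> Re (\<rho>\<^sub>1 z * \<rho>\<^sub>2 z)" "0 \<le> Im (\<rho>\<^sub>1 z * \<rho>\<^sub>2 z)"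
      unfolding 12 using 1 2 by (intro cis_first_quadrant; simp)+
    have q3: "0 \<le> Re (\<rho>\<^sub>3 z)" "0 \<le> Im (\<rho>\<^sub>3 z)"
      unfolding 3(4) using 3 by (intro cis_first_quadrant; simp)+
    have q4: "0 \<le> Re (\<rho>\<^sub>4 z)" "0 \<le> Im (\<rho>\<^sub>4 z)"
      unfolding 4(4) using 4 by (intro cis_first_quadrant; simp)+
    have a: "cmod (\<rho>\<^sub>4 z) \<le> cmod (\<rho>\<^sub>4 z + 1)" "1 \<le> cmod (\<rho>\<^sub>4 z + 1)"
      using cmod_le_first_quadrant[of "\<rho>\<^sub>4 z" 1] q4 by auto
    have b: "cmod (\<rho>\<^sub>3 z) \<le> cmod (\<rho>\<^sub>3 z + (\<rho>\<^sub>4 z + 1))" "cmod (\<rho>\<^sub>4 z + 1) \<le> cmod (\<rho>\<^sub>3 z + (\<rho>\<^sub>4 z + 1))"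
      using cmod_le_first_quadrant[of "\<rho>\<^sub>3 z" "\<rho>\<^sub>4 z + 1"] q3 q4 by auto
    have c: "cmod (\<rho>\<^sub>1 z * \<rho>\<^sub>2 z) \<le> cmod (\<Psi>\<^sub>0 z)" "cmod (\<rho>\<^sub>3 z + (\<rho>\<^sub>4 z + 1)) \<le> cmod (\<Psi>\<^sub>0 z)"
      unfolding \<Psi>\<^sub>0_def by (rule cmod_le_first_quadrant; use q12 q3 q4 in simp)+
    show "cmod (\<rho>\<^sub>1 z * \<rho>\<^sub>2 z) \<le> cmod (\<Psi>\<^sub>0 z)" "cmod (\<rho>\<^sub>3 z) \<le> cmod (\<Psi>\<^sub>0 z)"
      "cmod (\<rho>\<^sub>4 z) \<le> cmod (\<Psi>\<^sub>0 z)" "1 \<le> cmod (\<Psi>\<^sub>0 z)"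
      using a b c by linarith+
  qed
  have \<Psi>1: "1 \<le> cmod (\<Psi> z)" and \<Psi>z: "cmod z \<le> cmod (\<Psi> z)"
    and \<Psi>ab: "cmod (a z) * cmod (b z) \<le> 2 * (cmod (\<Psi> z))\<^sup>2" if z: "z \<in> UHP" for z
  proof -
    have "1 ^ 2 \<le> cmod (\<Psi>\<^sub>0 z) ^ 2"
      using low(4)[OF z] by (intro power_mono) auto
    then show "1 \<le> cmod (\<Psi> z)"
      by (simp add: \<Psi>_def norm_power)
    have "cmod (\<rho>\<^sub>4 z) ^ 2 \<le> cmod (\<Psi>\<^sub>0 z) ^ 2"
      using low(3)[OF z] by (intro power_mono) auto
    then show "cmod z \<le> cmod (\<Psi> z)"
      using r4(2)[OF z] unfolding \<Psi>_def norm_power[symmetric] by simp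
    have "cmod (\<rho>\<^sub>1 z * \<rho>\<^sub>2 z) ^ 4 \<le> cmod (\<Psi>\<^sub>0 z) ^ 4"
      using low(1)[OF z] by (intro power_mono) auto
    moreover have "(\<rho>\<^sub>1 z * \<rho>\<^sub>2 z) ^ 4 = \<phi>\<^sub>1 z * \<phi>\<^sub>2 z"
      by (simp only: power_mult_distrib r1(2)[OF z] r2(2)[OF z])
    ultimately have "cmod (\<phi>\<^sub>1 z) * cmod (\<phi>\<^sub>2 z) \<le> (cmod (\<Psi> z))\<^sup>2"
      unfolding \<Psi>_def norm_power[symmetric] norm_mult[symmetric] power_mult[symmetric] by simp
    moreover have "cmod (\<rho>\<^sub>3 z) ^ 4 \<le> cmod (\<Psi>\<^sub>0 z) ^ 4"
      using low(2)[OF z] by (intro power_mono) auto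
    then have "(cmod (\<phi>\<^sub>3 z))\<^sup>2 \<le> (cmod (\<Psi> z))\<^sup>2"
      unfolding \<Psi>_def r3(2)[OF z, symmetric] norm_power[symmetric] power_mult[symmetric] by simp
    ultimately show "cmod (a z) * cmod (b z) \<le> 2 * (cmod (\<Psi> z))\<^sup>2"
      using ab[OF z] by linarith
  qed
  have nz: "\<Psi> z \<noteq> 0" if "z \<in> UHP" for z
    using \<Psi>1[OF that] by auto
  define \<Phi> where "\<Phi> = (\<lambda>z. a z / (2 * \<Psi> z))"
  have hol\<Psi>: "\<Psi> holomorphic_on UHP"
    unfolding \<Psi>_def \<Psi>\<^sub>0_def by (intro holomorphic_intros r1 r2 r3 r4)
  have hol\<Phi>: "\<Phi> holomorphic_on UHP"
    unfolding \<Phi>_def using nz by (intro holomorphic_intros hola hol\<Psi>) auto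
  have bd\<Phi>: "\<forall>\<^sub>F z in at (of_real x) within UHP. cmod (\<Phi> z) \<le> 1" for x
  proof -
    have "\<forall>\<^sub>F z in at (of_real x) within UHP. z \<in> UHP"
      by (rule eventually_in_UHP)
    with bd[of x] show ?thesis
    proof eventually_elim
      case (elim z)
      \<comment> \<open>Near real points a is comparable with b, so the bound on the product a b
        becomes one on the square of a; this is the origin of the factor 2 in \<Phi>.\<close>
      have "(cmod (a z))\<^sup>2 \<le> cmod (a z) * (2 * cmod (b z))"
        unfolding power2_eq_square using elim by (intro mult_left_mono) auto
      also have "\<dots> \<le> (2 * cmod (\<Psi> z))\<^sup>2"
        using \<Psi>ab[OF elim(2)] by (simp add: power_mult_distrib)
      finally have "cmod (a z) \<le> 2 * cmod (\<Psi> z)"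
        by (rule power2_le_imp_le) simp
      then show ?case
        using nz[OF elim(2)] by (simp add: \<Phi>_def norm_divide norm_mult divide_simps)
    qed
  qed
  have bd\<Phi>': "\<forall>\<^sub>F z in at (of_real x) within UHP. cmod (\<Phi> z) < 1 + e" if "e > 0" for x e
    using bd\<Phi>[of x] by eventually_elim (use that in auto)
  obtain C1 where C1: "C1 \<ge> 0" "\<And>z. z \<in> UHP \<Longrightarrow> cmod (a z) \<le> exp (C1 * (cmod (z + \<i>))\<^sup>2 / Im z)"
    using bounded_quotient_growth[OF bq hola] by blast
  have \<Phi>a: "cmod (\<Phi> z) \<le> cmod (a z)" if z: "z \<in> UHP" for z
  proof -
    have "cmod (a z) * 1 \<le> cmod (a z) * (2 * cmod (\<Psi> z))"
      using \<Psi>1[OF z] by (intro mult_left_mono) auto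
    then show ?thesis
      using nz[OF z] by (simp add: \<Phi>_def norm_divide norm_mult divide_simps)
  qed
  \<comment> \<open>Bounded type alone only yields exponential type. The linear growth of a on the
    imaginary axis, divided by \<Psi>, then excludes an exponential factor.\<close>
  have gr\<Phi>: "cmod (\<Phi> z) \<le> exp (8 * C1 * Im z)" if z: "z \<in> UHP" for z
    by (rule phragmen_lindelof_half_disc[OF hol\<Phi> bd\<Phi>' C1(1) _ z]) (use \<Phi>a C1(2) order_trans in blast)+
  have top: "\<forall>\<^sub>F \<eta> in at_top. cmod (\<Phi> (\<i> * of_real \<eta>)) \<le> max 2 (C0 / 2)"
    using gr eventually_gt_at_top[of 0]
  proof eventually_elim
    case (elim \<eta>)
    define z where "z = \<i> * complex_of_real \<eta>"
    have z: "z \<in> UHP" "cmod z = \<eta>"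
      using elim by (auto simp: z_def norm_mult)
    have "cmod (a z) \<le> C0 * \<eta>"
      using elim by (simp add: z_def)
    moreover have "0 \<le> C0"
      using elim norm_ge_zero[of "a (\<i> * of_real \<eta>)"] by (meson mult_neg_pos not_le order_less_le_trans order_less_irrefl)
    then have "C0 * \<eta> \<le> C0 * cmod (\<Psi> z)"
      using \<Psi>z[OF z(1)] z by (intro mult_left_mono) auto
    ultimately have "cmod (\<Phi> z) \<le> C0 / 2"
      using nz[OF z(1)] by (simp add: \<Phi>_def norm_divide norm_mult divide_simps)
    then show ?case
      by (simp add: z_def)
  qed
  have "\<forall>\<^sub>F z in at 0 within UHP. cmod (\<Phi> z) < max 2 (C0 / 2)"
    using bd\<Phi>[of 0] unfolding of_real_0 by eventually_elim auto
  then obtain B where B: "B \<ge> 1" "\<And>\<eta>. \<eta> > 0 \<Longrightarrow> cmod (\<Phi> (\<i> * of_real \<eta>)) \<le> B"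
    using bounded_on_imaginary_axis[OF hol\<Phi> _ top] by blast
  have \<Phi>B: "cmod (\<Phi> z) \<le> B" if z: "z \<in> UHP" for z
    by (rule phragmen_lindelof_UHP[OF hol\<Phi> bd\<Phi>' gr\<Phi> B(2,1) z])
  obtain K1 where K1: "K1 \<ge> 0" "\<And>z. z \<in> UHP \<Longrightarrow> cmod (\<phi>\<^sub>1 z) \<le> K1 * (cmod (z + \<i>))\<^sup>2 / Im z"
    using pick_bound[OF pick(1)] by blast
  obtain K2 where K2: "K2 \<ge> 0" "\<And>z. z \<in> UHP \<Longrightarrow> cmod (\<phi>\<^sub>2 z) \<le> K2 * (cmod (z + \<i>))\<^sup>2 / Im z"
    using pick_bound[OF pick(2)] by blast
  obtain K3 where K3: "K3 \<ge> 0" "\<And>z. z \<in> UHP \<Longrightarrow> cmod (\<phi>\<^sub>3 z) \<le> K3 * (cmod (z + \<i>))\<^sup>2 / Im z"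
    using pick_bound[OF pick(3)] by blast
  obtain K4 where K4: "K4 \<ge> 0" "\<And>z. z \<in> UHP \<Longrightarrow> cmod z \<le> K4 * (cmod (z + \<i>))\<^sup>2 / Im z"
    using pick_bound[OF \<open>pick (\<lambda>z. z)\<close>] by blast
  define K where "K = 8 * B * (K1 + K2 + K3 + K4 + 1)"
  show thesis
  proof (rule that[of K])
    show "0 \<le> K"
      using K1 K2 K3 K4 B by (simp add: K_def)
    fix z assume z: "z \<in> UHP"
    define D where "D = (cmod (z + \<i>))\<^sup>2 / Im z"
    have D: "1 \<le> D"
      using Im_le_cmod_add_i[OF z] z by (simp add: D_def)
    define s1 s2 s3 s4 where "s1 = cmod (\<rho>\<^sub>1 z)" and "s2 = cmod (\<rho>\<^sub>2 z)" and "s3 = cmod (\<rho>\<^sub>3 z)" and "s4 = cmod (\<rho>\<^sub>4 z)"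
    have s: "s1 ^ 4 = cmod (\<phi>\<^sub>1 z)" "s2 ^ 4 = cmod (\<phi>\<^sub>2 z)" "s3 ^ 2 = cmod (\<phi>\<^sub>3 z)" "s4 ^ 2 = cmod z"
      unfolding s1_def s2_def s3_def s4_def norm_power[symmetric] r1(2)[OF z] r2(2)[OF z] r3(2)[OF z] r4(2)[OF z] by auto
    have "cmod (\<Psi>\<^sub>0 z) \<le> cmod (\<rho>\<^sub>1 z * \<rho>\<^sub>2 z) + (cmod (\<rho>\<^sub>3 z) + (cmod (\<rho>\<^sub>4 z) + cmod 1))"
      unfolding \<Psi>\<^sub>0_def by (intro norm_triangle_le add_mono order_refl)
    then have "cmod (\<Psi>\<^sub>0 z) \<le> s1 * s2 + s3 + s4 + 1"
      by (simp add: norm_mult s1_def s2_def s3_def s4_def)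
    then have "cmod (\<Psi> z) \<le> (s1 * s2 + s3 + s4 + 1)\<^sup>2"
      unfolding \<Psi>_def norm_power by (intro power_mono) auto
    also have "\<dots> \<le> 4 * ((s1 * s2)\<^sup>2 + s3\<^sup>2 + s4\<^sup>2 + 1)"
    proof -
      have "0 \<le> (s1 * s2 - s3)\<^sup>2 + (s1 * s2 - s4)\<^sup>2 + (s1 * s2 - 1)\<^sup>2 + (s3 - s4)\<^sup>2 + (s3 - 1)\<^sup>2 + (s4 - 1)\<^sup>2"
        by simp
      then show ?thesis
        by (simp add: power2_eq_square algebra_simps)
    qed
    also have "(s1 * s2)\<^sup>2 \<le> s1 ^ 4 + s2 ^ 4"
    proof -
      have "0 \<le> (s1\<^sup>2 - s2\<^sup>2)\<^sup>2" "0 \<le> (s1 * s2)\<^sup>2"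
        by simp_all
      moreover have "(s1\<^sup>2 - s2\<^sup>2)\<^sup>2 = s1 ^ 4 + s2 ^ 4 - 2 * (s1 * s2)\<^sup>2"
        by (simp add: power2_eq_square power4_eq_xxxx algebra_simps)
      ultimately show ?thesis
        by linarith
    qed
    finally have "cmod (\<Psi> z) \<le> 4 * (cmod (\<phi>\<^sub>1 z) + cmod (\<phi>\<^sub>2 z) + cmod (\<phi>\<^sub>3 z) + cmod z + 1)"
      unfolding s by simp
    also have "\<dots> \<le> 4 * (K1 * D + K2 * D + K3 * D + K4 * D + D)"
      using K1(2)[OF z] K2(2)[OF z] K3(2)[OF z] K4(2)[OF z] D unfolding D_def by simp
    also have "\<dots> = 4 * (K1 + K2 + K3 + K4 + 1) * D"
      by (simp add: algebra_simps)
    finally have \<Psi>D: "cmod (\<Psi> z) \<le> 4 * (K1 + K2 + K3 + K4 + 1) * D" .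
    have "cmod (a z) \<le> B * (2 * cmod (\<Psi> z))"
      using \<Phi>B[OF z] nz[OF z] by (simp add: \<Phi>_def norm_divide norm_mult divide_simps)
    also have "\<dots> \<le> B * (2 * (4 * (K1 + K2 + K3 + K4 + 1) * D))"
      using \<Psi>D B(1) by (intro mult_left_mono) auto
    also have "\<dots> = K * D"
      by (simp add: K_def)
    finally show "cmod (a z) \<le> K * (cmod (z + \<i>))\<^sup>2 / Im z"
      by (simp add: D_def)
  qed
qed

subsection \<open>Behaviour at real points\<close>

lemma filterlim_cnj_UHP: "filterlim cnj (at (of_real x)) (at (of_real x) within UHP)"
  unfolding filterlim_at by (auto intro!: tendsto_eq_intros simp: eventually_at_filter complex_eq_iff)

lemma limit_at_real_cnj:
  assumes "(g \<longlongrightarrow> c) (at (of_real x))" "(h \<longlongrightarrow> d) (at (of_real x))"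
    "\<And>z. z \<in> UHP \<Longrightarrow> h (cnj z) = cnj (g z)"
  shows "d = cnj c"
proof -
  have "((\<lambda>z. h (cnj z)) \<longlongrightarrow> d) (at (of_real x) within UHP)"
    by (rule filterlim_compose[OF assms(2) filterlim_cnj_UHP])
  moreover have "((\<lambda>z. cnj (g z)) \<longlongrightarrow> cnj c) (at (of_real x) within UHP)"
    using assms(1) by (intro tendsto_cnj) (auto intro: tendsto_within_subset)
  then have "((\<lambda>z. h (cnj z)) \<longlongrightarrow> cnj c) (at (of_real x) within UHP)"
    by (rule Lim_transform_eventually) (simp add: eventually_at_filter assms(3))
  ultimately show ?thesis
    by (rule tendsto_unique[OF tendsto_at_real_UHP_nontrivial])
qed

text \<open>Unless a vanishes nearby, it behaves like a constant times a power of
  \<open>z - x\<close>, whose modulus is invariant under conjugation; the bounds 4/3 and 2/3 for the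
  regular factor give 2. For an entry of a #-real matrix, the value at \<open>cnj z\<close> is the
  conjugate of the transposed entry at z.\<close>

lemma meromorphic_reflection_ratio:
  assumes "a meromorphic_on {of_real x}"
  shows "\<forall>\<^sub>F z in at (of_real x) within UHP. cmod (a z) \<le> 2 * cmod (a (cnj z))"
proof -
  define X :: complex where "X = of_real x"
  have m: "isolated_singularity_at a X" "not_essential a X"
    using assms by (simp_all add: meromorphic_at_iff X_def)
  show ?thesis
  proof (cases "\<exists>\<^sub>F w in at X. a w \<noteq> 0")
    case False
    then have "\<forall>\<^sub>F w in at X. a w = 0"
      by (simp add: not_frequently)
    then have "\<forall>\<^sub>F w in at X within UHP. a w = 0"
      by (rule filter_leD[rotated]) (simp add: at_le)
    then show ?thesis
      unfolding X_def by eventually_elim simp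
  next
    case True
    define k where "k = zorder a X"
    define g where "g = zor_poly a X"
    obtain r where r: "r > 0" "g X \<noteq> 0" "g holomorphic_on cball X r"
      "\<And>w. w \<in> cball X r - {X} \<Longrightarrow> a w = g w * (w - X) powi k"
      using zorder_exist[OF m True] unfolding g_def k_def by blast
    have "g holomorphic_on ball X r"
      using r(3) by (rule holomorphic_on_subset) auto
    then have "isCont g X"
      using holomorphic_on_imp_continuous_on continuous_on_interior r(1)
      by (metis centre_in_ball interior_open open_ball)
    then have lim: "(g \<longlongrightarrow> g X) (at X)"
      by (simp add: isCont_def)
    have l1: "((\<lambda>z. cmod (g z)) \<longlongrightarrow> cmod (g X)) (at X within UHP)"
      using lim by (intro tendsto_norm) (auto intro: tendsto_within_subset)
    have l2: "((\<lambda>z. cmod (g (cnj z))) \<longlongrightarrow> cmod (g X)) (at X within UHP)"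
      using filterlim_compose[OF lim filterlim_cnj_UHP[of x, folded X_def]] by (rule tendsto_norm)
    have "\<forall>\<^sub>F z in at X within UHP. cmod (g z) < 4/3 * cmod (g X)"
      by (rule order_tendstoD(2)[OF l1]) (use r(2) in simp)
    moreover have "\<forall>\<^sub>F z in at X within UHP. 2/3 * cmod (g X) < cmod (g (cnj z))"
      by (rule order_tendstoD(1)[OF l2]) (use r(2) in simp)
    moreover have "\<forall>\<^sub>F z in at X within UHP. z \<in> UHP \<inter> ball X r"
      using eventually_UHP_ball[of x x r] r(1) by (simp add: X_def)
    ultimately have "\<forall>\<^sub>F z in at X within UHP. cmod (a z) \<le> 2 * cmod (a (cnj z))"
    proof eventually_elim
      case (elim z)
      have e: "cmod (cnj z - X) = cmod (z - X)"
        by (metis X_def complex_cnj_complex_of_real complex_cnj_diff complex_mod_cnj)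
      have z: "z \<in> cball X r - {X}"
        using elim by (auto simp: X_def)
      have "cnj z \<noteq> X"
        using elim by (auto simp: X_def complex_eq_iff)
      moreover have "dist X (cnj z) = dist X z"
        using e by (simp add: dist_norm norm_minus_commute)
      ultimately have cz: "cnj z \<in> cball X r - {X}"
        using elim by auto
      have "cmod (a z) = cmod (g z) * cmod (z - X) powi k"
        using r(4)[OF z] by (simp add: norm_mult norm_power_int)
      also have "\<dots> \<le> (2 * cmod (g (cnj z))) * cmod (z - X) powi k"
        using elim by (intro mult_right_mono) auto
      also have "\<dots> = 2 * cmod (a (cnj z))"
        using r(4)[OF cz] by (simp add: norm_mult norm_power_int e)
      finally show ?case .
    qed
    then show ?thesis
      by (simp add: X_def)
  qed
qed

text \<open>Near x, F is \<open>of_real \<rho> / (of_real x - z)\<close> minus a function k that is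
  holomorphic at x and real there by symmetry. The first term has nonnegative imaginary part on the
  half plane, and \<open>Im (k z)\<close> tends to 0. Regular points are the case \<rho> =
  0.\<close>

lemma Im_liminf_at_simple_pole:
  assumes mer: "F meromorphic_on {of_real x}"
    and sym: "\<And>z. z \<in> UHP \<Longrightarrow> F (cnj z) = cnj (F z)"
    and lim: "((\<lambda>z. (of_real x - z) * F z) \<longlongrightarrow> of_real \<rho>) (at (of_real x))" and "\<rho> \<ge> 0" "e > 0"
  shows "\<forall>\<^sub>F z in at (of_real x) within UHP. - e < Im (F z)"
proof -
  define X :: complex where "X = of_real x"
  obtain r where r: "r > 0" "F analytic_on ball X r - {X}"
    using mer unfolding meromorphic_at_iff isolated_singularity_at_def X_def by blast
  have holF: "F holomorphic_on ball X r - {X}"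
    by (rule analytic_imp_holomorphic[OF r(2)])
  define G where "G = (\<lambda>z. (if z = X then of_real \<rho> else (X - z) * F z) - of_real \<rho>)"
  have "(\<lambda>z. if z = X then of_real \<rho> else (X - z) * F z) holomorphic_on ball X r"
  proof (rule removable_singularity[OF _ open_ball])
    show "(\<lambda>z. (X - z) * F z) holomorphic_on ball X r - {X}"
      by (intro holomorphic_intros holF)
    show "((\<lambda>z. (X - z) * F z) \<longlongrightarrow> of_real \<rho>) (at X)"
      using lim by (simp add: X_def)
  qed
  then have holG: "G holomorphic_on ball X r"
    unfolding G_def by (intro holomorphic_intros)
  define k where "k = (\<lambda>z. if z = X then deriv G X else G z / (z - X))"
  have holk: "k holomorphic_on ball X r"
    by (rule pole_theorem_open_0[OF holG open_ball]) (auto simp: k_def G_def)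
  have Fk: "F z = of_real \<rho> / (X - z) - k z" if "z \<noteq> X" for z
  proof -
    have "k z = ((X - z) * F z - of_real \<rho>) / (z - X)"
      using that by (simp add: k_def G_def)
    also have "\<dots> = of_real \<rho> / (X - z) - F z"
      using that by (simp add: divide_simps) (simp add: algebra_simps)
    finally show ?thesis
      by simp
  qed
  have "isCont k X"
    using holomorphic_on_imp_continuous_on[OF holk] continuous_on_interior r(1)
    by (metis centre_in_ball interior_open open_ball)
  then have limk: "(k \<longlongrightarrow> k X) (at (of_real x))"
    by (simp add: isCont_def X_def)
  have "k (cnj z) = cnj (k z)" if "z \<in> UHP" for z
  proof -
    have z: "z \<noteq> X" "cnj z \<noteq> X"
      using that by (auto simp: X_def complex_eq_iff)
    have "k z = of_real \<rho> / (X - z) - F z" "k (cnj z) = of_real \<rho> / (X - cnj z) - F (cnj z)"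
      using Fk[OF z(1)] Fk[OF z(2)] by simp_all
    then show ?thesis
      using sym[OF that] by (simp add: X_def)
  qed
  then have "k X = cnj (k X)"
    by (rule limit_at_real_cnj[OF limk limk])
  then have "Im (k X) = 0"
    by (metis Reals_cnj_iff complex_is_Real_iff)
  moreover have "((\<lambda>z. Im (k z)) \<longlongrightarrow> Im (k X)) (at (of_real x) within UHP)"
    using limk by (intro tendsto_Im) (auto intro: tendsto_within_subset)
  ultimately have "\<forall>\<^sub>F z in at (of_real x) within UHP. Im (k z) < e"
    using \<open>e > 0\<close> by (auto dest: order_tendstoD)
  moreover have "\<forall>\<^sub>F z in at (of_real x) within UHP. z \<in> UHP"
    by (rule eventually_in_UHP)
  ultimately show ?thesis
  proof eventually_elim
    case (elim z)
    then have "z \<noteq> X"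
      by (auto simp: X_def)
    moreover have "Im (of_real \<rho> / (X - z)) = \<rho> * Im z / (cmod (X - z))\<^sup>2"
      by (simp add: Im_divide X_def cmod_power2)
    moreover have "0 \<le> \<rho> * Im z / (cmod (X - z))\<^sup>2"
      using elim \<open>\<rho> \<ge> 0\<close> by simp
    ultimately show ?case
      using Fk[of z] elim by simp
  qed
qed

text \<open>The half disc principle loses only a multiple of \<open>Im z\<close>, and adding the
  corresponding multiple of z gives a Pick function. The slope b may still be negative; excluding
  this is the role of the condition at infinity.\<close>

lemma herglotz_up_to_linear_term:
  assumes hol: "F holomorphic_on UHP" and mer: "F meromorphic_on UNIV"
    and sym: "\<And>z. z \<in> UHP \<Longrightarrow> F (cnj z) = cnj (F z)"
    and lim: "\<And>x. \<exists>\<rho>\<ge>0. ((\<lambda>z. (of_real x - z) * F z) \<longlongrightarrow> of_real \<rho>) (at (of_real x))"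
    and C: "C \<ge> 0" "\<And>z. z \<in> UHP \<Longrightarrow> cmod (F z) \<le> C * (cmod (z + \<i>))\<^sup>2 / Im z"
  obtains b :: real where "\<And>z. z \<in> UHP \<Longrightarrow> b * Im z \<le> Im (F z)"
    "((\<lambda>\<eta>::real. F (\<i> * of_real \<eta>) / (\<i> * of_real \<eta>)) \<longlongrightarrow> of_real b) at_top"
proof -
  have lb: "Im (F z) \<ge> - (8 * C * Im z)" if "z \<in> UHP" for z
  proof (rule Im_lower_bound_half_disc[OF hol _ C that])
    fix x e :: real assume "e > 0"
    obtain \<rho> where "\<rho> \<ge> 0" "((\<lambda>z. (of_real x - z) * F z) \<longlongrightarrow> of_real \<rho>) (at (of_real x))"
      using lim by blast
    then show "\<forall>\<^sub>F z in at (of_real x) within UHP. - e < Im (F z)"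
      using \<open>e > 0\<close> mer sym by (intro Im_liminf_at_simple_pole[where F = F and \<rho> = \<rho>]) (auto intro: meromorphic_on_subset)
  qed
  have "pick (\<lambda>z. F z + of_real (8 * C) * z)"
    unfolding pick_def
  proof
    show "(\<lambda>z. F z + of_real (8 * C) * z) holomorphic_on UHP"
      by (intro holomorphic_intros hol)
    show "\<forall>z\<in>UHP. 0 \<le> Im (F z + of_real (8 * C) * z)"
      using lb by fastforce
  qed
  then obtain b :: real where "b \<ge> 0" and b: "\<And>z. z \<in> UHP \<Longrightarrow> b * Im z \<le> Im (F z + of_real (8 * C) * z)"
    "((\<lambda>\<eta>::real. (F (\<i> * of_real \<eta>) + of_real (8 * C) * (\<i> * of_real \<eta>)) / (\<i> * of_real \<eta>)) \<longlongrightarrow> of_real b) at_top"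
    by (rule pick_scaled_limit) (rule that)
  show thesis
  proof (rule that[of "b - 8 * C"])
    show "(b - 8 * C) * Im z \<le> Im (F z)" if "z \<in> UHP" for z
      using b(1)[OF that] by (simp add: algebra_simps)
    show "((\<lambda>\<eta>::real. F (\<i> * of_real \<eta>) / (\<i> * of_real \<eta>)) \<longlongrightarrow> of_real (b - 8 * C)) at_top"
    proof (rule Lim_transform_eventually)
      show "((\<lambda>\<eta>::real. (F (\<i> * of_real \<eta>) + of_real (8 * C) * (\<i> * of_real \<eta>)) / (\<i> * of_real \<eta>) - of_real (8 * C)) \<longlongrightarrow> of_real (b - 8 * C)) at_top"
        unfolding of_real_diff by (intro tendsto_intros b)
      show "\<forall>\<^sub>F \<eta>::real in at_top. (F (\<i> * of_real \<eta>) + of_real (8 * C) * (\<i> * of_real \<eta>)) / (\<i> * of_real \<eta>) - of_real (8 * C) = F (\<i> * of_real \<eta>) / (\<i> * of_real \<eta>)"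
        using eventually_gt_at_top[of 0]
      proof eventually_elim
        case (elim \<eta>)
        then have "\<i> * complex_of_real \<eta> \<noteq> 0"
          by simp
        then show ?case
          by (simp only: add_divide_distrib nonzero_mult_div_cancel_right) simp
      qed
    qed
  qed
qed

section \<open>Real meromorphic functions with a bounded argument\<close>

definition real_meromorphic :: "(complex \<Rightarrow> complex) \<Rightarrow> bool" where
  "real_meromorphic f \<longleftrightarrow> f nicely_meromorphic_on UNIV \<and> f holomorphic_on - \<real> \<and> (\<forall>z. z \<notin> \<real> \<longrightarrow> f (cnj z) = cnj (f z))"

definition bounded_argument :: "nat \<Rightarrow> (complex \<Rightarrow> complex) \<Rightarrow> bool" where
  "bounded_argument m f \<longleftrightarrow> (\<forall>z\<in>UHP. f z = 0) \<or> (\<exists>u N. bounded_log_real_meromorphic f u N m)"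

lemma real_meromorphic_holomorphic_UHP:
  assumes "real_meromorphic f"
  shows "f holomorphic_on UHP"
  using assms unfolding real_meromorphic_def by (auto intro: holomorphic_on_subset dest: UHP_nonreal simp del: UHP_iff)

lemma real_meromorphic_zero:
  assumes "real_meromorphic f" "\<And>z. z \<in> UHP \<Longrightarrow> f z = 0"
  shows "f z = 0"
proof -
  have "f constant_on UHP"
    using assms(2) unfolding constant_on_def by blast
  moreover have "UHP \<noteq> {}"
    using UHP_iff[of \<i>] by fastforce
  ultimately have "f constant_on UNIV"
    using assms(1) unfolding real_meromorphic_def
    by (intro constant_on_extend_nicely_meromorphic_on[of f UNIV UHP]) auto
  then have "f z = f \<i>"
    by (auto simp: constant_on_def)
  then show ?thesis
    using assms(2)[of \<i>] by simp
qed

lemma real_meromorphic_log: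
  assumes "real_meromorphic f" "\<And>z. z \<in> UHP \<Longrightarrow> f z \<noteq> 0"
  obtains u where "log_real_meromorphic f u"
proof -
  obtain u where u: "u holomorphic_on UHP" "\<And>z. z \<in> UHP \<Longrightarrow> exp (u z) = f z"
    using holomorphic_logarithm_exists[OF convex_UHP open_UHP real_meromorphic_holomorphic_UHP[OF assms(1)] assms(2), of \<i>]
    by auto
  have "log_real_meromorphic f u"
    by unfold_locales (use assms(1) u in \<open>auto simp: real_meromorphic_def\<close>)
  then show thesis
    by (rule that)
qed

lemma interlacing_bounded_log:
  assumes "real_meromorphic f" "bounded_quotient f" "interlacing UNIV m f"
  obtains u N where "bounded_log_real_meromorphic f u N m"
proof -
  have "f z \<noteq> 0" if "z \<in> UHP" for z
    using assms(3) UHP_nonreal[OF that] unfolding interlacing_def by blast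
  then obtain u where u: "log_real_meromorphic f u"
    using real_meromorphic_log[OF assms(1)] by blast
  then obtain N :: int where "\<And>z. z \<in> UHP \<Longrightarrow> of_int N * pi \<le> Im (u z) \<and> Im (u z) \<le> of_int (N + int m) * pi"
    using log_real_meromorphic.interlacing_imp_Im_bounds[OF u assms(2,3)] by blast
  then have "bounded_log_real_meromorphic f u N m"
    using u by (simp add: bounded_log_real_meromorphic_def bounded_log_real_meromorphic_axioms_def)
  then show thesis
    by (rule that)
qed

text \<open>N = 0 stands for the positive sign in front of the m-th power; conditions (b) and (c)
  both lead to this normalised case.\<close>

lemma bounded_log_0I:
  assumes "real_meromorphic f" "u holomorphic_on UHP" "\<And>z. z \<in> UHP \<Longrightarrow> exp (u z) = f z"
    "\<And>z. z \<in> UHP \<Longrightarrow> 0 \<le> Im (u z) \<and> Im (u z) \<le> real m * pi"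
  shows "bounded_log_real_meromorphic f u 0 m"
  by unfold_locales (use assms in \<open>auto simp: real_meromorphic_def\<close>)

lemma prop_c_bounded_log:
  assumes "real_meromorphic f" "prop_c m f"
  obtains u where "bounded_log_real_meromorphic f u 0 m"
  using assms(2) bounded_log_0I[OF assms(1)] unfolding prop_c_def by (metis less_imp_le)

lemma scalar_meromorphic_herglotz_pick: "scalar_meromorphic_herglotz g \<Longrightarrow> pick g"
  unfolding scalar_meromorphic_herglotz_iff pick_def
  by (auto intro: holomorphic_on_subset dest: UHP_nonreal simp del: UHP_iff)

text \<open>Each factor has a logarithm with argument between 0 and pi, and the logarithms add up.
  No factor vanishes identically, since f is nonzero at some point.\<close>

lemma prop_b_bounded_log:
  assumes "real_meromorphic f" "prop_b m f" "\<not> (\<forall>z\<in>UHP. f z = 0)"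
  obtains u where "bounded_log_real_meromorphic f u 0 m"
proof -
  obtain g where g: "\<And>j. j < m \<Longrightarrow> scalar_meromorphic_herglotz (g j)"
    "\<And>z. z \<notin> \<real> \<Longrightarrow> f z = (\<Prod>j<m. g j z)"
    using assms(2) by (auto simp: prop_b_def)
  obtain z0 where z0: "z0 \<in> UHP" "f z0 \<noteq> 0"
    using assms(3) by blast
  have "\<exists>u. u holomorphic_on UHP \<and> (\<forall>z\<in>UHP. exp (u z) = g j z) \<and> (\<forall>z\<in>UHP. 0 \<le> Im (u z) \<and> Im (u z) \<le> pi)" if j: "j < m" for j
  proof -
    have p: "pick (g j)"
      by (rule scalar_meromorphic_herglotz_pick[OF g(1)[OF j]])
    have "g j z0 \<noteq> 0"
      using z0 g(2)[OF UHP_nonreal[OF z0(1)]] j by auto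
    then have "\<And>z. z \<in> UHP \<Longrightarrow> g j z \<noteq> 0"
      using pick_zero_or_zero_free[OF p] z0(1) by blast
    from pick_log[OF p this] show ?thesis
      by metis
  qed
  then obtain u where u: "\<And>j. j < m \<Longrightarrow> u j holomorphic_on UHP" "\<And>j z. j < m \<Longrightarrow> z \<in> UHP \<Longrightarrow> exp (u j z) = g j z"
    "\<And>j z. j < m \<Longrightarrow> z \<in> UHP \<Longrightarrow> 0 \<le> Im (u j z) \<and> Im (u j z) \<le> pi"
    by metis
  show thesis
  proof (rule that[of "\<lambda>z. \<Sum>j<m. u j z"], rule bounded_log_0I[OF assms(1)])
    show "(\<lambda>z. \<Sum>j<m. u j z) holomorphic_on UHP"
      using u(1) by (intro holomorphic_on_sum) auto
    fix z assume z: "z \<in> UHP"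
    show "exp (\<Sum>j<m. u j z) = f z"
      using u(2)[OF _ z] g(2)[OF UHP_nonreal[OF z]] by (simp add: exp_sum)
    have "(\<Sum>j<m. Im (u j z)) \<le> (\<Sum>j<m. pi)"
      by (rule sum_mono) (use u(3)[OF _ z] in auto)
    moreover have "0 \<le> (\<Sum>j<m. Im (u j z))"
      by (rule sum_nonneg) (use u(3)[OF _ z] in auto)
    ultimately show "0 \<le> Im (\<Sum>j<m. u j z) \<and> Im (\<Sum>j<m. u j z) \<le> real m * pi"
      by simp
  qed
qed

lemma has_pole_of_multD:
  assumes "interlacing UNIV m f" "has_pole_of_mult m f"
  obtains x :: real where "zorder f (of_real x) = - int m"
proof -
  obtain z where z: "is_pole f z" "zorder f z = - int m"
    using assms(2) by (auto simp: has_pole_of_mult_def)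
  then have "z \<in> \<real>"
    using assms(1) by (auto simp: interlacing_def)
  then show thesis
    using z that by (metis Reals_cases)
qed

lemma bounded_log_0_imp_prop_a:
  assumes "bounded_log_real_meromorphic f u 0 m" "m \<ge> 1"
  shows "prop_a m f"
proof -
  interpret bounded_log_real_meromorphic f u 0 m by fact
  obtain b :: real where b: "b \<ge> 0" "leading_limit m f (of_real (cos (of_int 0 * pi) * b))"
    using leading_limit_exists[OF assms(2)] by blast
  have "pole_sign_condition m f"
    unfolding pole_sign_condition_def
  proof
    assume "has_pole_of_mult m f"
    then obtain x where x: "zorder f (of_real x) = - int m"
      using has_pole_of_multD[OF interlacing] by blast
    show "\<exists>x L :: real. 0 < L \<and> ((\<lambda>z. (of_real x - z) ^ m * f z) \<longlongrightarrow> of_real L) (at (of_real x))"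
      by (rule pole_limit[of x]) (use x in auto)
  qed
  then show ?thesis
    unfolding prop_a_def using interlacing b by auto
qed

text \<open>The weak bounds become strict by the open mapping theorem, applied to u for the lower
  bound and to its negative for the upper one.\<close>

lemma bounded_log_0_imp_prop_c:
  assumes "bounded_log_real_meromorphic f u 0 m" "\<not> f constant_on UNIV"
  shows "prop_c m f"
proof -
  interpret bounded_log_real_meromorphic f u 0 m by fact
  have "\<not> u constant_on UHP"
  proof
    assume "u constant_on UHP"
    then have "f constant_on UHP"
      using exp_u unfolding constant_on_def by metis
    moreover have "UHP \<noteq> {}"
      using UHP_iff[of \<i>] by fastforce
    ultimately have "f constant_on UNIV"
      using mero by (intro constant_on_extend_nicely_meromorphic_on[of f UNIV UHP]) auto
    then show False
      using assms(2) by simp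
  qed
  then have nc: "\<not> u constant_on UHP" "\<not> (\<lambda>z. - u z) constant_on UHP"
    by (auto simp: constant_on_def simp del: UHP_iff) (metis minus_minus)
  have "0 < Im (u z)" "Im (u z) < real m * pi" if z: "z \<in> UHP" for z
  proof -
    have "Im (u z) \<noteq> 0"
      using open_map_Im_strict[OF holu, of 0 z] Im_bounds z nc(1) by auto
    then show "0 < Im (u z)"
      using Im_bounds[OF z] by simp
    have "Im (- u z) \<noteq> - (real m * pi)"
      using open_map_Im_strict[of "\<lambda>z. - u z" "- (real m * pi)" z] Im_bounds z nc(2) holu
      by (auto intro: holomorphic_on_minus)
    then show "Im (u z) < real m * pi"
      using Im_bounds[OF z] by simp
  qed
  then show ?thesis
    unfolding prop_c_def using holu exp_u by (intro exI[of _ u]) (auto simp del: UHP_iff)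
qed

lemma bounded_argument_pick:
  assumes "bounded_argument m f" "m \<ge> 1"
  obtains \<phi> where "pick \<phi>" "\<And>z. z \<in> UHP \<Longrightarrow> cmod (f z) = cmod (\<phi> z) ^ m"
  using assms(1) unfolding bounded_argument_def
proof (elim disjE exE)
  assume "\<forall>z\<in>UHP. f z = 0"
  then show thesis
    using assms(2) by (intro that[of "\<lambda>_. 0"]) (auto simp: pick_def)
next
  fix u N assume "bounded_log_real_meromorphic f u N m"
  then interpret bounded_log_real_meromorphic f u N m .
  obtain \<phi> where \<phi>: "pick \<phi>" "\<And>z. z \<in> UHP \<Longrightarrow> f z = of_real (cos (of_int N * pi)) * \<phi> z ^ m"
    by (rule pick_root[OF assms(2)]) (rule that)
  have "\<bar>cos (of_int N * pi)\<bar> = (1::real)"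
  proof -
    have "sin (of_int N * pi) = 0"
      by (auto simp: sin_zero_iff_int2)
    then have "(cos (of_int N * pi))\<^sup>2 = 1"
      using sin_cos_squared_add[of "of_int N * pi"] by simp
    then show ?thesis
      by (auto simp: power2_eq_1_iff)
  qed
  then show thesis
    using \<phi> by (intro that[of \<phi>]) (simp_all add: norm_mult norm_power del: UHP_iff)
qed

lemma bounded_argument_limit:
  assumes "real_meromorphic f" "bounded_argument m f" "m \<ge> 1"
  obtains c where "((\<lambda>z. (of_real x - z) ^ m * f z) \<longlongrightarrow> c) (at (of_real x))"
  using assms(2) unfolding bounded_argument_def
proof (elim disjE exE)
  assume "\<forall>z\<in>UHP. f z = 0"
  then have "f z = 0" for z
    using real_meromorphic_zero[OF assms(1)] by blast
  then show thesis
    by (intro that[of 0]) simp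
next
  fix u N assume "bounded_log_real_meromorphic f u N m"
  then interpret bounded_log_real_meromorphic f u N m .
  show thesis
    by (rule pole_limit[of x]) (rule that)
qed

text \<open>The sign condition on poles in uniform form: it is asked at every real point, with L = 0
  where there is no pole of order m. In this form it yields the principal minors of a residue
  matrix.\<close>

definition nonneg_limits :: "nat \<Rightarrow> (complex \<Rightarrow> complex) \<Rightarrow> bool" where
  "nonneg_limits m f \<longleftrightarrow>
     (\<forall>x::real. \<exists>L\<ge>0. ((\<lambda>z. (of_real x - z) ^ m * f z) \<longlongrightarrow> of_real L) (at (of_real x)))"

lemma bounded_log_0_nonneg_limits:
  assumes "bounded_log_real_meromorphic f u 0 m"
  shows "nonneg_limits m f"
  unfolding nonneg_limits_def
proof
  fix x
  interpret bounded_log_real_meromorphic f u 0 m by fact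
  show "\<exists>L\<ge>0. ((\<lambda>z. (of_real x - z) ^ m * f z) \<longlongrightarrow> of_real L) (at (of_real x))"
    by (rule pole_limit[of x]) auto
qed

lemma zero_nonneg_limits:
  assumes "real_meromorphic f" "\<forall>z\<in>UHP. f z = 0"
  shows "nonneg_limits m f"
proof -
  have "f z = 0" for z
    using real_meromorphic_zero[OF assms(1)] assms(2) by blast
  then show ?thesis
    by (auto simp: nonneg_limits_def)
qed

text \<open>A pole of maximal order determines the sign of \<open>f\<close>; without such a pole all limits vanish.\<close>

lemma prop_a_nonneg_limits:
  assumes "bounded_log_real_meromorphic f u N m" "pole_sign_condition m f" "m \<ge> 1"
  shows "nonneg_limits m f"
  unfolding nonneg_limits_def
proof
  fix x
  interpret bounded_log_real_meromorphic f u N m by fact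
  define s where "s = cos (of_int N * pi)"
  obtain L where L: "L \<ge> 0" "L > 0 \<longleftrightarrow> zorder f (of_real x) = - int m"
    "((\<lambda>z. (of_real x - z) ^ m * f z) \<longlongrightarrow> of_real (s * L)) (at (of_real x))"
    unfolding s_def by (rule pole_limit[of x])
  show "\<exists>L\<ge>0. ((\<lambda>z. (of_real x - z) ^ m * f z) \<longlongrightarrow> of_real L) (at (of_real x))"
  proof (cases "zorder f (of_real x) = - int m")
    case False
    then have "L = 0"
      using L by auto
    then show ?thesis
      using L by (intro exI[of _ 0]) auto
  next
    case True
    have "is_pole f (of_real x)"
    proof (rule neg_zorder_imp_is_pole)
      show "isolated_singularity_at f (of_real x)" "not_essential f (of_real x)"
        using mero meromorphic_on_subset[of f UNIV "{of_real x}"] by (auto simp: nicely_meromorphic_on_def meromorphic_at_iff)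
      show "zorder f (of_real x) < 0"
        using True assms(3) by simp
      show "\<exists>\<^sub>F w in at (of_real x). f w \<noteq> 0"
      proof -
        have "\<exists>\<^sub>F w in at (of_real x) within UHP. f w \<noteq> 0"
          using eventually_in_UHP[of "of_real x"] nz_UHP
          by (intro eventually_frequently) (auto elim: eventually_mono)
        then show ?thesis
          unfolding frequently_def using filter_leD[OF at_le[OF subset_UNIV]] by blast
      qed
    qed
    then have "has_pole_of_mult m f"
      using True by (auto simp: has_pole_of_mult_def)
    then obtain y K :: real where K: "K > 0" "((\<lambda>z. (of_real y - z) ^ m * f z) \<longlongrightarrow> of_real K) (at (of_real y))"
      using assms(2) by (auto simp: pole_sign_condition_def)
    obtain L' where L': "L' \<ge> 0" "((\<lambda>z. (of_real y - z) ^ m * f z) \<longlongrightarrow> of_real (s * L')) (at (of_real y))"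
      unfolding s_def by (rule pole_limit[of y])
    \<comment> \<open>The representation by a bounded argument gives the limit at y with the global
      sign s; its positivity at this one point determines s for all points.\<close>
    have "complex_of_real K = of_real (s * L')"
      by (rule tendsto_unique[OF _ K(2) L'(2)]) simp
    then have "K = s * L'"
      unfolding of_real_eq_iff .
    then have "s > 0"
      using K(1) L'(1) by (auto simp: zero_less_mult_iff)
    then show ?thesis
      using L by (intro exI[of _ "s * L"]) auto
  qed
qed

section \<open>Determinants of limits\<close>

lemma fdet_tendsto:
  assumes "\<And>i j. i < n \<Longrightarrow> j < n \<Longrightarrow> ((\<lambda>z. A z i j) \<longlongrightarrow> B i j) F"
  shows "((\<lambda>z. fdet n (A z)) \<longlongrightarrow> fdet n B) F"
  unfolding fdet_leibniz
  by (intro tendsto_sum tendsto_mult tendsto_const tendsto_prod assms) (auto dest: permutes_in_image)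

lemma qform_tendsto:
  assumes "\<And>i j. i < n \<Longrightarrow> j < n \<Longrightarrow> ((\<lambda>z. A z i j) \<longlongrightarrow> B i j) F"
  shows "((\<lambda>z. qform n (A z) v) \<longlongrightarrow> qform n B v) F"
  unfolding qform_def by (intro tendsto_sum tendsto_mult tendsto_const assms) auto

lemma fdet_scale: "fdet n (\<lambda>i j. c * A i j) = c ^ n * fdet n A"
  unfolding fdet_leibniz by (simp add: prod.distrib sum_distrib_left mult.left_commute)

lemma qform_scale_matrix: "qform n (\<lambda>i j. c * A i j) v = c * qform n A v"
  unfolding qform_def sum_distrib_left by (intro sum.cong refl) (simp only: mult_ac)

lemma fdet_cnj_transpose: "fdet n (\<lambda>i j. cnj (A j i)) = cnj (fdet n A)"
proof -
  have "fdet n (\<lambda>i j. cnj (A j i)) = Determinant.det (transpose_mat (mat n n (\<lambda>(i, j). cnj (A i j))))"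
    unfolding fdet_def by (intro arg_cong[of _ _ Determinant.det] eq_matI) auto
  also have "\<dots> = fdet n (\<lambda>i j. cnj (A i j))"
    unfolding fdet_def by (rule det_transpose[of _ n]) simp
  also have "\<dots> = cnj (fdet n A)"
    unfolding fdet_leibniz by simp
  finally show ?thesis .
qed

text \<open>The vector is pushed forward along s. For an increasing index tuple this is extension by
  zero, so the form of a principal submatrix is a restriction of the full form.\<close>

lemma qform_select:
  assumes "\<And>k. k < m \<Longrightarrow> s k < n"
  shows "qform m (\<lambda>k l. A (s k) (s l)) v = qform n A (\<lambda>i. \<Sum>k<m. if s k = i then v k else 0)"
proof -
  define w where "w = (\<lambda>i. \<Sum>k<m. if s k = i then v k else 0)"
  have select: "(\<Sum>j<n. g j * (\<Sum>l<m. if s l = j then h l else 0)) = (\<Sum>l<m. g (s l) * h l)" for g h :: "nat \<Rightarrow> complex"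
  proof -
    have "(\<Sum>j<n. g j * (\<Sum>l<m. if s l = j then h l else 0)) = (\<Sum>j<n. \<Sum>l<m. if s l = j then g (s l) * h l else 0)"
      unfolding sum_distrib_left by (intro sum.cong refl) auto
    also have "\<dots> = (\<Sum>l<m. \<Sum>j<n. if s l = j then g (s l) * h l else 0)"
      by (rule sum.swap)
    also have "\<dots> = (\<Sum>l<m. g (s l) * h l)"
      using assms by (intro sum.cong refl) (simp add: sum.delta')
    finally show ?thesis .
  qed
  have cw: "cnj (w i) = (\<Sum>k<m. if s k = i then cnj (v k) else 0)" for i
    unfolding w_def cnj_sum by (intro sum.cong refl) auto
  have "qform n A w = (\<Sum>i<n. (\<Sum>j<n. A i j * w j) * cnj (w i))"
    unfolding qform_def sum_distrib_right by (intro sum.cong refl) (simp only: mult_ac)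
  also have "\<dots> = (\<Sum>k<m. (\<Sum>j<n. A (s k) j * w j) * cnj (v k))"
    unfolding cw by (rule select)
  also have "\<dots> = (\<Sum>k<m. (\<Sum>l<m. A (s k) (s l) * v l) * cnj (v k))"
    unfolding w_def select ..
  also have "\<dots> = qform m (\<lambda>k l. A (s k) (s l)) v"
    unfolding qform_def sum_distrib_right by (intro sum.cong refl) (simp only: mult_ac)
  finally show ?thesis
    by (simp add: w_def)
qed

lemma bounded_quotient_cong:
  assumes "\<And>z. z \<in> UHP \<Longrightarrow> f z = g z"
  shows "bounded_quotient f \<longleftrightarrow> bounded_quotient g"
  using assms unfolding bounded_quotient_def by (simp del: UHP_iff cong: conj_cong)

section \<open>The equivalence\<close>

lemma frobenius_norm_ge:
  assumes "M \<in> carrier_mat n m" "i < n" "j < m"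
  shows "cmod (M $$ (i, j)) \<le> frobenius_norm M"
proof -
  have "(cmod (M $$ (i, j)))\<^sup>2 \<le> (\<Sum>l<dim_col M. (cmod (M $$ (i, l)))\<^sup>2)"
    using assms by (intro member_le_sum[of j "{..<dim_col M}" "\<lambda>l. (cmod (M $$ (i, l)))\<^sup>2"]) auto
  also have "\<dots> \<le> (\<Sum>k<dim_row M. \<Sum>l<dim_col M. (cmod (M $$ (k, l)))\<^sup>2)"
    using assms by (intro member_le_sum[of i "{..<dim_row M}" "\<lambda>k. \<Sum>l<dim_col M. (cmod (M $$ (k, l)))\<^sup>2"]) (auto intro: sum_nonneg)
  finally show ?thesis
    unfolding frobenius_norm_def by (rule real_le_rsqrt)
qed

lemma index_tuples_iff:
  "idx \<in> index_tuples n m \<longleftrightarrow> length idx = m \<and> sorted_wrt (<) idx \<and> (\<forall>k<m. idx ! k < n)"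
  unfolding index_tuples_def by (auto simp: subset_iff in_set_conv_nth)

section \<open>The matrix function under the standing hypotheses\<close>

locale meromorphic_matrix =
  fixes n :: nat and Q :: "complex \<Rightarrow> complex mat"
  assumes mat_mer: "mat_meromorphic n Q"
    and poles: "mat_poles n Q \<subseteq> \<real>"
    and sharp: "sharp_real_on (- mat_poles n Q) Q"
    and btype: "mat_bounded_type n Q"
    and growth: "Limsup at_top (\<lambda>\<eta>::real. ereal (frobenius_norm (Q (\<i> * of_real \<eta>)) / \<eta>)) < \<infinity>"
begin

lemma carrier: "Q z \<in> carrier_mat n n"
  using mat_mer by (simp add: mat_meromorphic_def)

lemma entry_nice: "i < n \<Longrightarrow> j < n \<Longrightarrow> (\<lambda>z. Q z $$ (i, j)) nicely_meromorphic_on UNIV"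
  using mat_mer by (simp add: mat_meromorphic_def)

lemma entry_mer: "i < n \<Longrightarrow> j < n \<Longrightarrow> (\<lambda>z. Q z $$ (i, j)) meromorphic_on A"
  using entry_nice meromorphic_on_subset unfolding nicely_meromorphic_on_def by blast

lemma entry_hol:
  assumes "i < n" "j < n"
  shows "(\<lambda>z. Q z $$ (i, j)) holomorphic_on - \<real>"
proof (rule analytic_imp_holomorphic, subst analytic_on_analytic_at, intro ballI)
  fix z :: complex assume "z \<in> - \<real>"
  then have "\<not> is_pole (\<lambda>z. Q z $$ (i, j)) z"
    using poles assms unfolding mat_poles_def by auto
  then show "(\<lambda>z. Q z $$ (i, j)) analytic_on {z}"
    using nicely_meromorphic_on_imp_analytic_at[OF entry_nice[OF assms]] by simp
qed

lemma entry_hol_UHP: "i < n \<Longrightarrow> j < n \<Longrightarrow> (\<lambda>z. Q z $$ (i, j)) holomorphic_on UHP"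
  using entry_hol by (auto intro: holomorphic_on_subset dest: UHP_nonreal simp del: UHP_iff)

lemma entry_sym:
  assumes "z \<notin> \<real>" "i < n" "j < n"
  shows "Q (cnj z) $$ (i, j) = cnj (Q z $$ (j, i))"
proof -
  have "cnj z \<notin> \<real>"
    using assms(1) by simp
  then have "cnj z \<in> - mat_poles n Q"
    using poles by blast
  then have "Q (cnj z) = mat_adjoint (Q (cnj (cnj z)))"
    using sharp unfolding sharp_real_on_def sharp_def by blast
  then show ?thesis
    using mat_adjoint_index[OF carrier assms(2,3)] by simp
qed

lemma entry_bounded_quotient: "i < n \<Longrightarrow> j < n \<Longrightarrow> bounded_quotient (\<lambda>z. Q z $$ (i, j))"
  using btype by (intro bounded_type_imp_bounded_quotient entry_hol_UHP) (auto simp: mat_bounded_type_def)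

lemma entry_growth:
  assumes "i < n" "j < n"
  obtains C where "\<forall>\<^sub>F \<eta> in at_top. cmod (Q (\<i> * of_real \<eta>) $$ (i, j)) \<le> C * \<eta>"
proof -
  obtain M :: real where "Limsup at_top (\<lambda>\<eta>::real. ereal (frobenius_norm (Q (\<i> * of_real \<eta>)) / \<eta>)) < ereal M"
    using growth less_PInf_Ex_of_nat by (metis ereal_dense2 less_ereal.simps(2))
  then have "\<forall>\<^sub>F \<eta> in at_top. ereal (frobenius_norm (Q (\<i> * of_real \<eta>)) / \<eta>) < ereal M"
    by (rule Limsup_lessD)
  then have "\<forall>\<^sub>F \<eta> in at_top. cmod (Q (\<i> * of_real \<eta>) $$ (i, j)) \<le> M * \<eta>"
    using eventually_gt_at_top[of 0]
  proof eventually_elim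
    case (elim \<eta>)
    then have "frobenius_norm (Q (\<i> * of_real \<eta>)) \<le> M * \<eta>"
      by (simp add: field_simps)
    then show ?case
      using frobenius_norm_ge[OF carrier assms, of "\<i> * of_real \<eta>"] by linarith
  qed
  then show thesis
    by (rule that)
qed

subsection \<open>Principal minors\<close>

text \<open>The pointwise minor, for which algebraic identities hold everywhere;
  \<open>minor_fun\<close> agrees with it off the real line and in punctured neighbourhoods of all
  points, which suffices for limits.\<close>

definition minor :: "nat list \<Rightarrow> complex \<Rightarrow> complex" where
  "minor idx z = fdet (length idx) (\<lambda>k l. Q z $$ (idx ! k, idx ! l))"

lemma minor_fun_eq: "minor_fun Q idx = remove_sings (minor idx)"
  unfolding minor_fun_def minor_def fdet_def principal_submatrix_def ..

context
  fixes idx m assumes idx: "idx \<in> index_tuples n m"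
begin

lemma idx_length: "length idx = m"
  using idx by (simp add: index_tuples_iff)

lemma idx_lt: "k < m \<Longrightarrow> idx ! k < n"
  using idx by (simp add: index_tuples_iff)

lemma minor_leibniz:
  "minor idx z = (\<Sum>p | p permutes {0..<m}. signof p * (\<Prod>k=0..<m. Q z $$ (idx ! k, idx ! p k)))"
  unfolding minor_def fdet_leibniz idx_length ..

lemma idx_perm: "p permutes {0..<m} \<Longrightarrow> k < m \<Longrightarrow> idx ! p k < n"
  using permutes_in_image[of p "{0..<m}" k] by (intro idx_lt) auto

lemma minor_hol: "minor idx holomorphic_on - \<real>"
  unfolding minor_leibniz[abs_def] using idx_lt idx_perm
  by (intro holomorphic_on_sum holomorphic_on_mult holomorphic_on_const holomorphic_on_prod entry_hol) auto

lemma minor_mer: "minor idx meromorphic_on A"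
  unfolding minor_leibniz[abs_def] using idx_lt idx_perm
  by (intro meromorphic_on_sum meromorphic_on_mult meromorphic_on_const meromorphic_on_prod entry_mer) auto

lemma minor_bounded_quotient: "bounded_quotient (minor idx)"
  unfolding minor_leibniz[abs_def] using idx_lt idx_perm
  by (intro bounded_quotient_sum finite_permutations bounded_quotient_mult bounded_quotient_const bounded_quotient_prod
      holomorphic_on_mult holomorphic_on_const holomorphic_on_prod entry_bounded_quotient entry_hol_UHP) auto

lemma minor_fun_nonreal:
  assumes "z \<notin> \<real>"
  shows "minor_fun Q idx z = minor idx z"
  unfolding minor_fun_eq
proof (rule remove_sings_at_analytic)
  show "minor idx analytic_on {z}"
    by (rule analytic_at_nonreal[OF minor_hol assms])
qed

lemma minor_fun_real_meromorphic: "real_meromorphic (minor_fun Q idx)"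
  unfolding real_meromorphic_def
proof (intro conjI allI impI)
  show "minor_fun Q idx nicely_meromorphic_on UNIV"
    unfolding minor_fun_eq by (rule remove_sings_nicely_meromorphic) (rule minor_mer)
  show "minor_fun Q idx holomorphic_on - \<real>"
    using minor_hol by (rule holomorphic_transform) (simp add: minor_fun_nonreal)
  fix z :: complex assume z: "z \<notin> \<real>"
  have "minor idx (cnj z) = fdet m (\<lambda>k l. cnj (Q z $$ (idx ! l, idx ! k)))"
    unfolding minor_def idx_length by (rule fdet_cong) (use entry_sym[OF z] idx_lt in auto)
  also have "\<dots> = cnj (minor idx z)"
    unfolding fdet_cnj_transpose minor_def idx_length ..
  finally show "minor_fun Q idx (cnj z) = cnj (minor_fun Q idx z)"
    using z by (simp add: minor_fun_nonreal)
qed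

lemma minor_fun_bounded_quotient: "bounded_quotient (minor_fun Q idx)"
  using bounded_quotient_cong[of "minor_fun Q idx" "minor idx"] minor_bounded_quotient minor_fun_nonreal UHP_nonreal
  by blast

lemma minor_fun_eventually: "\<forall>\<^sub>F z in at w. minor_fun Q idx z = minor idx z"
  unfolding minor_fun_eq
  by (rule eventually_remove_sings_eq_at) (use minor_mer[of "{w}"] in \<open>simp add: meromorphic_at_iff\<close>)

text \<open>What the three alternatives of (ii) have in common: a bounded argument, nonnegative
  leading coefficients at real points, and one at infinity. Under (b) and (c) the sign is positive
  from the start; under (a) it comes from the explicit sign conditions.\<close>

lemma minor_cond_imp:
  assumes "prop_a m (minor_fun Q idx) \<or> prop_b m (minor_fun Q idx) \<or> prop_c m (minor_fun Q idx)" "m \<ge> 1"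
  shows "bounded_argument m (minor_fun Q idx)" "nonneg_limits m (minor_fun Q idx)"
    "\<exists>L\<ge>0. leading_limit m (minor_fun Q idx) (of_real L)"
proof -
  define f where "f = minor_fun Q idx"
  have rm: "real_meromorphic f"
    unfolding f_def by (rule minor_fun_real_meromorphic)
  have bq: "bounded_quotient f"
    unfolding f_def by (rule minor_fun_bounded_quotient)
  have zero: "bounded_argument m f \<and> nonneg_limits m f \<and> (\<exists>L\<ge>0. leading_limit m f (of_real L))"
    if "\<forall>z\<in>UHP. f z = 0"
  proof -
    have "f z = 0" for z
      using real_meromorphic_zero[OF rm] that by blast
    then have "leading_limit m f (of_real 0)"
      by (simp add: leading_limit_def)
    then show ?thesis
      using that zero_nonneg_limits[OF rm that] by (auto simp: bounded_argument_def)
  qed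
  have log0: "bounded_argument m f \<and> nonneg_limits m f \<and> (\<exists>L\<ge>0. leading_limit m f (of_real L))"
    if "bounded_log_real_meromorphic f u 0 m" for u
    using that bounded_log_0_nonneg_limits[OF that] bounded_log_0_imp_prop_a[OF that assms(2)]
    by (auto simp: bounded_argument_def prop_a_def)
  have "bounded_argument m f \<and> nonneg_limits m f \<and> (\<exists>L\<ge>0. leading_limit m f (of_real L))"
    using assms(1) unfolding f_def[symmetric]
  proof (elim disjE)
    assume a: "prop_a m f"
    then obtain u N where uN: "bounded_log_real_meromorphic f u N m"
      using interlacing_bounded_log[OF rm bq] by (auto simp: prop_a_def)
    then show ?thesis
      using prop_a_nonneg_limits[OF uN _ assms(2)] a by (auto simp: bounded_argument_def prop_a_def)
  next
    assume b: "prop_b m f"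
    show ?thesis
    proof (cases "\<forall>z\<in>UHP. f z = 0")
      case True
      then show ?thesis
        by (rule zero)
    next
      case False
      show ?thesis
        by (rule prop_b_bounded_log[OF rm b False]) (rule log0)
    qed
  next
    assume c: "prop_c m f"
    show ?thesis
      by (rule prop_c_bounded_log[OF rm c]) (rule log0)
  qed
  then show "bounded_argument m (minor_fun Q idx)" "nonneg_limits m (minor_fun Q idx)"
    "\<exists>L\<ge>0. leading_limit m (minor_fun Q idx) (of_real L)"
    by (auto simp: f_def)
qed

text \<open>A principal submatrix of a Herglotz function is Herglotz, because its form is the
  original one at vectors supported on idx; the factorisation of determinants then applies.\<close>

lemma herglotz_imp_prop_b:
  assumes "herglotz n Q"
  shows "prop_b m (minor_fun Q idx)"
proof -
  have h: "herglotz_family n (\<lambda>z. entries (Q z))"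
    using assms herglotz_iff[of Q n, OF carrier] by blast
  have "herglotz_family m (\<lambda>z k l. Q z $$ (idx ! k, idx ! l))"
    unfolding herglotz_family_def
  proof (intro conjI allI impI ballI)
    fix z v assume z: "z \<in> UHP"
    have "qform m (\<lambda>k l. Q z $$ (idx ! k, idx ! l)) v = qform n (entries (Q z)) (\<lambda>i. \<Sum>k<m. if idx ! k = i then v k else 0)"
      by (rule qform_select[where s = "\<lambda>k. idx ! k" and A = "entries (Q z)"]) (rule idx_lt)
    then show "0 \<le> Im (qform m (\<lambda>k l. Q z $$ (idx ! k, idx ! l)) v)"
      using h z by (simp add: herglotz_family_def)
  qed (auto intro!: entry_hol entry_sym idx_lt)
  then obtain g where g: "\<forall>j<m. scalar_meromorphic_herglotz (g j)"
    "\<forall>z. z \<notin> \<real> \<longrightarrow> fdet m (\<lambda>k l. Q z $$ (idx ! k, idx ! l)) = (\<Prod>j<m. g j z)"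
    using herglotz_family_det[of m "\<lambda>z k l. Q z $$ (idx ! k, idx ! l)"] entry_mer idx_lt by blast
  then show ?thesis
    unfolding prop_b_def by (intro exI[of _ g]) (auto simp: minor_fun_nonreal minor_def idx_length)
qed

end

lemma single_index: "i < n \<Longrightarrow> [i] \<in> index_tuples n 1"
  by (simp add: index_tuples_iff)

lemma double_index: "i < j \<Longrightarrow> j < n \<Longrightarrow> [i, j] \<in> index_tuples n 2"
  by (auto simp: index_tuples_iff less_Suc_eq numeral_2_eq_2)

lemma minor_1: "minor [i] z = Q z $$ (i, i)"
  by (simp add: minor_def)

lemma minor_2: "minor [i, j] z = Q z $$ (i, i) * Q z $$ (j, j) - Q z $$ (i, j) * Q z $$ (j, i)"
proof -
  have "length [i, j] = 2"
    by simp
  then show ?thesis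
    unfolding minor_def by (simp only: fdet_2) simp
qed

text \<open>The negative of the residue when the pole is simple, so that negative semi-definite
  residues become nonnegative forms. The value is meaningful once the limit is known to
  exist.\<close>

definition res :: "real \<Rightarrow> nat \<Rightarrow> nat \<Rightarrow> complex" where
  "res x i j = Lim (at (of_real x)) (\<lambda>z. (of_real x - z) * Q z $$ (i, j))"

end

section \<open>Growth and simple poles from the minors of size 1 and 2\<close>

locale bounded_argument_matrix = meromorphic_matrix +
  assumes arg1: "\<And>i. i < n \<Longrightarrow> bounded_argument 1 (minor_fun Q [i])"
    and arg2: "\<And>i j. i < j \<Longrightarrow> j < n \<Longrightarrow> bounded_argument 2 (minor_fun Q [i, j])"
begin

lemma diag_pick:
  assumes "i < n"
  obtains \<phi> where "pick \<phi>" "\<And>z. z \<in> UHP \<Longrightarrow> cmod (Q z $$ (i, i)) = cmod (\<phi> z)"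
proof -
  obtain \<phi> where \<phi>: "pick \<phi>" "\<And>z. z \<in> UHP \<Longrightarrow> cmod (minor_fun Q [i] z) = cmod (\<phi> z) ^ 1"
    using bounded_argument_pick[OF arg1[OF assms]] by blast
  show thesis
    using \<phi> minor_fun_nonreal[OF single_index[OF assms] UHP_nonreal]
    by (intro that[of \<phi>]) (simp_all add: minor_1 del: UHP_iff)
qed

lemma offdiag_pick:
  assumes "i < n" "j < n" "i \<noteq> j"
  obtains \<phi> where "pick \<phi>"
    "\<And>z. z \<in> UHP \<Longrightarrow> cmod (Q z $$ (i, i) * Q z $$ (j, j) - Q z $$ (i, j) * Q z $$ (j, i)) = (cmod (\<phi> z))\<^sup>2"
proof -
  have *: "\<exists>\<phi>. pick \<phi> \<and> (\<forall>z\<in>UHP. cmod (Q z $$ (i, i) * Q z $$ (j, j) - Q z $$ (i, j) * Q z $$ (j, i)) = (cmod (\<phi> z))\<^sup>2)"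
    if ij: "i < j" "j < n" for i j
  proof -
    obtain \<phi> where \<phi>: "pick \<phi>" "\<And>z. z \<in> UHP \<Longrightarrow> cmod (minor_fun Q [i, j] z) = cmod (\<phi> z) ^ 2"
      using bounded_argument_pick[OF arg2[OF ij]] by auto
    then show ?thesis
      using minor_fun_nonreal[OF double_index[OF ij] UHP_nonreal] by (auto simp: minor_2 simp del: UHP_iff)
  qed
  consider "i < j" | "j < i"
    using assms(3) by linarith
  then show thesis
  proof cases
    case 1
    then show ?thesis
      using *[of i j] assms that by blast
  next
    case 2
    then obtain \<phi> where \<phi>: "pick \<phi>" "\<forall>z\<in>UHP. cmod (Q z $$ (j, j) * Q z $$ (i, i) - Q z $$ (j, i) * Q z $$ (i, j)) = (cmod (\<phi> z))\<^sup>2"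
      using *[of j i] assms by blast
    show ?thesis
      by (rule that[OF \<phi>(1)]) (use \<phi>(2) in \<open>simp add: mult.commute del: UHP_iff\<close>)
  qed
qed

lemma entry_reflection:
  assumes "i < n" "j < n"
  shows "\<forall>\<^sub>F z in at (of_real x) within UHP. cmod (Q z $$ (i, j)) \<le> 2 * cmod (Q z $$ (j, i))"
proof -
  have "\<forall>\<^sub>F z in at (of_real x) within UHP. z \<in> UHP"
    by (rule eventually_in_UHP)
  with meromorphic_reflection_ratio[OF entry_mer[OF assms], of x] show ?thesis
  proof eventually_elim
    case (elim z)
    then show ?case
      using entry_sym[OF UHP_nonreal[OF elim(2)] assms] by simp
  qed
qed

text \<open>A diagonal entry has the modulus of a Pick function. For an off-diagonal one, its
  product with the transposed entry is the difference of a product of diagonal entries and a minor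
  of size 2, all with moduli given by Pick functions.\<close>

lemma entry_bound:
  assumes ij: "i < n" "j < n"
  obtains C where "C \<ge> 0" "\<And>z. z \<in> UHP \<Longrightarrow> cmod (Q z $$ (i, j)) \<le> C * (cmod (z + \<i>))\<^sup>2 / Im z"
proof (cases "i = j")
  case True
  obtain \<phi> where \<phi>: "pick \<phi>" "\<And>z. z \<in> UHP \<Longrightarrow> cmod (Q z $$ (i, i)) = cmod (\<phi> z)"
    using diag_pick[OF ij(1)] by blast
  obtain C where C: "C \<ge> 0" "\<And>z. z \<in> UHP \<Longrightarrow> cmod (\<phi> z) \<le> C * (cmod (z + \<i>))\<^sup>2 / Im z"
    using pick_bound[OF \<phi>(1)] by blast
  show thesis
    using C \<phi>(2) True by (intro that[of C]) (simp_all del: UHP_iff)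
next
  case False
  obtain \<phi>1 where 1: "pick \<phi>1" "\<And>z. z \<in> UHP \<Longrightarrow> cmod (Q z $$ (i, i)) = cmod (\<phi>1 z)"
    using diag_pick[OF ij(1)] by blast
  obtain \<phi>2 where 2: "pick \<phi>2" "\<And>z. z \<in> UHP \<Longrightarrow> cmod (Q z $$ (j, j)) = cmod (\<phi>2 z)"
    using diag_pick[OF ij(2)] by blast
  obtain \<phi>3 where 3: "pick \<phi>3" 
    "\<And>z. z \<in> UHP \<Longrightarrow> cmod (Q z $$ (i, i) * Q z $$ (j, j) - Q z $$ (i, j) * Q z $$ (j, i)) = (cmod (\<phi>3 z))\<^sup>2"
    using offdiag_pick[OF ij False] by blast
  have ab: "cmod (Q z $$ (i, j)) * cmod (Q z $$ (j, i)) \<le> cmod (\<phi>1 z) * cmod (\<phi>2 z) + (cmod (\<phi>3 z))\<^sup>2" if z: "z \<in> UHP" for z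
    using norm_triangle_ineq4[of "Q z $$ (i, i) * Q z $$ (j, j)" "Q z $$ (i, i) * Q z $$ (j, j) - Q z $$ (i, j) * Q z $$ (j, i)"]
    unfolding 1(2)[OF z, symmetric] 2(2)[OF z, symmetric] 3(2)[OF z, symmetric] by (simp add: norm_mult)
  obtain C0 where "\<forall>\<^sub>F \<eta> in at_top. cmod (Q (\<i> * of_real \<eta>) $$ (i, j)) \<le> C0 * \<eta>"
    using entry_growth[OF ij] by blast
  from offdiagonal_bound[OF entry_hol_UHP[OF ij] entry_bounded_quotient[OF ij] 1(1) 2(1) 3(1) ab entry_reflection[OF ij] this]
  show thesis
    using that by blast
qed

lemma diag_res_exists:
  assumes "i < n"
  obtains c where "((\<lambda>z. (of_real x - z) * Q z $$ (i, i)) \<longlongrightarrow> c) (at (of_real x))"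
proof -
  note s = single_index[OF assms]
  obtain c where "((\<lambda>z. (of_real x - z) ^ 1 * minor_fun Q [i] z) \<longlongrightarrow> c) (at (of_real x))"
    using bounded_argument_limit[OF minor_fun_real_meromorphic[OF s] arg1[OF assms]] by blast
  then have "((\<lambda>z. (of_real x - z) * Q z $$ (i, i)) \<longlongrightarrow> c) (at (of_real x))"
    by (rule Lim_transform_eventually)
      (use minor_fun_eventually[OF s, of "of_real x"] in \<open>auto simp: minor_1 elim: eventually_mono\<close>)
  then show thesis
    by (rule that)
qed

lemma det_res_exists:
  assumes "i < n" "j < n" "i \<noteq> j"
  obtains c where "((\<lambda>z. (of_real x - z)\<^sup>2 * (Q z $$ (i, i) * Q z $$ (j, j) - Q z $$ (i, j) * Q z $$ (j, i))) \<longlongrightarrow> c) (at (of_real x))"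
proof -
  have *: "\<exists>c. ((\<lambda>z. (of_real x - z)\<^sup>2 * (Q z $$ (i, i) * Q z $$ (j, j) - Q z $$ (i, j) * Q z $$ (j, i))) \<longlongrightarrow> c) (at (of_real x))"
    if ij: "i < j" "j < n" for i j
  proof -
    note s = double_index[OF ij]
    obtain c where "((\<lambda>z. (of_real x - z)\<^sup>2 * minor_fun Q [i, j] z) \<longlongrightarrow> c) (at (of_real x))"
      using bounded_argument_limit[OF minor_fun_real_meromorphic[OF s] arg2[OF ij]] by auto
    then have "((\<lambda>z. (of_real x - z)\<^sup>2 * minor [i, j] z) \<longlongrightarrow> c) (at (of_real x))"
      by (rule Lim_transform_eventually)
        (use minor_fun_eventually[OF s, of "of_real x"] in \<open>auto elim: eventually_mono\<close>)
    then show ?thesis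
      by (auto simp: minor_2)
  qed
  show thesis
  proof (cases "i < j")
    case True
    then show thesis
      using *[of i j] assms that by blast
  next
    case False
    then obtain c where "((\<lambda>z. (of_real x - z)\<^sup>2 * (Q z $$ (j, j) * Q z $$ (i, i) - Q z $$ (j, i) * Q z $$ (i, j))) \<longlongrightarrow> c) (at (of_real x))"
      using *[of j i] assms by auto
    then show thesis
      by (intro that[of c]) (simp add: mult.commute)
  qed
qed

text \<open>The product of g and its transposed counterpart converges, by the limits for the
  diagonal entries and the minor. Reflection bounds the square of g by twice this product, though
  only from the half plane. That suffices: at a pole the modulus would tend to infinity from every
  direction.\<close>

lemma res_exists:
  assumes ij: "i < n" "j < n"
  shows "\<exists>c. ((\<lambda>z. (of_real x - z) * Q z $$ (i, j)) \<longlongrightarrow> c) (at (of_real x))"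
proof (cases "i = j")
  case True
  then show ?thesis
    using diag_res_exists[OF ij(1), of x] by blast
next
  case False
  define X :: complex where "X = of_real x"
  define g where "g = (\<lambda>z. (X - z) * Q z $$ (i, j))"
  obtain c1 where c1: "((\<lambda>z. (X - z) * Q z $$ (i, i)) \<longlongrightarrow> c1) (at X)"
    unfolding X_def using diag_res_exists[OF ij(1)] by blast
  obtain c2 where c2: "((\<lambda>z. (X - z) * Q z $$ (j, j)) \<longlongrightarrow> c2) (at X)"
    unfolding X_def using diag_res_exists[OF ij(2)] by blast
  obtain c3 where c3: "((\<lambda>z. (X - z)\<^sup>2 * (Q z $$ (i, i) * Q z $$ (j, j) - Q z $$ (i, j) * Q z $$ (j, i))) \<longlongrightarrow> c3) (at X)"
    unfolding X_def using det_res_exists[OF ij False] by blast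
  have "((\<lambda>z. (X - z) * Q z $$ (i, i) * ((X - z) * Q z $$ (j, j)) - (X - z)\<^sup>2 * (Q z $$ (i, i) * Q z $$ (j, j) - Q z $$ (i, j) * Q z $$ (j, i))) \<longlongrightarrow> c1 * c2 - c3) (at X)"
    by (intro tendsto_intros c1 c2 c3)
  then have "((\<lambda>z. g z * ((X - z) * Q z $$ (j, i))) \<longlongrightarrow> c1 * c2 - c3) (at X)"
    by (simp add: g_def algebra_simps power2_eq_square)
  then have lim: "((\<lambda>z. cmod (g z * ((X - z) * Q z $$ (j, i)))) \<longlongrightarrow> cmod (c1 * c2 - c3)) (at X within UHP)"
    by (intro tendsto_norm) (auto intro: tendsto_within_subset)
  define M where "M = cmod (c1 * c2 - c3) + 1"
  have "\<forall>\<^sub>F z in at X within UHP. cmod (g z * ((X - z) * Q z $$ (j, i))) < M"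
    by (rule order_tendstoD(2)[OF lim]) (simp add: M_def)
  then have bd: "\<forall>\<^sub>F z in at X within UHP. (cmod (g z))\<^sup>2 < 2 * M"
    using entry_reflection[OF ij, of x, folded X_def]
  proof eventually_elim
    case (elim z)
    have "(cmod (g z))\<^sup>2 = cmod (g z) * (cmod (X - z) * cmod (Q z $$ (i, j)))"
      by (simp add: g_def power2_eq_square norm_mult)
    also have "\<dots> \<le> cmod (g z) * (cmod (X - z) * (2 * cmod (Q z $$ (j, i))))"
      using elim by (intro mult_left_mono) auto
    also have "\<dots> = 2 * cmod (g z * ((X - z) * Q z $$ (j, i)))"
      by (simp add: norm_mult)
    finally show ?case
      using elim by linarith
  qed
  have "g meromorphic_on {X}"
    unfolding g_def by (intro meromorphic_intros entry_mer ij)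
  then have "not_essential g X"
    by (simp add: meromorphic_at_iff)
  moreover have "\<not> is_pole g X"
  proof
    assume "is_pole g X"
    then have "filterlim g at_infinity (at X within UHP)"
      unfolding is_pole_def by (rule filterlim_mono) (auto simp: at_le)
    then have "filterlim (\<lambda>z. cmod (g z)) at_top (at X within UHP)"
      by (rule filterlim_at_infinity_imp_norm_at_top)
    then have "\<forall>\<^sub>F z in at X within UHP. cmod (g z) \<ge> 2 * M + 1"
      by (simp add: filterlim_at_top)
    with bd have "\<forall>\<^sub>F z in at X within UHP. False"
    proof eventually_elim
      case (elim z)
      have "1 \<le> M"
        by (simp add: M_def)
      then have "1 \<le> cmod (g z)"
        using elim by linarith
      then have "cmod (g z) * 1 \<le> (cmod (g z))\<^sup>2"
        unfolding power2_eq_square by (intro mult_left_mono) auto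
      then show ?case
        using elim by linarith
    qed
    then show False
      by (simp add: X_def)
  qed
  ultimately show ?thesis
    unfolding not_essential_def g_def X_def by blast
qed

lemma res_tendsto:
  assumes "i < n" "j < n"
  shows "((\<lambda>z. (of_real x - z) * Q z $$ (i, j)) \<longlongrightarrow> res x i j) (at (of_real x))"
proof -
  obtain c where c: "((\<lambda>z. (of_real x - z) * Q z $$ (i, j)) \<longlongrightarrow> c) (at (of_real x))"
    using res_exists[OF assms, of x] by blast
  then have "res x i j = c"
    unfolding res_def by (rule tendsto_Lim[OF at_neq_bot])
  with c show ?thesis
    by simp
qed

lemma res_hermitian:
  assumes "i < n" "j < n"
  shows "res x i j = cnj (res x j i)"
proof (rule limit_at_real_cnj[where x = x and g = "\<lambda>z. (of_real x - z) * Q z $$ (j, i)" and h = "\<lambda>z. (of_real x - z) * Q z $$ (i, j)"])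
  show "((\<lambda>z. (of_real x - z) * Q z $$ (j, i)) \<longlongrightarrow> res x j i) (at (of_real x))"
    by (rule res_tendsto[OF assms(2,1)])
  show "((\<lambda>z. (of_real x - z) * Q z $$ (i, j)) \<longlongrightarrow> res x i j) (at (of_real x))"
    by (rule res_tendsto[OF assms])
  fix z assume "z \<in> UHP"
  then show "(of_real x - cnj z) * Q (cnj z) $$ (i, j) = cnj ((of_real x - z) * Q z $$ (j, i))"
    using entry_sym[OF UHP_nonreal assms] by simp
qed

lemma mat_residue_eq:
  assumes "i < n" "j < n"
  shows "residue (\<lambda>w. Q w $$ (i, j)) (of_real x) = - res x i j"
proof -
  obtain r where r: "r > 0" "(\<lambda>w. Q w $$ (i, j)) analytic_on ball (of_real x) r - {of_real x}"
    using entry_mer[OF assms, of "{of_real x}"] unfolding meromorphic_at_iff isolated_singularity_at_def by blast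
  show ?thesis
  proof (rule residue_simple'[of "ball (of_real x) r"])
    show "(\<lambda>w. Q w $$ (i, j)) holomorphic_on ball (of_real x) r - {of_real x}"
      using r(2) by (rule analytic_imp_holomorphic)
    show "((\<lambda>w. Q w $$ (i, j) * (w - of_real x)) \<longlongrightarrow> - res x i j) (at (of_real x))"
      using tendsto_minus[OF res_tendsto[OF assms, of x]] by (simp add: algebra_simps)
  qed (use r in auto)
qed

lemma neg_mat_residue_psd_iff: "psd n (- mat_residue n Q (of_real x)) \<longleftrightarrow> (\<forall>v. 0 \<le> qform n (res x) v)"
proof -
  have c: "- mat_residue n Q (of_real x) \<in> carrier_mat n n"
    by (simp add: mat_residue_def)
  have "qform n (entries (- mat_residue n Q (of_real x))) v = qform n (res x) v" for v
    by (rule qform_cong) (auto simp: mat_residue_def mat_residue_eq)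
  then show ?thesis
    unfolding psd_iff_qform[OF c] by simp
qed

lemma res_not_pole:
  assumes "of_real x \<notin> mat_poles n Q" "i < n" "j < n"
  shows "res x i j = 0"
proof -
  have "\<not> is_pole (\<lambda>z. Q z $$ (i, j)) (of_real x)"
    using assms unfolding mat_poles_def by auto
  then have "(\<lambda>z. Q z $$ (i, j)) analytic_on {of_real x}"
    using nicely_meromorphic_on_imp_analytic_at[OF entry_nice[OF assms(2,3)]] by simp
  then have "isCont (\<lambda>z. Q z $$ (i, j)) (of_real x)"
    by (rule analytic_at_imp_isCont)
  then have "((\<lambda>z. (of_real x - z) * Q z $$ (i, j)) \<longlongrightarrow> (of_real x - of_real x) * Q (of_real x) $$ (i, j)) (at (of_real x))"
    by (intro tendsto_intros) (simp add: isCont_def)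
  then have "((\<lambda>z. (of_real x - z) * Q z $$ (i, j)) \<longlongrightarrow> 0) (at (of_real x))"
    by simp
  then show ?thesis
    by (rule tendsto_unique[OF at_neq_bot res_tendsto[OF assms(2,3)]])
qed

text \<open>At a real point that is not a pole \<open>res\<close> vanishes, so the condition at the
  poles may be stated at all real points.\<close>

lemma residues_nsd_iff: "residues_nsd n Q \<longleftrightarrow> (\<forall>x v. 0 \<le> qform n (res x) v)"
proof
  assume r: "residues_nsd n Q"
  show "\<forall>x v. 0 \<le> qform n (res x) v"
  proof (intro allI)
    fix x v
    show "0 \<le> qform n (res x) v"
    proof (cases "of_real x \<in> mat_poles n Q")
      case True
      then show ?thesis
        using r neg_mat_residue_psd_iff unfolding residues_nsd_def by blast
    next
      case False
      then have "qform n (res x) v = 0"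
        by (simp add: qform_def res_not_pole)
      then show ?thesis
        by simp
    qed
  qed
next
  assume r: "\<forall>x v. 0 \<le> qform n (res x) v"
  show "residues_nsd n Q"
    unfolding residues_nsd_def
  proof
    fix z assume "z \<in> mat_poles n Q"
    then obtain x where "z = of_real x"
      using poles by (metis Reals_cases subsetD)
    then show "psd n (- mat_residue n Q z)"
      using r neg_mat_residue_psd_iff by blast
  qed
qed

lemma form_res_tendsto:
  "((\<lambda>z. (of_real x - z) * qform n (entries (Q z)) v) \<longlongrightarrow> qform n (res x) v) (at (of_real x))"
proof -
  have "((\<lambda>z. qform n (\<lambda>i j. (of_real x - z) * Q z $$ (i, j)) v) \<longlongrightarrow> qform n (res x) v) (at (of_real x))"
    by (intro qform_tendsto res_tendsto)
  then show ?thesis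
    unfolding qform_scale_matrix .
qed

lemma form_hol: "(\<lambda>z. qform n (entries (Q z)) v) holomorphic_on - \<real>"
  by (rule qform_holomorphic) (rule entry_hol)

lemma form_hol_UHP: "(\<lambda>z. qform n (entries (Q z)) v) holomorphic_on UHP"
  by (rule qform_holomorphic) (rule entry_hol_UHP)

lemma form_mer: "(\<lambda>z. qform n (entries (Q z)) v) meromorphic_on A"
  by (rule qform_meromorphic) (rule entry_mer)

lemma form_sym: "z \<notin> \<real> \<Longrightarrow> qform n (entries (Q (cnj z))) v = cnj (qform n (entries (Q z)) v)"
  using qform_symmetric[of n "\<lambda>z. entries (Q z)" z v] entry_sym by simp

lemma form_bound:
  obtains C where "C \<ge> 0" "\<And>z. z \<in> UHP \<Longrightarrow> cmod (qform n (entries (Q z)) v) \<le> C * (cmod (z + \<i>))\<^sup>2 / Im z"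
proof -
  have "\<exists>C. C \<ge> 0 \<and> (\<forall>z\<in>UHP. cmod (Q z $$ (i, j)) \<le> C * (cmod (z + \<i>))\<^sup>2 / Im z)" if "i < n" "j < n" for i j
    using entry_bound[OF that] by metis
  then obtain K where K: "\<And>i j. i < n \<Longrightarrow> j < n \<Longrightarrow> K i j \<ge> 0"
    "\<And>i j z. i < n \<Longrightarrow> j < n \<Longrightarrow> z \<in> UHP \<Longrightarrow> cmod (Q z $$ (i, j)) \<le> K i j * (cmod (z + \<i>))\<^sup>2 / Im z"
    by metis
  define C where "C = (\<Sum>i<n. \<Sum>j<n. cmod (v i) * K i j * cmod (v j))"
  show thesis
  proof (rule that[of C])
    show "C \<ge> 0"
      unfolding C_def using K(1) by (intro sum_nonneg) auto
    fix z assume z: "z \<in> UHP"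
    define D where "D = (cmod (z + \<i>))\<^sup>2 / Im z"
    have "cmod (qform n (entries (Q z)) v) \<le> (\<Sum>i<n. \<Sum>j<n. cmod (v i) * (K i j * D) * cmod (v j))"
      unfolding qform_def
    proof (intro sum_norm_le)
      fix i j assume "i \<in> {..<n}" "j \<in> {..<n}"
      then have "cmod (Q z $$ (i, j)) \<le> K i j * D"
        using K(2)[OF _ _ z] by (simp add: D_def)
      then show "cmod (cnj (v i) * Q z $$ (i, j) * v j) \<le> cmod (v i) * (K i j * D) * cmod (v j)"
        by (simp add: norm_mult mult_left_mono mult_right_mono)
    qed
    also have "\<dots> = C * D"
      unfolding C_def sum_distrib_right by (intro sum.cong refl) (simp only: mult_ac)
    finally show "cmod (qform n (entries (Q z)) v) \<le> C * (cmod (z + \<i>))\<^sup>2 / Im z"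
      by (simp add: D_def)
  qed
qed

end

lemma qform_diff: "qform n (\<lambda>i j. A i j - B i j) v = qform n A v - qform n B v"
  unfolding qform_def by (simp add: sum_subtractf left_diff_distrib right_diff_distrib)

lemma nonneg_complex_eq_of_real: "0 \<le> c \<Longrightarrow> c = complex_of_real (Re c) \<and> 0 \<le> Re c"
  by (simp add: less_eq_complex_def complex_eq_iff)

section \<open>Nonnegative residue forms and the linear term at infinity\<close>

locale psd_residue_matrix = bounded_argument_matrix +
  assumes res_psd: "\<And>x v. 0 \<le> qform n (res x) v"
begin

lemma slope_exists:
  "\<exists>b. (\<forall>z\<in>UHP. b * Im z \<le> Im (qform n (entries (Q z)) v)) \<and>
    ((\<lambda>\<eta>::real. qform n (entries (Q (\<i> * of_real \<eta>))) v / (\<i> * of_real \<eta>)) \<longlongrightarrow> of_real b) at_top"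
proof -
  obtain C where C: "C \<ge> 0" "\<And>z. z \<in> UHP \<Longrightarrow> cmod (qform n (entries (Q z)) v) \<le> C * (cmod (z + \<i>))\<^sup>2 / Im z"
    using form_bound[of v] by blast
  show ?thesis
  proof (rule herglotz_up_to_linear_term[where F = "\<lambda>z. qform n (entries (Q z)) v" and C = C])
    show "\<exists>\<rho>\<ge>0. ((\<lambda>z. (of_real x - z) * qform n (entries (Q z)) v) \<longlongrightarrow> of_real \<rho>) (at (of_real x))" for x
    proof (intro exI conjI)
      note r = nonneg_complex_eq_of_real[OF res_psd[of x v]]
      then show "0 \<le> Re (qform n (res x) v)"
        by simp
      show "((\<lambda>z. (of_real x - z) * qform n (entries (Q z)) v) \<longlongrightarrow> of_real (Re (qform n (res x) v))) (at (of_real x))"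
        using form_res_tendsto[of x v] r by metis
    qed
    show "qform n (entries (Q (cnj z))) v = cnj (qform n (entries (Q z)) v)" if "z \<in> UHP" for z
      by (rule form_sym[OF UHP_nonreal[OF that]])
  qed (use C form_hol_UHP form_mer in \<open>auto simp del: UHP_iff\<close>)
qed

text \<open>Turns out to be the value at v of the Hermitian form with matrix \<open>lead\<close>. It
  is introduced vector by vector, because the scalar theory gives limits of forms first; limits of
  entries follow by polarization.\<close>

definition slope :: "(nat \<Rightarrow> complex) \<Rightarrow> real" where
  "slope v = (SOME b. (\<forall>z\<in>UHP. b * Im z \<le> Im (qform n (entries (Q z)) v)) \<and>
    ((\<lambda>\<eta>::real. qform n (entries (Q (\<i> * of_real \<eta>))) v / (\<i> * of_real \<eta>)) \<longlongrightarrow> of_real b) at_top)"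

lemma slope_le: "z \<in> UHP \<Longrightarrow> slope v * Im z \<le> Im (qform n (entries (Q z)) v)"
  and slope_tendsto: "((\<lambda>\<eta>::real. qform n (entries (Q (\<i> * of_real \<eta>))) v / (\<i> * of_real \<eta>)) \<longlongrightarrow> of_real (slope v)) at_top"
  using someI_ex[OF slope_exists[of v]] unfolding slope_def by blast+

text \<open>Once the residue forms are nonnegative, the slopes are the only remaining obstruction to
  the Herglotz property.\<close>

lemma herglotz_of_slope:
  assumes "\<And>v. 0 \<le> slope v"
  shows "herglotz n Q"
  unfolding herglotz_iff[of Q n, OF carrier] herglotz_family_def
proof (intro conjI allI impI ballI)
  fix z v assume z: "z \<in> UHP"
  have "0 \<le> slope v * Im z"
    using assms z by simp
  then show "0 \<le> Im (qform n (entries (Q z)) v)"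
    using slope_le[OF z, of v] by linarith
qed (auto intro: entry_hol entry_sym)

lemma slope_nonneg:
  assumes "herglotz n Q"
  shows "0 \<le> slope v"
proof -
  have "\<forall>\<^sub>F \<eta>::real in at_top. 0 \<le> Re (qform n (entries (Q (\<i> * of_real \<eta>))) v / (\<i> * of_real \<eta>))"
    using eventually_gt_at_top[of 0]
  proof eventually_elim
    case (elim \<eta>)
    then have "0 \<le> Im (qform n (entries (Q (\<i> * of_real \<eta>))) v)"
      using assms unfolding herglotz_iff[of Q n, OF carrier] herglotz_family_def by simp
    then show ?case
      using elim by (simp add: Re_divide power2_eq_square zero_le_mult_iff)
  qed
  then have "0 \<le> Re (complex_of_real (slope v))"
    by (intro tendsto_lowerbound[OF tendsto_Re[OF slope_tendsto[of v]]]) auto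
  then show ?thesis
    by simp
qed

definition lead :: "nat \<Rightarrow> nat \<Rightarrow> complex" where
  "lead i j = Lim at_top (\<lambda>\<eta>::real. Q (\<i> * of_real \<eta>) $$ (i, j) / (\<i> * of_real \<eta>))"

text \<open>The form of the scaled matrix converges at every vector, and polarization expresses each
  entry as a fixed combination of such values.\<close>

lemma lead_tendsto:
  assumes "i < n" "j < n"
  shows "((\<lambda>\<eta>::real. Q (\<i> * of_real \<eta>) $$ (i, j) / (\<i> * of_real \<eta>)) \<longlongrightarrow> lead i j) at_top"
proof -
  define A where "A = (\<lambda>(\<eta>::real) i j. Q (\<i> * of_real \<eta>) $$ (i, j) / (\<i> * of_real \<eta>))"
  have form: "((\<lambda>\<eta>. qform n (A \<eta>) v) \<longlongrightarrow> of_real (slope v)) at_top" for v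
  proof -
    have "qform n (A \<eta>) v = qform n (entries (Q (\<i> * of_real \<eta>))) v / (\<i> * of_real \<eta>)" for \<eta>
      using qform_scale_matrix[of n "1 / (\<i> * of_real \<eta>)" "entries (Q (\<i> * of_real \<eta>))" v] by (simp add: A_def)
    then show ?thesis
      using slope_tendsto[of v] by simp
  qed
  have diag: "\<exists>c. ((\<lambda>\<eta>. A \<eta> i i) \<longlongrightarrow> c) at_top" if "i < n" for i
    using form[of "\<lambda>k. if k = i then 1 else 0"] unfolding qform_unit[OF that] by blast
  have "\<exists>c. ((\<lambda>\<eta>. A \<eta> i j) \<longlongrightarrow> c) at_top"
  proof (cases "i = j")
    case True
    then show ?thesis
      using diag[OF assms(1)] by simp
  next
    case False
    obtain c1 c2 where c: "((\<lambda>\<eta>. A \<eta> i i) \<longlongrightarrow> c1) at_top" "((\<lambda>\<eta>. A \<eta> j j) \<longlongrightarrow> c2) at_top"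
      using diag assms by blast
    define p1 p2 where "p1 = (\<lambda>k. if k = i then 1 else if k = j then 1 else 0 :: complex)"
      and "p2 = (\<lambda>k. if k = i then 1 else if k = j then \<i> else 0)"
    have "((\<lambda>\<eta>. (qform n (A \<eta>) p1 - \<i> * qform n (A \<eta>) p2 - (1 - \<i>) * (A \<eta> i i + A \<eta> j j)) / 2)
        \<longlongrightarrow> (of_real (slope p1) - \<i> * of_real (slope p2) - (1 - \<i>) * (c1 + c2)) / 2) at_top"
      by (intro tendsto_intros form c) auto
    moreover have "(qform n (A \<eta>) p1 - \<i> * qform n (A \<eta>) p2 - (1 - \<i>) * (A \<eta> i i + A \<eta> j j)) / 2 = A \<eta> i j" for \<eta>
      unfolding p1_def p2_def by (rule polarization[OF assms False, symmetric])
    ultimately show ?thesis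
      by auto
  qed
  then obtain c where c: "((\<lambda>\<eta>. A \<eta> i j) \<longlongrightarrow> c) at_top"
    by blast
  then have "lead i j = c"
    unfolding lead_def A_def by (intro tendsto_Lim) auto
  with c show ?thesis
    by (simp add: A_def)
qed

lemma qform_lead: "qform n lead v = of_real (slope v)"
proof -
  have "((\<lambda>\<eta>::real. qform n (\<lambda>i j. Q (\<i> * of_real \<eta>) $$ (i, j) / (\<i> * of_real \<eta>)) v) \<longlongrightarrow> qform n lead v) at_top"
    by (intro qform_tendsto lead_tendsto)
  moreover have "qform n (\<lambda>i j. Q (\<i> * of_real \<eta>) $$ (i, j) / (\<i> * of_real \<eta>)) v = qform n (entries (Q (\<i> * of_real \<eta>))) v / (\<i> * of_real \<eta>)" for \<eta> :: real
    using qform_scale_matrix[of n "1 / (\<i> * of_real \<eta>)" "entries (Q (\<i> * of_real \<eta>))" v] by simp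
  ultimately have "((\<lambda>\<eta>::real. qform n (entries (Q (\<i> * of_real \<eta>))) v / (\<i> * of_real \<eta>)) \<longlongrightarrow> qform n lead v) at_top"
    by simp
  then show ?thesis
    using slope_tendsto[of v] by (intro tendsto_unique[OF trivial_limit_at_top_linorder])
qed

text \<open>The form of \<open>lead\<close> is real-valued, so the form of its difference with the
  adjoint vanishes, and a vanishing complex form has vanishing entries.\<close>

lemma lead_hermitian:
  assumes "i < n" "j < n"
  shows "lead i j = cnj (lead j i)"
proof -
  have "qform n (\<lambda>i j. lead i j - cnj (lead j i)) v = 0" for v
    using qform_cnj[of n lead v] by (simp add: qform_diff qform_lead)
  from qform_eq_0_imp[of n "\<lambda>i j. lead i j - cnj (lead j i)", OF this assms] show ?thesis
    by simp
qed

text \<open>Division by \<open>\<i> * of_real \<eta>\<close> turns imaginary into real parts: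
  \<open>mat_Im\<close> of Q divided by \<eta> is the Hermitian part of the scaled matrix, whose
  limit is already Hermitian.\<close>

lemma Im_growth_tendsto:
  assumes "i < n" "j < n"
  shows "((\<lambda>\<eta>::real. mat_Im (Q (\<i> * of_real \<eta>)) $$ (i, j) / of_real \<eta>) \<longlongrightarrow> lead i j) at_top"
proof (rule Lim_transform_eventually)
  have "((\<lambda>\<eta>::real. (Q (\<i> * of_real \<eta>) $$ (i, j) / (\<i> * of_real \<eta>) + cnj (Q (\<i> * of_real \<eta>) $$ (j, i) / (\<i> * of_real \<eta>))) / 2)
     \<longlongrightarrow> (lead i j + cnj (lead j i)) / 2) at_top"
    by (intro tendsto_intros lead_tendsto assms) auto
  then show "((\<lambda>\<eta>::real. (Q (\<i> * of_real \<eta>) $$ (i, j) / (\<i> * of_real \<eta>) + cnj (Q (\<i> * of_real \<eta>) $$ (j, i) / (\<i> * of_real \<eta>))) / 2)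
     \<longlongrightarrow> lead i j) at_top"
    unfolding lead_hermitian[OF assms, symmetric] by simp
  show "\<forall>\<^sub>F \<eta>::real in at_top. (Q (\<i> * of_real \<eta>) $$ (i, j) / (\<i> * of_real \<eta>) + cnj (Q (\<i> * of_real \<eta>) $$ (j, i) / (\<i> * of_real \<eta>))) / 2
      = mat_Im (Q (\<i> * of_real \<eta>)) $$ (i, j) / of_real \<eta>"
    using eventually_gt_at_top[of 0]
  proof eventually_elim
    case (elim \<eta>)
    have "(a / (\<i> * e) + b / (- \<i> * e)) / 2 = (a - b) / (2 * \<i>) / e" if "e \<noteq> 0" for a b e :: complex
      using that by (simp add: field_simps)
    then show ?case
      using elim by (simp add: mat_Im_index[OF carrier assms])
  qed
qed

lemma Im_growth_limit_lead: "Im_growth_limit n Q (mat n n (\<lambda>(i, j). lead i j))"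
  unfolding Im_growth_limit_def using Im_growth_tendsto by auto

lemma psd_lead_iff:
  assumes "Im_growth_limit n Q D"
  shows "psd n D \<longleftrightarrow> (\<forall>v. 0 \<le> slope v)"
proof -
  have D: "D \<in> carrier_mat n n"
    using assms by (simp add: Im_growth_limit_def)
  have "D $$ (i, j) = lead i j" if "i < n" "j < n" for i j
    using assms that Im_growth_tendsto[OF that] unfolding Im_growth_limit_def
    by (intro tendsto_unique[OF trivial_limit_at_top_linorder, of _ "D $$ (i, j)" "lead i j"]) auto
  then have "qform n (entries D) v = of_real (slope v)" for v
    using qform_cong[of n "entries D" lead v v] by (simp add: qform_lead)
  then show ?thesis
    unfolding psd_iff_qform[OF D] by (simp add: less_eq_complex_def)
qed

lemma minor_leading_limit:
  assumes "idx \<in> index_tuples n m"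
  shows "leading_limit m (minor_fun Q idx) (fdet m (\<lambda>k l. lead (idx ! k) (idx ! l)))"
  unfolding leading_limit_def
proof (rule Lim_transform_eventually)
  show "((\<lambda>\<eta>::real. fdet m (\<lambda>k l. Q (\<i> * of_real \<eta>) $$ (idx ! k, idx ! l) / (\<i> * of_real \<eta>))) \<longlongrightarrow> fdet m (\<lambda>k l. lead (idx ! k) (idx ! l))) at_top"
    by (intro fdet_tendsto lead_tendsto idx_lt[OF assms])
  show "\<forall>\<^sub>F \<eta>::real in at_top. fdet m (\<lambda>k l. Q (\<i> * of_real \<eta>) $$ (idx ! k, idx ! l) / (\<i> * of_real \<eta>)) = minor_fun Q idx (\<i> * of_real \<eta>) / (\<i> * of_real \<eta>) ^ m"
    using eventually_gt_at_top[of 0]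
  proof eventually_elim
    case (elim \<eta>)
    then have "\<i> * complex_of_real \<eta> \<notin> \<real>"
      by (simp add: complex_is_Real_iff)
    then have "minor_fun Q idx (\<i> * of_real \<eta>) = fdet m (\<lambda>k l. Q (\<i> * of_real \<eta>) $$ (idx ! k, idx ! l))"
      by (simp add: minor_fun_nonreal[OF assms] minor_def idx_length[OF assms])
    then show ?case
      using fdet_scale[of m "1 / (\<i> * of_real \<eta>)" "\<lambda>k l. Q (\<i> * of_real \<eta>) $$ (idx ! k, idx ! l)"]
      by (simp add: power_one_over divide_simps)
  qed
qed

end

section \<open>The implications between the three conditions\<close>

context meromorphic_matrix
begin

lemma index_tuples_principal:
  assumes "sorted_wrt (<) idx" "set idx \<subseteq> {..<n}" "idx \<noteq> []"
  shows "length idx \<in> {1..n}" "idx \<in> index_tuples n (length idx)"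
proof -
  have "distinct idx"
    using assms(1) by (simp add: strict_sorted_iff)
  then have "length idx = card (set idx)"
    by (simp add: distinct_card)
  also have "\<dots> \<le> n"
    using card_mono[OF _ assms(2)] by simp
  finally show "length idx \<in> {1..n}"
    using assms(3) by (simp add: Suc_le_eq)
  show "idx \<in> index_tuples n (length idx)"
    using assms by (auto simp: index_tuples_def)
qed

lemma herglotz_bounded_argument_matrix:
  assumes "herglotz n Q"
  shows "bounded_argument_matrix n Q"
proof unfold_locales
  show "bounded_argument 1 (minor_fun Q [i])" if "i < n" for i
    using minor_cond_imp(1)[OF single_index[OF that]] herglotz_imp_prop_b[OF single_index[OF that] assms] by auto
  show "bounded_argument 2 (minor_fun Q [i, j])" if "i < j" "j < n" for i j
    using minor_cond_imp(1)[OF double_index[OF that]] herglotz_imp_prop_b[OF double_index[OF that] assms] by auto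
qed

text \<open>For fixed v the form of Q is a scalar Herglotz function, that is, a product with a
  single factor; its limits at real points are therefore nonnegative and equal the residue form at
  v.\<close>

lemma herglotz_psd_residue_matrix:
  assumes "herglotz n Q"
  shows "psd_residue_matrix n Q"
proof -
  interpret bounded_argument_matrix n Q
    by (rule herglotz_bounded_argument_matrix[OF assms])
  show ?thesis
  proof unfold_locales
    fix x v
    define F where "F = (\<lambda>z. qform n (entries (Q z)) v)"
    define f where "f = remove_sings F"
    have f: "f z = F z" if "z \<notin> \<real>" for z
      unfolding f_def
    proof (rule remove_sings_at_analytic)
      show "F analytic_on {z}"
        unfolding F_def by (rule analytic_at_nonreal[OF form_hol that])
    qed
    have rm: "real_meromorphic f"
      unfolding real_meromorphic_def
    proof (intro conjI allI impI)
      show "f nicely_meromorphic_on UNIV"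
        unfolding f_def F_def by (rule remove_sings_nicely_meromorphic) (rule form_mer)
      show "f holomorphic_on - \<real>"
        using form_hol[of v] by (rule holomorphic_transform) (simp add: f F_def)
      show "f (cnj z) = cnj (f z)" if "z \<notin> \<real>" for z
        using that form_sym[OF that, of v] by (simp add: f F_def)
    qed
    have "0 \<le> Im (f z)" if "z \<in> UHP" for z
      using assms that f[OF UHP_nonreal[OF that]] unfolding herglotz_iff[of Q n, OF carrier] herglotz_family_def F_def by simp
    then have "scalar_meromorphic_herglotz f"
      using rm unfolding scalar_meromorphic_herglotz_iff real_meromorphic_def by blast
    then have "prop_b 1 f"
      unfolding prop_b_def by (intro exI[of _ "\<lambda>_. f"]) auto
    then have "nonneg_limits 1 f"
      using prop_b_bounded_log[OF rm] zero_nonneg_limits[OF rm] bounded_log_0_nonneg_limits by metis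
    then obtain L where L: "L \<ge> 0" "((\<lambda>z. (of_real x - z) * f z) \<longlongrightarrow> of_real L) (at (of_real x))"
      by (auto simp: nonneg_limits_def)
    have "\<forall>\<^sub>F z in at (of_real x). f z = F z"
      unfolding f_def by (rule eventually_remove_sings_eq_at)
        (use form_mer[of v "{of_real x}"] in \<open>simp add: meromorphic_at_iff F_def\<close>)
    then have "\<forall>\<^sub>F z in at (of_real x). (of_real x - z) * f z = (of_real x - z) * F z"
      by eventually_elim simp
    then have "((\<lambda>z. (of_real x - z) * F z) \<longlongrightarrow> of_real L) (at (of_real x))"
      by (rule Lim_transform_eventually[OF L(2)])
    then have "qform n (res x) v = of_real L"
      using form_res_tendsto[of x v] unfolding F_def by (intro tendsto_unique[OF at_neq_bot])
    then show "0 \<le> qform n (res x) v"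
      using L(1) by (simp add: less_eq_complex_def)
  qed
qed

lemma small_minors_bounded_argument_matrix:
  assumes "small_minors_condition n Q"
  shows "bounded_argument_matrix n Q"
proof -
  have *: "bounded_argument (length idx) (minor_fun Q idx)" if "idx \<in> index_tuples n 1 \<union> index_tuples n 2" for idx
  proof -
    have idx: "idx \<in> index_tuples n (length idx)"
      using that by (auto simp: index_tuples_iff)
    have "interlacing_or_zero UNIV (length idx) (minor_fun Q idx)"
      using assms that by (auto simp: small_minors_condition_def)
    then show ?thesis
      unfolding interlacing_or_zero_def
    proof
      assume "interlacing UNIV (length idx) (minor_fun Q idx)"
      then show ?thesis
        using interlacing_bounded_log[OF minor_fun_real_meromorphic[OF idx] minor_fun_bounded_quotient[OF idx]]
        unfolding bounded_argument_def by metis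
    qed (simp add: bounded_argument_def)
  qed
  show ?thesis
  proof unfold_locales
    show "bounded_argument 1 (minor_fun Q [i])" if "i < n" for i
      using *[of "[i]"] single_index[OF that] by simp
    show "bounded_argument 2 (minor_fun Q [i, j])" if "i < j" "j < n" for i j
      using *[of "[i, j]"] double_index[OF that] by (simp add: numeral_2_eq_2)
  qed
qed

lemma small_minors_psd_residue_matrix:
  assumes "small_minors_condition n Q" "residues_nsd n Q"
  shows "psd_residue_matrix n Q"
proof -
  interpret bounded_argument_matrix n Q
    by (rule small_minors_bounded_argument_matrix[OF assms(1)])
  show ?thesis
    using assms(2) residues_nsd_iff by unfold_locales blast
qed

text \<open>Scaling a minor of order m by the m-th power of \<open>of_real x - z\<close> scales
  every entry by that factor once. So the principal minors of the residue matrix are limits of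
  scaled minors of Q, which (ii) makes nonnegative.\<close>

lemma minors_psd_residue_matrix:
  assumes "minors_condition n Q"
  shows "psd_residue_matrix n Q"
proof -
  have c: "prop_a m (minor_fun Q idx) \<or> prop_b m (minor_fun Q idx) \<or> prop_c m (minor_fun Q idx)"
    if "m \<in> {1..n}" "idx \<in> index_tuples n m" for idx m
    using assms that unfolding minors_condition_def by blast
  interpret bounded_argument_matrix n Q
  proof unfold_locales
    show "bounded_argument 1 (minor_fun Q [i])" if "i < n" for i
      using minor_cond_imp(1)[OF single_index[OF that]] c[OF _ single_index[OF that]] that by auto
    show "bounded_argument 2 (minor_fun Q [i, j])" if "i < j" "j < n" for i j
      using minor_cond_imp(1)[OF double_index[OF that]] c[OF _ double_index[OF that]] that by auto
  qed
  show ?thesis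
  proof unfold_locales
    fix x v
    show "0 \<le> qform n (res x) v"
    proof (rule psd_from_principal_minors)
      show "res x i j = cnj (res x j i)" if "i < n" "j < n" for i j
        by (rule res_hermitian[OF that])
      fix idx :: "nat list" assume s: "sorted_wrt (<) idx" "set idx \<subseteq> {..<n}"
      show "0 \<le> fdet (length idx) (\<lambda>k l. res x (idx ! k) (idx ! l))"
      proof (cases "idx = []")
        case False
        define m where "m = length idx"
        note idx = index_tuples_principal[OF s False, folded m_def]
        have "nonneg_limits m (minor_fun Q idx)"
          using minor_cond_imp(2)[OF idx(2) c[OF idx]] idx(1) by simp
        then obtain L where L: "L \<ge> 0" "((\<lambda>z. (of_real x - z) ^ m * minor_fun Q idx z) \<longlongrightarrow> of_real L) (at (of_real x))"
          by (auto simp: nonneg_limits_def)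
        have "\<forall>\<^sub>F z in at (of_real x). (of_real x - z) ^ m * minor_fun Q idx z = fdet m (\<lambda>k l. (of_real x - z) * Q z $$ (idx ! k, idx ! l))"
          using minor_fun_eventually[OF idx(2), of "of_real x"]
          by eventually_elim (simp add: minor_def fdet_scale m_def)
        then have "((\<lambda>z. fdet m (\<lambda>k l. (of_real x - z) * Q z $$ (idx ! k, idx ! l))) \<longlongrightarrow> of_real L) (at (of_real x))"
          by (rule Lim_transform_eventually[OF L(2)])
        moreover have "((\<lambda>z. fdet m (\<lambda>k l. (of_real x - z) * Q z $$ (idx ! k, idx ! l))) \<longlongrightarrow> fdet m (\<lambda>k l. res x (idx ! k) (idx ! l))) (at (of_real x))"
          by (intro fdet_tendsto res_tendsto idx_lt[OF idx(2)])
        ultimately have "fdet m (\<lambda>k l. res x (idx ! k) (idx ! l)) = of_real L"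
          by (intro tendsto_unique[OF at_neq_bot])
        then show ?thesis
          using L(1) by (simp add: m_def less_eq_complex_def)
      qed (simp add: less_eq_complex_def)
    qed
  qed
qed

text \<open>The same argument at infinity: the principal minors of \<open>lead\<close> are the
  leading coefficients of the minors of Q, so \<open>lead\<close> is positive semi-definite and all
  slopes are nonnegative.\<close>

lemma minors_imp_herglotz:
  assumes "minors_condition n Q"
  shows "herglotz n Q"
proof -
  interpret psd_residue_matrix n Q
    by (rule minors_psd_residue_matrix[OF assms])
  have "0 \<le> qform n lead v" for v
  proof (rule psd_from_principal_minors)
    show "lead i j = cnj (lead j i)" if "i < n" "j < n" for i j
      by (rule lead_hermitian[OF that])
    fix idx :: "nat list" assume s: "sorted_wrt (<) idx" "set idx \<subseteq> {..<n}"
    show "0 \<le> fdet (length idx) (\<lambda>k l. lead (idx ! k) (idx ! l))"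
    proof (cases "idx = []")
      case False
      note idx = index_tuples_principal[OF s False]
      have "prop_a (length idx) (minor_fun Q idx) \<or> prop_b (length idx) (minor_fun Q idx) \<or> prop_c (length idx) (minor_fun Q idx)"
        using assms idx unfolding minors_condition_def by blast
      then obtain L where L: "L \<ge> 0" "leading_limit (length idx) (minor_fun Q idx) (of_real L)"
        using minor_cond_imp(3)[OF idx(2)] idx(1) by auto
      have "fdet (length idx) (\<lambda>k l. lead (idx ! k) (idx ! l)) = of_real L"
        using minor_leading_limit[OF idx(2)] L(2) unfolding leading_limit_def
        by (intro tendsto_unique[OF trivial_limit_at_top_linorder])
      then show ?thesis
        using L(1) by (simp add: less_eq_complex_def)
    qed (simp add: less_eq_complex_def)
  qed
  then have "0 \<le> slope v" for v
    by (simp add: qform_lead less_eq_complex_def)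
  then show ?thesis
    by (rule herglotz_of_slope)
qed

lemma herglotz_nonzero_minor_log:
  assumes "herglotz n Q" "idx \<in> index_tuples n m" "\<not> (\<forall>z. minor_fun Q idx z = 0)"
  obtains u where "bounded_log_real_meromorphic (minor_fun Q idx) u 0 m"
proof -
  note rm = minor_fun_real_meromorphic[OF assms(2)]
  have "\<not> (\<forall>z\<in>UHP. minor_fun Q idx z = 0)"
    using real_meromorphic_zero[OF rm] assms(3) by blast
  then show thesis
    using prop_b_bounded_log[OF rm herglotz_imp_prop_b[OF assms(2,1)]] that by blast
qed

lemma herglotz_imp_small_minors:
  assumes "herglotz n Q"
  shows "small_minors_condition n Q"
proof -
  have *: "interlacing_or_zero UNIV m (minor_fun Q idx) \<and> pole_sign_condition m (minor_fun Q idx)"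
    if idx: "idx \<in> index_tuples n m" and m: "m \<ge> 1" for idx m
  proof (cases "\<forall>z. minor_fun Q idx z = 0")
    case True
    then have z: "minor_fun Q idx = (\<lambda>_. 0)"
      by auto
    have "\<not> is_pole (\<lambda>_. 0 :: complex) w" for w :: complex
      by (rule analytic_at_imp_no_pole) auto
    then show ?thesis
      unfolding z by (simp add: interlacing_or_zero_def pole_sign_condition_def has_pole_of_mult_def)
  next
    case False
    then obtain u where "bounded_log_real_meromorphic (minor_fun Q idx) u 0 m"
      using herglotz_nonzero_minor_log[OF assms idx] by blast
    from bounded_log_0_imp_prop_a[OF this m] show ?thesis
      by (simp add: interlacing_or_zero_def prop_a_def)
  qed
  show ?thesis
    unfolding small_minors_condition_def
  proof (intro conjI ballI)
    fix idx assume "idx \<in> index_tuples n 1 \<union> index_tuples n 2"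
    then show "interlacing_or_zero UNIV (length idx) (minor_fun Q idx)"
      using *[of idx 1] *[of idx 2] idx_length[of idx 1] idx_length[of idx 2] by auto
  next
    fix idx assume "idx \<in> index_tuples n 2"
    then show "pole_sign_condition 2 (minor_fun Q idx)"
      using *[of idx 2] by auto
  qed
qed

text \<open>In the backward direction the minors and residues supply the slopes, and any limit D
  coincides with \<open>lead\<close> by uniqueness of limits, so its positivity is that of all
  slopes.\<close>

lemma herglotz_iff_small_minors:
  "herglotz n Q \<longleftrightarrow> small_minors_condition n Q \<and> residues_nsd n Q \<and> (\<exists>D. Im_growth_limit n Q D \<and> psd n D)"
proof
  assume h: "herglotz n Q"
  interpret psd_residue_matrix n Q
    by (rule herglotz_psd_residue_matrix[OF h])
  have "psd n (mat n n (\<lambda>(i, j). lead i j))"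
    using psd_lead_iff[OF Im_growth_limit_lead] slope_nonneg[OF h] by blast
  then show "small_minors_condition n Q \<and> residues_nsd n Q \<and> (\<exists>D. Im_growth_limit n Q D \<and> psd n D)"
    using herglotz_imp_small_minors[OF h] residues_nsd_iff res_psd Im_growth_limit_lead by blast
next
  assume a: "small_minors_condition n Q \<and> residues_nsd n Q \<and> (\<exists>D. Im_growth_limit n Q D \<and> psd n D)"
  then interpret psd_residue_matrix n Q
    by (intro small_minors_psd_residue_matrix) auto
  show "herglotz n Q"
    using a psd_lead_iff herglotz_of_slope by blast
qed

lemma herglotz_iff_minors: "herglotz n Q \<longleftrightarrow> minors_condition n Q"
  using minors_imp_herglotz herglotz_imp_prop_b unfolding minors_condition_def by blast

lemma interlacing_imp_leading_limit:
  assumes "idx \<in> index_tuples n m" "m \<ge> 1" "interlacing UNIV m (minor_fun Q idx)"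
  shows "\<exists>L. leading_limit m (minor_fun Q idx) L"
proof -
  obtain u N where "bounded_log_real_meromorphic (minor_fun Q idx) u N m"
    by (rule interlacing_bounded_log[OF minor_fun_real_meromorphic[OF assms(1)] minor_fun_bounded_quotient[OF assms(1)] assms(3)])
  then interpret bounded_log_real_meromorphic "minor_fun Q idx" u N m .
  show ?thesis
    using leading_limit_exists[OF assms(2)] by blast
qed

lemma small_minors_imp_growth_limit:
  assumes "small_minors_condition n Q" "residues_nsd n Q"
  shows "\<exists>D. Im_growth_limit n Q D"
proof -
  interpret psd_residue_matrix n Q
    by (rule small_minors_psd_residue_matrix[OF assms])
  show ?thesis
    using Im_growth_limit_lead by blast
qed

lemma herglotz_imp_all_props:
  assumes "herglotz n Q" "idx \<in> index_tuples n m" "m \<ge> 1" "\<not> minor_fun Q idx constant_on UNIV"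
  shows "prop_a m (minor_fun Q idx) \<and> prop_b m (minor_fun Q idx) \<and> prop_c m (minor_fun Q idx)"
proof -
  have "\<not> (\<forall>z. minor_fun Q idx z = 0)"
    using assms(4) by (auto simp: constant_on_def)
  then obtain u where u: "bounded_log_real_meromorphic (minor_fun Q idx) u 0 m"
    using herglotz_nonzero_minor_log[OF assms(1,2)] by blast
  show ?thesis
    using bounded_log_0_imp_prop_a[OF u assms(3)] herglotz_imp_prop_b[OF assms(2,1)]
      bounded_log_0_imp_prop_c[OF u assms(4)] by blast
qed

end

text \<open>The two conjuncts after the equivalences make precise that the limits in (a) and in
  (iii) exist: each follows from the other requirements of the same condition.\<close>

theorem theorem4p3:
  fixes n :: nat and Q :: "complex \<Rightarrow> complex mat"
  defines "cond_i \<equiv> herglotz n Q"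
    and "cond_ii \<equiv> minors_condition n Q"
    and "cond_iii \<equiv> small_minors_condition n Q \<and> residues_nsd n Q \<and>
                    (\<exists>D. Im_growth_limit n Q D \<and> psd n D)"
  assumes "1 \<le> n"
    and "mat_meromorphic n Q"
    and "mat_poles n Q \<subseteq> \<real>"
    and "sharp_real_on (- mat_poles n Q) Q"
    and "mat_bounded_type n Q"
    and "Limsup at_top (\<lambda>\<eta>::real. ereal (frobenius_norm (Q (\<i> * of_real \<eta>)) / \<eta>)) < \<infinity>"
  shows "(cond_i \<longleftrightarrow> cond_ii) \<and> (cond_i \<longleftrightarrow> cond_iii) \<and>
    (\<forall>m \<in> {1..n}. \<forall>idx \<in> index_tuples n m.
       interlacing UNIV m (minor_fun Q idx) \<and> pole_sign_condition m (minor_fun Q idx) \<longrightarrow>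
       (\<exists>L. leading_limit m (minor_fun Q idx) L)) \<and>
    (small_minors_condition n Q \<and> residues_nsd n Q \<longrightarrow> (\<exists>D. Im_growth_limit n Q D)) \<and>
    (cond_i \<and> cond_ii \<and> cond_iii \<longrightarrow>
       (\<forall>m \<in> {1..n}. \<forall>idx \<in> index_tuples n m. \<not> minor_fun Q idx constant_on UNIV \<longrightarrow>
          prop_a m (minor_fun Q idx) \<and> prop_b m (minor_fun Q idx) \<and> prop_c m (minor_fun Q idx)))"
proof -
  interpret meromorphic_matrix n Q
    by unfold_locales (fact assms)+
  show ?thesis
    unfolding cond_i_def cond_ii_def cond_iii_def
  proof (intro conjI impI ballI)
    show "herglotz n Q \<longleftrightarrow> minors_condition n Q"
      by (rule herglotz_iff_minors)
    show "herglotz n Q \<longleftrightarrow> small_minors_condition n Q \<and> residues_nsd n Q \<and> (\<exists>D. Im_growth_limit n Q D \<and> psd n D)"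
      by (rule herglotz_iff_small_minors)
  next
    fix m idx
    assume "m \<in> {1..n}" "idx \<in> index_tuples n m"
      "interlacing UNIV m (minor_fun Q idx) \<and> pole_sign_condition m (minor_fun Q idx)"
    then show "\<exists>L. leading_limit m (minor_fun Q idx) L"
      using interlacing_imp_leading_limit by auto
  next
    assume "small_minors_condition n Q \<and> residues_nsd n Q"
    then show "\<exists>D. Im_growth_limit n Q D"
      using small_minors_imp_growth_limit by blast
  next
    fix m idx
    assume h: "herglotz n Q \<and> minors_condition n Q \<and> small_minors_condition n Q \<and> residues_nsd n Q \<and>
        (\<exists>D. Im_growth_limit n Q D \<and> psd n D)"
      and m: "m \<in> {1..n}" "idx \<in> index_tuples n m" and nc: "\<not> minor_fun Q idx constant_on UNIV"
    have "prop_a m (minor_fun Q idx) \<and> prop_b m (minor_fun Q idx) \<and> prop_c m (minor_fun Q idx)"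
      using h m by (intro herglotz_imp_all_props[OF _ m(2) _ nc]) auto
    then show "prop_a m (minor_fun Q idx)" "prop_b m (minor_fun Q idx)" "prop_c m (minor_fun Q idx)"
      by auto
  qed
qed

end
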